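(* Let $N\ge 1$, $Z>0$, let $V$ be the atomic Coulomb potential on $\mathbb{R}^{3N}$ and $H=-\Delta+V$ the corresponding $N$-electron Hamilton operator, and let $\psi\in L^2(\mathbb{R}^{3N})$ be a real-valued normalised eigenfunction of $H$: $(H-E)\psi=0$ for some $E\in\mathbb{R}$, $\|\psi\|_{L^2(\mathbb{R}^{3N})}=1$. Then for every $R\in(0,\infty)$ there exists a constant $C=C(R)$ such that $$\sup_{\mathbf{y}\in B(\mathbf{x},R)}|\nabla\psi(\mathbf{y})|\le C\sup_{\mathbf{y}\in B(\mathbf{x},2R)}|\psi(\mathbf{y})|\qquad\text{for all }\mathbf{x}\in\mathbb{R}^{3N}.$$
   Context: Write $\mathbf{x}=(x_1,\ldots,x_N)\in\mathbb{R}^{3N}$ with $x_j\in\mathbb{R}^3$. The atomic Coulomb potential (nucleus of charge $Z$ at the origin, $N$ electrons) is $$V(\mathbf{x})=-\sum_{j=1}^N\frac{Z}{|x_j|}+\sum_{1\le j<k\le N}\frac{1}{|x_j-x_k|}.$$ $\Delta=\sum_{j=1}^N\Delta_j$ is the Laplacian on $\mathbb{R}^{3N}$, and $H=-\Delta+V$ is the self-adjoint operator on $L^2(\mathbb{R}^{3N})$ with quadratic form domain $W^{1,2}(\mathbb{R}^{3N})$. It is known that such a $\psi$ lies in $W^{2,2}(\mathbb{R}^{3N})$, is continuous (its continuous representative is used) with bounded first derivatives, and is real analytic away from the singularities of $V$. Thus $\nabla\psi$ is defined almost everywhere (in particular off the singular set of $V$), and the supremum of $|\nabla\psi|$ is the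 essential supremum. $B(\mathbf{x},R)$ is the open ball of radius $R$ centred at $\mathbf{x}$ in $\mathbb{R}^{3N}$. *)

theory Defs
  imports "HOL-Analysis.Analysis" "HOL-Probability.Essential_Supremum"
begin

section \<open>Weak derivatives and Sobolev spaces on a Euclidean space\<close>

text \<open>Elements of \<open>L2\<close> are functions, not classes modulo null sets; all notions below that
  are built on \<open>L2\<close> are invariant under changes on null sets.\<close>

definition L2 :: "('a::euclidean_space \<Rightarrow> complex) set" where
  "L2 = {f. f \<in> borel_measurable lebesgue \<and> integrable lebesgue (\<lambda>x. (cmod (f x))\<^sup>2)}"

definition L2_inner :: "('a::euclidean_space \<Rightarrow> complex) \<Rightarrow> ('a \<Rightarrow> complex) \<Rightarrow> complex" where
  "L2_inner f g = (LINT x|lebesgue. f x * cnj (g x))"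

definition L2_norm :: "('a::euclidean_space \<Rightarrow> complex) \<Rightarrow> real" where
  "L2_norm f = sqrt (LINT x|lebesgue. (cmod (f x))\<^sup>2)"

definition partial_deriv ::
  "'a::euclidean_space \<Rightarrow> ('a \<Rightarrow> real) \<Rightarrow> 'a \<Rightarrow> real" where
  "partial_deriv b f x = frechet_derivative f (at x) b"

primrec C_k :: "nat \<Rightarrow> ('a::euclidean_space \<Rightarrow> real) \<Rightarrow> bool" where
  "C_k 0 f \<longleftrightarrow> continuous_on UNIV f"
| "C_k (Suc k) f \<longleftrightarrow>
     (\<forall>x. f differentiable (at x)) \<and> (\<forall>b\<in>Basis. C_k k (partial_deriv b f))"

definition test_function :: "('a::euclidean_space \<Rightarrow> real) \<Rightarrow> bool" where
  "test_function \<phi> \<longleftrightarrow> (\<forall>k. C_k k \<phi>) \<and> compact (closure {x. \<phi> x \<noteq> 0})"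

definition has_weak_partial ::
  "'a::euclidean_space \<Rightarrow> ('a \<Rightarrow> complex) \<Rightarrow> ('a \<Rightarrow> complex) \<Rightarrow> bool" where
  "has_weak_partial b u g \<longleftrightarrow>
     (\<forall>\<phi>. test_function \<phi> \<longrightarrow>
        (LINT x|lebesgue. partial_deriv b \<phi> x *\<^sub>R u x) = - (LINT x|lebesgue. \<phi> x *\<^sub>R g x))"

definition W12 :: "('a::euclidean_space \<Rightarrow> complex) set" where
  "W12 = {u \<in> L2. \<forall>b\<in>Basis. \<exists>g\<in>L2. has_weak_partial b u g}"

text \<open>The weak partial derivative is unique up to null sets, so the choice is immaterial.\<close>

definition weak_partial ::
  "'a::euclidean_space \<Rightarrow> ('a \<Rightarrow> complex) \<Rightarrow> 'a \<Rightarrow> complex" where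
  "weak_partial b u = (SOME g. g \<in> L2 \<and> has_weak_partial b u g)"


section \<open>The atomic Schroedinger operator\<close>

text \<open>The electrons are indexed by a finite linearly ordered type \<open>'n\<close>, so \<open>N = CARD('n) \<ge> 1\<close>.
  The norm and the Lebesgue measure of this type are the Euclidean ones.\<close>

type_synonym 'n config = "((real, 3) vec, 'n) vec"

text \<open>On the null set where two particles collide the quotients below take the value 0
  by the convention \<open>1 / 0 = 0\<close>.\<close>

definition coulomb_potential :: "real \<Rightarrow> 'n::{finite,linorder} config \<Rightarrow> real" where
  "coulomb_potential Z x =
     - (\<Sum>j\<in>UNIV. Z / norm (x $ j)) + (\<Sum>(j, k)\<in>{(j, k). j < k}. 1 / norm (x $ j - x $ k))"

text \<open>The quadratic form of \<open>- \<Delta> + V\<close>. By Hardy's inequality all integrands are integrable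
  for \<open>u\<close> and \<open>v\<close> in \<open>W12\<close>.\<close>

definition energy_form ::
  "real \<Rightarrow> ('n::{finite,linorder} config \<Rightarrow> complex) \<Rightarrow> ('n config \<Rightarrow> complex) \<Rightarrow> complex" where
  "energy_form Z u v =
     (\<Sum>b\<in>Basis. L2_inner (weak_partial b u) (weak_partial b v))
     + (LINT x|lebesgue. complex_of_real (coulomb_potential Z x) * u x * cnj (v x))"

text \<open>The graph of the self-adjoint operator associated (by the representation theorem for closed
  semibounded forms) with \<open>energy_form Z\<close> on the form domain \<open>W12\<close>:
  \<open>(u, f) \<in> hamiltonian Z\<close> means that \<open>u\<close> is in the operator domain and \<open>H u = f\<close>.\<close>

definition hamiltonian ::
  "real \<Rightarrow> (('n::{finite,linorder} config \<Rightarrow> complex) \<times> ('n config \<Rightarrow> complex)) set" where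
  "hamiltonian Z = {(u, f). u \<in> W12 \<and> f \<in> L2 \<and> (\<forall>v\<in>W12. energy_form Z u v = L2_inner f v)}"


section \<open>The classical gradient\<close>

text \<open>Meaningful only at points of differentiability.\<close>

definition gradient :: "('a::euclidean_space \<Rightarrow> real) \<Rightarrow> 'a \<Rightarrow> 'a" where
  "gradient f x = (THE D. GDERIV f x :> D)"

end

theory Submission
  imports Defs
begin

text \<open>
  Testing the eigenvalue equation with smooth functions gives \<open>\<Delta> \<psi> = (V - E) \<psi>\<close> in the sense of
  distributions. If \<open>\<Delta> g = f\<close>, the derivative in \<open>t\<close> of the average of \<open>g\<close> at scale \<open>t\<close> around \<open>x\<close> (taken with a
  suitable smooth bump) is \<open>t\<close> times a similar average of \<open>f\<close>. The averages of \<open>|V|\<close> at scale \<open>t\<close> are \<open>O(1/t)\<close>, so \<open>\<psi>\<close>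
  differs from its average at scale \<open>t\<close> by \<open>O(t)\<close> times the local supremum \<open>M\<close> of \<open>|\<psi>|\<close>; with \<open>t\<close> of order
  \<open>|x - z| ^ (1/2)\<close> this yields \<open>|\<psi> x - \<psi> z| \<le> C M |x - z| ^ (1/2)\<close>.

  The function \<open>F = - Z/2 \<Sum> |x_j| + 1/4 \<Sum> |x_j - x_k|\<close> is Lipschitz and satisfies \<open>\<Delta> F = V\<close>. For fixed \<open>x\<close> the
  function \<open>w = \<psi> - \<psi>(x) (F - F(x))\<close> has Laplacian \<open>V (\<psi> - \<psi>(x)) - E \<psi>\<close>, and by the Hoelder bound the averages
  of this around \<open>x\<close> are only \<open>O(M t ^ (-1/2))\<close>. Integrating over the scales shows that \<open>w\<close> differs from its average
  at scale \<open>T\<close> by a function with increments at most \<open>C M T ^ (1/2) |z - x|\<close> at \<open>x\<close>. Letting \<open>T\<close> tend to \<open>0\<close>,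
  \<open>w\<close> is differentiable at \<open>x\<close>; for fixed \<open>T\<close> one gets \<open>|\<psi> z - \<psi> x| \<le> C M |z - x|\<close>. So \<open>\<psi>\<close> is differentiable wherever
  \<open>F\<close> is, that is, off the collision set, and its gradient is bounded by \<open>C M\<close>.
\<close>


section \<open>Smooth functions\<close>

text \<open>The obstacle is a logarithm. Averages of \<open>V \<psi>\<close> at scale
  \<open>s\<close> are only \<open>O(M / s)\<close>. Comparing two centres at distance
  \<open>d\<close> gains a factor \<open>d / s\<close>, and with the weight \<open>s\<close> of the
  scale derivative this leaves \<open>d / s\<close>, whose integral from \<open>d\<close> to
  \<open>T\<close> is \<open>d log (T / d)\<close>, just short of Lipschitz. Any Hoelder exponent a
  > 0 repairs this, since it turns \<open>d / s\<close> into \<open>d s^(a - 1)\<close>; the value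
  1/2 is what one balancing of two errors yields. The correction subtracts \<open>F\<close> with its
  coefficient frozen at the point \<open>x\<close>. Dividing \<psi> by \<open>exp F\<close> instead
  would create a first order term with the unknown gradient. The coefficients of \<open>F\<close>
  come from \<Delta> |x_j| = 2 / |x_j| and \<Delta> |x_j - x_k| = 4 / |x_j - x_k|. The bound
  \<open>O(1/t)\<close> for averages of the potential holds with one constant for all centres, and
  \<open>M\<close> enters every estimate linearly; this is why the final constant does not depend on
  \<open>x\<close>.\<close>

lemmas frechet_derivative_worksI = frechet_derivative_works[THEN iffD1]

lemma partial_deriv_eq: "(f has_derivative f') (at x) \<Longrightarrow> partial_deriv b f x = f' b"
  unfolding partial_deriv_def by (metis frechet_derivative_at)

lemma partial_deriv_works:
  "f differentiable (at x) \<Longrightarrow> (f has_derivative (\<lambda>h. \<Sum>b\<in>Basis. (h \<bullet> b) * partial_deriv b f x)) (at x)"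
proof -
  assume "f differentiable (at x)"
  then have d: "(f has_derivative frechet_derivative f (at x)) (at x)"
    by (rule frechet_derivative_worksI)
  have lin: "linear (frechet_derivative f (at x))" by (rule has_derivative_linear[OF d])
  have "frechet_derivative f (at x) h = (\<Sum>b\<in>Basis. (h \<bullet> b) * partial_deriv b f x)" for h
  proof -
    have "frechet_derivative f (at x) h = frechet_derivative f (at x) (\<Sum>b\<in>Basis. (h \<bullet> b) *\<^sub>R b)"
      by (simp only: euclidean_representation)
    also have "\<dots> = (\<Sum>b\<in>Basis. (h \<bullet> b) * partial_deriv b f x)"
      by (simp add: linear_sum[OF lin] linear_scale[OF lin] partial_deriv_def)
    finally show ?thesis .
  qed
  then have "frechet_derivative f (at x) = (\<lambda>h. \<Sum>b\<in>Basis. (h \<bullet> b) * partial_deriv b f x)" by blast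
  with d show ?thesis by simp
qed

lemma has_derivative_differentiable: "(f has_derivative f') F \<Longrightarrow> f differentiable F"
  unfolding differentiable_def by blast

lemma C_k_SucD: "C_k (Suc k) f \<Longrightarrow> C_k k f"
proof (induction k arbitrary: f)
  case 0
  then show ?case
    by (auto intro!: continuous_at_imp_continuous_on differentiable_imp_continuous_within)
qed auto

lemma C_k_const: "C_k k (\<lambda>x. c)"
proof (induction k arbitrary: c)
  case (Suc k)
  have "partial_deriv b (\<lambda>x. c) = (\<lambda>x. 0)" for b :: 'a
    by (auto intro!: ext partial_deriv_eq[where f'="\<lambda>h. 0", simplified])
  with Suc show ?case by auto
qed auto

lemma partial_deriv_add:
  "f differentiable at x \<Longrightarrow> g differentiable at x \<Longrightarrow>
    partial_deriv b (\<lambda>x. f x + g x) x = partial_deriv b f x + partial_deriv b g x"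
  unfolding partial_deriv_def
  by (subst partial_deriv_eq[unfolded partial_deriv_def, OF has_derivative_add])
     (auto intro: frechet_derivative_worksI)

lemma partial_deriv_mult:
  "f differentiable at x \<Longrightarrow> g differentiable at x \<Longrightarrow>
    partial_deriv b (\<lambda>x. f x * g x) x = f x * partial_deriv b g x + partial_deriv b f x * g x"
  unfolding partial_deriv_def
  by (subst partial_deriv_eq[unfolded partial_deriv_def, OF has_derivative_mult])
     (auto intro: frechet_derivative_worksI)

lemma C_k_add: "C_k k f \<Longrightarrow> C_k k g \<Longrightarrow> C_k k (\<lambda>x. f x + g x)"
proof (induction k arbitrary: f g)
  case 0 then show ?case by (auto intro: continuous_intros)
next
  case (Suc k)
  then have "partial_deriv b (\<lambda>x. f x + g x) = (\<lambda>x. partial_deriv b f x + partial_deriv b g x)" for b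
    by (auto simp: partial_deriv_add)
  with Suc show ?case by auto
qed

lemma C_k_mult: "C_k k f \<Longrightarrow> C_k k g \<Longrightarrow> C_k k (\<lambda>x. f x * g x)"
proof (induction k arbitrary: f g)
  case 0 then show ?case by (auto intro: continuous_intros)
next
  case (Suc k)
  then have "partial_deriv b (\<lambda>x. f x * g x)
      = (\<lambda>x. f x * partial_deriv b g x + partial_deriv b f x * g x)" for b
    by (auto simp: partial_deriv_mult)
  moreover have "C_k k f" "C_k k g" using Suc.prems C_k_SucD by auto
  ultimately show ?case using Suc by (auto intro!: C_k_add)
qed

lemma C_k_prod: "finite A \<Longrightarrow> (\<And>i. i \<in> A \<Longrightarrow> C_k k (f i)) \<Longrightarrow> C_k k (\<lambda>x. \<Prod>i\<in>A. f i x)"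
  by (induction A rule: finite_induct) (auto intro: C_k_const C_k_mult)

lemma C_k_inner: "C_k k (\<lambda>x. x \<bullet> v)"
proof (cases k)
  case (Suc m)
  have d: "((\<lambda>x. x \<bullet> v) has_derivative (\<lambda>h. h \<bullet> v)) (at x)" for x :: 'a
    by (auto intro!: derivative_eq_intros)
  then have "partial_deriv b (\<lambda>x. x \<bullet> v) = (\<lambda>x. b \<bullet> v)" for b
    by (auto intro!: partial_deriv_eq)
  with d Suc show ?thesis by (auto intro: C_k_const has_derivative_differentiable)
qed (auto intro: continuous_intros)

lemma C_k_diff: "C_k k f \<Longrightarrow> C_k k g \<Longrightarrow> C_k k (\<lambda>x. f x - g x)"
  using C_k_add[of k f "\<lambda>x. (-1) * g x"] C_k_mult[OF C_k_const[of k "-1"], of g] by simp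

lemma C_k_norm_sq: "C_k k (\<lambda>y. (norm (y - x))\<^sup>2)"
proof -
  have "C_k k (\<lambda>y. \<Sum>b\<in>A. (y \<bullet> b - x \<bullet> b) * (y \<bullet> b - x \<bullet> b))" if "finite A" for A
    using that by (induction A rule: finite_induct)
      (auto intro!: C_k_add C_k_mult C_k_diff C_k_const C_k_inner)
  from this[OF finite_Basis]
  show ?thesis unfolding power2_norm_eq_inner
    by (subst euclidean_inner) (simp add: inner_diff_left)
qed

text \<open>The outer function comes as a whole chain \<open>G 0, G 1, ...\<close> of successive
  derivatives: one differentiation of \<open>G i (q y)\<close> produces
  \<open>G (Suc i) (q y)\<close>, so the induction on \<open>k\<close> must run for all
  \<open>i\<close> at once.\<close>

lemma C_k_compose:
  assumes G: "\<And>i t. (G i has_real_derivative G (Suc i) t) (at t)" and q: "\<And>k. C_k k q"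
  shows "C_k k (\<lambda>y. G i (q y))"
proof (induction k arbitrary: i)
  case 0
  have "continuous_on UNIV (G i)"
    using G by (auto intro!: continuous_at_imp_continuous_on DERIV_isCont)
  then show ?case using q[of 0] by (auto intro: continuous_on_compose2)
next
  case (Suc k)
  have d: "((\<lambda>y. G i (q y)) has_derivative (\<lambda>h. frechet_derivative q (at y) h * G (Suc i) (q y))) (at y)" for y
    using q[of 1] by (intro has_derivative_compose[OF frechet_derivative_worksI]
      G[unfolded has_field_derivative_def, THEN has_derivative_eq_rhs]) auto
  then have "partial_deriv b (\<lambda>y. G i (q y)) = (\<lambda>y. partial_deriv b q y * G (Suc i) (q y))" for b
    by (auto simp: partial_deriv_def[of b q] intro!: partial_deriv_eq)
  moreover have "C_k k (partial_deriv b q)" if "b \<in> Basis" for b using q[of "Suc k"] that by auto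
  ultimately show ?case using d Suc by (auto intro!: C_k_mult has_derivative_differentiable)
qed

section \<open>A smooth bump\<close>

text \<open>The derivative of \<open>p (1/t) * exp (-1/t)\<close> is
  \<open>(1/t)^2 * (p (1/t) - p' (1/t)) * exp (-1/t)\<close>; the recursion is this rule in the
  variable \<open>1/t\<close>.\<close>

primrec bump_poly :: "nat \<Rightarrow> real poly" where
  "bump_poly 0 = 1"
| "bump_poly (Suc i) = [:0, 0, 1:] * (bump_poly i - pderiv (bump_poly i))"

text \<open>The successive derivatives of \<open>exp (-1 / t)\<close>, extended by \<open>0\<close> to \<open>t \<le> 0\<close>.\<close>

definition bump :: "nat \<Rightarrow> real \<Rightarrow> real" where
  "bump i t = (if t \<le> 0 then 0 else poly (bump_poly i) (1 / t) * exp (- (1 / t)))"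

lemma bump_nonpos [simp]: "t \<le> 0 \<Longrightarrow> bump i t = 0"
  by (simp add: bump_def)

lemma poly_times_exp_minus_tendsto_0: "((\<lambda>x::real. poly p x * exp (- x)) \<longlongrightarrow> 0) at_top"
proof -
  have *: "((\<lambda>x::real. x ^ i * exp (- x)) \<longlongrightarrow> 0) at_top" for i
    using tendsto_power_div_exp_0[of i] by (simp add: exp_minus field_simps)
  have "((\<lambda>x::real. \<Sum>i\<le>degree p. coeff p i * (x ^ i * exp (- x))) \<longlongrightarrow> (\<Sum>i\<le>degree p. coeff p i * 0)) at_top"
    by (intro tendsto_intros *)
  then show ?thesis by (simp add: poly_altdef sum_distrib_right mult.assoc)
qed

text \<open>Since every \<open>bump i\<close> vanishes at 0, this quotient is the difference
  quotient there. From the right, with \<open>1/t\<close> as variable, it is a polynomial times a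
  decaying exponential.\<close>

lemma bump_div_tendsto: "((\<lambda>t. bump i t / t) \<longlongrightarrow> 0) (at 0)"
proof (rule filterlim_split_at_real)
  have "((\<lambda>t. bump i t / t) \<longlongrightarrow> 0) (at_left 0) \<longleftrightarrow> ((\<lambda>t. 0::real) \<longlongrightarrow> 0) (at_left (0::real))"
    by (intro tendsto_cong) (auto simp: eventually_at_left_field intro: exI[of _ "-1"])
  then show "((\<lambda>t. bump i t / t) \<longlongrightarrow> 0) (at_left 0)" by simp
  have "((\<lambda>t::real. poly ([:0, 1:] * bump_poly i) (inverse t) * exp (- inverse t)) \<longlongrightarrow> 0) (at_right 0)"
    by (rule filterlim_compose[OF poly_times_exp_minus_tendsto_0 filterlim_inverse_at_top_right])
  moreover have "eventually (\<lambda>t. poly ([:0, 1:] * bump_poly i) (inverse t) * exp (- inverse t) = bump i t / t) (at_right 0)"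
    by (auto simp: eventually_at_right_field bump_def inverse_eq_divide intro!: exI[of _ 1])
  ultimately show "((\<lambda>t. bump i t / t) \<longlongrightarrow> 0) (at_right 0)"
    using tendsto_cong by fast
qed

lemma bump_deriv: "(bump i has_real_derivative bump (Suc i) t) (at t)"
proof -
  consider "t < 0" | "t = 0" | "t > 0" by linarith
  then show ?thesis
  proof cases
    case 1
    have "((\<lambda>t. 0) has_real_derivative 0) (at t)" by simp
    then have "(bump i has_real_derivative 0) (at t)"
      by (rule has_field_derivative_transform_within_open[where S="{..<0}"]) (use 1 in auto)
    then show ?thesis using 1 by simp
  next
    case 2
    then show ?thesis using bump_div_tendsto by (simp add: has_field_derivative_iff)
  next
    case 3
    have "((\<lambda>t. poly (bump_poly i) (1 / t) * exp (- (1 / t))) has_real_derivative bump (Suc i) t) (at t)"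
      using 3 by (auto intro!: derivative_eq_intros poly_DERIV[THEN DERIV_chain2]
        simp: bump_def power2_eq_square field_simps)
    then show ?thesis
      by (rule has_field_derivative_transform_within_open[where S="{0<..}"]) (use 3 in \<open>auto simp: bump_def\<close>)
  qed
qed

lemma continuous_on_bump: "continuous_on S (bump i)"
  using bump_deriv by (auto intro!: continuous_at_imp_continuous_on DERIV_isCont)

lemmas continuous_on_bump' [continuous_intros] = continuous_on_compose2[OF continuous_on_bump[of UNIV]]

lemma bump_0: "t > 0 \<Longrightarrow> bump 0 t = exp (- (1 / t))"
  and bump_1: "t > 0 \<Longrightarrow> bump (Suc 0) t = exp (- (1 / t)) / t\<^sup>2"
  by (auto simp: bump_def power2_eq_square one_pCons pderiv_pCons field_simps)

text \<open>These two profiles serve as weights. The next one, \<open>bump 2\<close>, changes sign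
  at \<open>t = 1/2\<close> and is only ever bounded in absolute value.\<close>

lemma bump_0_nonneg: "bump 0 t \<ge> 0" and bump_1_nonneg: "bump (Suc 0) t \<ge> 0"
  by (cases "t > 0"; simp add: bump_0 bump_1)+

section \<open>Test functions and their supports\<close>

lemma test_functionI:
  assumes "\<And>k. C_k k f" "\<And>x. x \<notin> cball a r \<Longrightarrow> f x = 0"
  shows "test_function f"
proof -
  have "closure {x. f x \<noteq> 0} \<subseteq> cball a r"
    using assms(2) by (intro closure_minimal) (auto simp del: mem_cball)
  then show ?thesis using assms(1)
    by (auto simp: test_function_def compact_eq_bounded_closed intro: bounded_subset[OF bounded_cball])
qed

lemma test_function_cball:
  assumes "test_function f" obtains r where "r > 0" "\<And>x. x \<notin> cball 0 r \<Longrightarrow> f x = 0"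
proof -
  have "bounded (closure {x. f x \<noteq> 0})" using assms by (simp add: test_function_def compact_imp_bounded)
  then obtain r where "r > 0" and r: "\<And>x. x \<in> closure {x. f x \<noteq> 0} \<Longrightarrow> norm x \<le> r"
    using bounded_pos by blast
  have "f x = 0" if "x \<notin> cball 0 r" for x
    using that r[of x] closure_subset[of "{x. f x \<noteq> 0}"] by auto
  with \<open>r > 0\<close> that show ?thesis by blast
qed

lemma test_function_partial_deriv:
  assumes f: "test_function f" and b: "b \<in> Basis" shows "test_function (partial_deriv b f)"
proof -
  obtain r where r: "\<And>x. x \<notin> cball 0 r \<Longrightarrow> f x = 0" using test_function_cball[OF f] by blast
  show ?thesis
  proof (rule test_functionI)
    show "C_k k (partial_deriv b f)" for k using f b C_k.simps(2)[of k f] by (auto simp: test_function_def simp del: C_k.simps)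
    fix x :: 'a assume x: "x \<notin> cball 0 r"
    have "(f has_derivative (\<lambda>h. 0)) (at x)"
      by (rule has_derivative_transform_within_open[of "\<lambda>x. 0" _ _ _ "- cball 0 r"])
        (use x r in \<open>auto simp del: mem_cball\<close>)
    then show "partial_deriv b f x = 0" by (rule partial_deriv_eq)
  qed
qed

lemma test_function_diff: "test_function f \<Longrightarrow> f differentiable at x"
  unfolding test_function_def using C_k.simps(2)[of 0 f] by blast

lemma test_function_cont: "test_function f \<Longrightarrow> continuous_on S f"
  unfolding test_function_def using C_k.simps(1)[of f] continuous_on_subset by blast

section \<open>Integration by parts\<close>

lemma bounded_subset_cball_0:
  fixes S :: "'a::real_normed_vector set"
  assumes "bounded S" obtains r where "S \<subseteq> cball 0 r"
  using assms bounded_any_center[of S 0] by (auto simp: subset_iff)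

lemma integrable_indicator_cball: "integrable lborel (indicator (cball (x::'a::euclidean_space) r) :: 'a \<Rightarrow> real)"
  by (intro integrable_real_indicator emeasure_lborel_cball_finite[unfolded infinity_ennreal_def[symmetric]]) auto

lemma integrable_continuous_cball:
  fixes f :: "'a::euclidean_space \<Rightarrow> 'b::{banach, second_countable_topology}"
  assumes "continuous_on UNIV f" "\<And>x. x \<notin> cball a r \<Longrightarrow> f x = 0"
  shows "integrable lborel f"
proof -
  have "integrable lborel (\<lambda>x. indicator (cball a r) x *\<^sub>R f x)"
    using assms(1) by (intro borel_integrable_compact) (auto intro: continuous_on_subset)
  moreover have "(\<lambda>x. indicator (cball a r) x *\<^sub>R f x) = f"
    using assms(2) by (auto simp: indicator_def simp del: mem_cball)
  ultimately show ?thesis by simp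
qed

lemma integral_lborel_translation:
  fixes f :: "'a::euclidean_space \<Rightarrow> real"
  assumes "f \<in> borel_measurable borel"
  shows "(LINT x|lborel. f (x + a)) = (LINT x|lborel. f x)"
proof -
  have "(LINT x|lborel. f x) = (LINT x|distr lborel borel ((+) a). f x)"
    by (simp add: lborel_distr_plus)
  also have "\<dots> = (LINT x|lborel. f (a + x))"
    using assms by (intro integral_distr) auto
  finally show ?thesis by (simp add: add.commute)
qed

lemma continuous_compact_support_bounded:
  fixes f :: "'a::euclidean_space \<Rightarrow> real"
  assumes "continuous_on UNIV f" "\<And>x. x \<notin> cball a r \<Longrightarrow> f x = 0"
  obtains B where "B > 0" "\<And>x. \<bar>f x\<bar> \<le> B"
proof -
  have "compact (f ` cball a r)"
    using assms(1) by (intro compact_continuous_image) (auto intro: continuous_on_subset)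
  then obtain B where "B > 0" and B: "\<And>x. x \<in> cball a r \<Longrightarrow> \<bar>f x\<bar> \<le> B"
    using bounded_pos[of "f ` cball a r"] compact_imp_bounded by (auto simp del: mem_cball)
  have "\<bar>f x\<bar> \<le> B" for x using B[of x] assms(2)[of x] \<open>B > 0\<close> by (cases "x \<in> cball a r") auto
  with \<open>B > 0\<close> that show ?thesis by blast
qed

lemma partial_deriv_zero_outside:
  assumes "\<And>x. x \<notin> cball a r \<Longrightarrow> h x = 0" "x \<notin> cball a r"
  shows "partial_deriv b h x = 0"
proof -
  have "(h has_derivative (\<lambda>h. 0)) (at x)"
    by (rule has_derivative_transform_within_open[of "\<lambda>x. 0" _ _ _ "- cball a r"])
      (use assms in \<open>auto simp del: mem_cball\<close>)
  then show ?thesis by (rule partial_deriv_eq)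
qed

lemma DERIV_along_line:
  assumes "h differentiable (at (x + t *\<^sub>R b))"
  shows "((\<lambda>t. h (x + t *\<^sub>R b)) has_real_derivative partial_deriv b h (x + t *\<^sub>R b)) (at t)"
proof -
  let ?D = "frechet_derivative h (at (x + t *\<^sub>R b))"
  have d: "(h has_derivative ?D) (at (x + t *\<^sub>R b))"
    using assms by (rule frechet_derivative_worksI)
  have "((\<lambda>t. h (x + t *\<^sub>R b)) has_derivative (\<lambda>s. ?D (s *\<^sub>R b))) (at t)"
    using d by (intro has_derivative_compose[where g=h and f="\<lambda>t. x + t *\<^sub>R b"]) (auto intro!: derivative_eq_intros)
  then show ?thesis
    unfolding has_field_derivative_def partial_deriv_def
    by (simp add: linear_scale[OF has_derivative_linear[OF d]] mult.commute[of _ "?D b"] mult_commute_abs)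
qed

lemma partial_deriv_mean_value:
  assumes "\<And>x. h differentiable (at x)" "\<And>x. \<bar>partial_deriv b h x\<bar> \<le> B" "t \<ge> 0"
  shows "\<bar>h (x + t *\<^sub>R b) - h x\<bar> \<le> B * t"
proof (cases "t = 0")
  case False
  then have "0 < t" using assms(3) by simp
  from MVT2[OF this DERIV_along_line[OF assms(1)], of x b]
  obtain z where "h (x + t *\<^sub>R b) - h x = t * partial_deriv b h (x + z *\<^sub>R b)" by auto
  then show ?thesis using assms(2)[of "x + z *\<^sub>R b"] assms(3)
    by (auto simp: abs_mult mult.commute[of B] intro: mult_left_mono)
qed simp

lemma difference_quotient_tendsto:
  assumes "h differentiable (at x)"
  shows "(\<lambda>k. (h (x + (1 / real (Suc k)) *\<^sub>R b) - h x) * real (Suc k)) \<longlonglongrightarrow> partial_deriv b h x"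
proof -
  have "((\<lambda>t. (h (x + t *\<^sub>R b) - h x) / t) \<longlongrightarrow> partial_deriv b h x) (at 0)"
    using DERIV_along_line[of h x 0 b] assms by (simp add: has_field_derivative_iff)
  moreover have "filterlim (\<lambda>k. 1 / real (Suc k)) (at 0) sequentially"
    using LIMSEQ_inverse_real_of_nat by (auto simp: filterlim_at inverse_eq_divide)
  ultimately have "(\<lambda>k. (h (x + (1 / real (Suc k)) *\<^sub>R b) - h x) / (1 / real (Suc k))) \<longlonglongrightarrow> partial_deriv b h x"
    by (rule filterlim_compose)
  then show ?thesis by simp
qed

text \<open>Translation invariance of the measure gives every difference quotient in direction
  \<open>b\<close> the integral 0. The quotients converge to the partial derivative and are
  dominated through the mean value theorem, which replaces an iterated integral along
  \<open>b\<close>.\<close>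

lemma integral_partial_deriv_eq_0:
  fixes h :: "'a::euclidean_space \<Rightarrow> real"
  assumes d: "\<And>x. h differentiable (at x)" and c: "continuous_on UNIV (partial_deriv b h)"
    and z: "\<And>x. x \<notin> cball 0 r \<Longrightarrow> h x = 0" and b: "b \<in> Basis"
  shows "(LINT x|lborel. partial_deriv b h x) = 0"
proof -
  have ch: "continuous_on UNIV h"
    using d by (auto intro!: continuous_at_imp_continuous_on differentiable_imp_continuous_within)
  then have [measurable]: "h \<in> borel_measurable borel" by (rule borel_measurable_continuous_onI)
  have [measurable]: "partial_deriv b h \<in> borel_measurable borel"
    using c by (rule borel_measurable_continuous_onI)
  obtain B where "B > 0" and B: "\<And>x. \<bar>partial_deriv b h x\<bar> \<le> B"
    using continuous_compact_support_bounded[OF c partial_deriv_zero_outside[of 0 r h]] z by blast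
  let ?s = "\<lambda>k x. (h (x + (1 / real (Suc k)) *\<^sub>R b) - h x) * real (Suc k)"
  have "(\<lambda>k. LINT x|lborel. ?s k x) \<longlonglongrightarrow> (LINT x|lborel. partial_deriv b h x)"
  proof (rule integral_dominated_convergence)
    \<comment> \<open>The steps \<open>1 / Suc k\<close> have length at most 1, so all quotients
      vanish outside the ball enlarged by 1.\<close>
    show "integrable lborel (\<lambda>x. B * indicator (cball (0::'a) (r + 1)) x)"
      by (intro integrable_mult_right integrable_indicator_cball)
    show "AE x in lborel. (\<lambda>k. ?s k x) \<longlonglongrightarrow> partial_deriv b h x"
      using difference_quotient_tendsto[OF d] by simp
    show "AE x in lborel. norm (?s k x) \<le> B * indicator (cball 0 (r + 1)) x" for k
    proof (rule AE_I2)
      fix x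
      show "norm (?s k x) \<le> B * indicator (cball 0 (r + 1)) x"
      proof (cases "x \<in> cball 0 (r + 1)")
        case True
        have "\<bar>h (x + (1 / real (Suc k)) *\<^sub>R b) - h x\<bar> \<le> B * (1 / real (Suc k))"
          by (rule partial_deriv_mean_value[OF d B]) simp
        then have "\<bar>h (x + (1 / real (Suc k)) *\<^sub>R b) - h x\<bar> * real (Suc k) \<le> B"
          by (simp add: pos_le_divide_eq del: of_nat_Suc)
        then show ?thesis using True by (simp add: abs_mult del: of_nat_Suc)
      next
        case False
        have "norm ((1 / real (Suc k)) *\<^sub>R b) \<le> 1" using b by simp
        then have "norm (x + (1 / real (Suc k)) *\<^sub>R b) > r"
          using False norm_triangle_ineq2[of x "- ((1 / real (Suc k)) *\<^sub>R b)"] by (simp del: norm_scaleR)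
        then show ?thesis using False z[of x] z[of "x + (1 / real (Suc k)) *\<^sub>R b"] by (auto simp: mem_cball)
      qed
    qed
  qed measurable
  moreover have "(LINT x|lborel. ?s k x) = 0" for k
  proof -
    have ih: "integrable lborel h" using ch z by (rule integrable_continuous_cball)
    let ?v = "(1 / real (Suc k)) *\<^sub>R b"
    have "continuous_on UNIV (\<lambda>x. h (x + ?v))"
      by (rule continuous_on_compose2[OF ch]) (auto intro: continuous_intros)
    moreover have "h (x + ?v) = 0" if "x \<notin> cball (- ?v) r" for x
    proof -
      have "dist (- ?v) x = norm (x + ?v)"
        by (metis add.commute diff_minus_eq_add dist_commute dist_norm)
      then show ?thesis using z[of "x + ?v"] that by (simp add: mem_cball)
    qed
    ultimately have "integrable lborel (\<lambda>x. h (x + ?v))" by (rule integrable_continuous_cball)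
    then show ?thesis using ih integral_lborel_translation[of h ?v] by simp
  qed
  ultimately show ?thesis using LIMSEQ_unique[OF _ tendsto_const] by fastforce
qed

lemma integral_by_parts_partial_deriv:
  fixes f g :: "'a::euclidean_space \<Rightarrow> real"
  assumes f: "\<And>x. f differentiable (at x)" "continuous_on UNIV (partial_deriv b f)"
    and g: "\<And>x. g differentiable (at x)" "continuous_on UNIV (partial_deriv b g)"
    and z: "\<And>x. x \<notin> cball 0 r \<Longrightarrow> f x = 0" and b: "b \<in> Basis"
  shows "(LINT x|lborel. f x * partial_deriv b g x) = - (LINT x|lborel. partial_deriv b f x * g x)"
proof -
  have cf: "continuous_on UNIV f" "continuous_on UNIV g" using f g
    by (auto intro!: continuous_at_imp_continuous_on differentiable_imp_continuous_within)
  have pd: "partial_deriv b (\<lambda>x. f x * g x) = (\<lambda>x. f x * partial_deriv b g x + partial_deriv b f x * g x)"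
    using f g by (auto simp: partial_deriv_mult)
  have "(LINT x|lborel. partial_deriv b (\<lambda>x. f x * g x) x) = 0"
    using f g cf z b by (intro integral_partial_deriv_eq_0[where r=r])
      (auto simp: pd intro!: continuous_intros differentiable_mult)
  moreover have "integrable lborel (\<lambda>x. f x * partial_deriv b g x)"
    "integrable lborel (\<lambda>x. partial_deriv b f x * g x)"
    using f g cf z partial_deriv_zero_outside[of 0 r f, OF z]
    by (auto intro!: integrable_continuous_cball[where a=0 and r=r] continuous_intros simp del: mem_cball)
  ultimately show ?thesis by (simp add: pd)
qed

lemma test_function_by_parts:
  fixes f g :: "'a::euclidean_space \<Rightarrow> real"
  assumes f: "test_function f" and g: "\<And>x. g differentiable (at x)" "continuous_on UNIV (partial_deriv b g)"
    and b: "b \<in> Basis"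
  shows "(LINT x|lborel. f x * partial_deriv b g x) = - (LINT x|lborel. partial_deriv b f x * g x)"
proof -
  obtain r where r: "\<And>x. x \<notin> cball 0 r \<Longrightarrow> f x = 0" using test_function_cball[OF f] by blast
  show ?thesis
    using test_function_diff[OF f] test_function_cont[OF test_function_partial_deriv[OF f b]] g r b
    by (rule integral_by_parts_partial_deriv)
qed

section \<open>The fundamental lemma of the calculus of variations\<close>

text \<open>Boxes form an intersection-stable generator of the Borel sets, so Dynkin's argument
  extends the vanishing to all Borel sets; the vanishing total integral serves the complements. The
  sets where \<open>f\<close> has a fixed sign then finish the proof.\<close>

lemma AE_zero_of_box_integrals:
  fixes f :: "'a::euclidean_space \<Rightarrow> real"
  assumes f: "integrable lborel f" and box: "\<And>a b. (LINT x:box a b|lborel. f x) = 0"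
    and U: "(LINT x|lborel. f x) = 0"
  shows "AE x in lborel. f x = 0"
proof -
  have int: "set_integrable lborel A f" if "A \<in> sets borel" for A
    using f that unfolding set_integrable_def by (intro integrable_mult_indicator) auto
  have z: "(LINT x:A|lborel. f x) = 0" if A: "A \<in> sets borel" for A
  proof -
    have "Int_stable (range (\<lambda>(a, b). box a b :: 'a set))"
      by (auto simp: Int_stable_def box_Int_box)
    moreover have "range (\<lambda>(a, b). box a b :: 'a set) \<subseteq> Pow UNIV" by simp
    moreover have "A \<in> sigma_sets UNIV (range (\<lambda>(a, b). box a b :: 'a set))"
      using A by (simp add: borel_eq_box)
    ultimately show ?thesis
    proof (induction rule: sigma_sets_induct_disjoint)
      fix A :: "'a set" assume "A \<in> range (\<lambda>(a, b). box a b)" then show "(LINT x:A|lborel. f x) = 0" using box by auto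
    next
      show "(LINT x:{}|lborel. f x) = 0" by (simp add: set_lebesgue_integral_def)
    next
      fix A :: "'a set" assume A: "A \<in> sigma_sets UNIV (range (\<lambda>(a, b). box a b))" "(LINT x:A|lborel. f x) = 0"
      then have "A \<in> sets borel" by (simp add: borel_eq_box)
      then have "(LINT x:A \<union> (UNIV - A)|lborel. f x) = (LINT x:A|lborel. f x) + (LINT x:UNIV - A|lborel. f x)"
        by (intro set_integral_Un int) auto
      then show "(LINT x:UNIV - A|lborel. f x) = 0"
        using A U by (simp add: set_lebesgue_integral_def)
    next
      fix A :: "nat \<Rightarrow> 'a set" assume A: "disjoint_family A"
        "range A \<subseteq> sigma_sets UNIV (range (\<lambda>(a, b). box a b))" "\<And>i. (LINT x:A i|lborel. f x) = 0"
      then have "A i \<in> sets borel" for i by (auto simp: borel_eq_box)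
      then show "(LINT x:(\<Union>i. A i)|lborel. f x) = 0"
        using A by (subst lebesgue_integral_countable_add) (auto intro!: int simp: disjoint_family_on_def)
    qed
  qed
  have [measurable]: "f \<in> borel_measurable borel" using f by auto
  \<comment> \<open>The factor \<open>c\<close>, later 1 or -1, lets one argument treat both
    signs.\<close>
  have AEz: "AE x in lborel. indicator A x *\<^sub>R f x = 0"
    if "A \<in> sets borel" "\<And>x. x \<in> A \<Longrightarrow> 0 \<le> c * f x" "c \<noteq> 0" for A and c :: real
  proof -
    have "AE x in lborel. c * (indicator A x *\<^sub>R f x) = 0"
    proof (subst integral_nonneg_eq_0_iff_AE[symmetric])
      show "integrable lborel (\<lambda>x. c * (indicator A x *\<^sub>R f x))"
        using int[OF that(1)] unfolding set_integrable_def by (intro integrable_mult_right)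
      show "AE x in lborel. 0 \<le> c * (indicator A x *\<^sub>R f x)" using that by (auto simp: indicator_def)
      show "(LINT x|lborel. c * (indicator A x *\<^sub>R f x)) = 0" using z[OF that(1)]
        by (simp add: set_lebesgue_integral_def)
    qed
    then show ?thesis using that by simp
  qed
  have "AE x in lborel. indicator {x. 0 \<le> f x} x *\<^sub>R f x = 0" by (rule AEz[where c=1]) auto
  moreover have "AE x in lborel. indicator {x. f x \<le> 0} x *\<^sub>R f x = 0" by (rule AEz[where c="-1"]) auto
  ultimately show ?thesis by eventually_elim (auto simp: indicator_def split: if_splits)
qed

text \<open>On the open box each factor is \<open>exp (- 1 / (k s))\<close> with
  \<open>s > 0\<close>, which tends to 1 as \<open>k\<close> grows; outside the box some factor is
  exactly 0. So these are test functions tending to the indicator of the box at every point.\<close>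

definition box_bump :: "nat \<Rightarrow> 'a::euclidean_space \<Rightarrow> 'a \<Rightarrow> 'a \<Rightarrow> real" where
  "box_bump k a c x = (\<Prod>b\<in>Basis. bump 0 (real k * (x \<bullet> b - a \<bullet> b)) * bump 0 (real k * (c \<bullet> b - x \<bullet> b)))"

lemma test_function_box_bump:
  fixes a c :: "'a::euclidean_space"
  assumes "k > 0" shows "test_function (box_bump k a c)"
proof -
  obtain r where r: "box a c \<subseteq> cball 0 r" using bounded_subset_cball_0[OF bounded_box] by blast
  show ?thesis
  proof (rule test_functionI)
    show "C_k j (box_bump k a c)" for j unfolding box_bump_def
      by (intro C_k_prod C_k_mult C_k_compose[where G=bump] bump_deriv C_k_diff C_k_const C_k_inner) auto
    fix x :: 'a assume "x \<notin> cball 0 r"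
    then have "x \<notin> box a c" using r by auto
    then obtain b where b: "b \<in> Basis" "x \<bullet> b \<le> a \<bullet> b \<or> c \<bullet> b \<le> x \<bullet> b" by (auto simp: mem_box not_less)
    show "box_bump k a c x = 0"
      using b by (auto simp: box_bump_def mult_le_0_iff intro!: bexI[of _ b])
  qed
qed

lemma box_bump_bound: "\<bar>box_bump k a c x\<bar> \<le> indicator (box a c) x"
proof (cases "x \<in> box a c")
  case True
  have "\<bar>bump 0 t\<bar> \<le> 1" for t by (cases "t > 0") (auto simp: bump_0)
  then have "\<bar>box_bump k a c x\<bar> \<le> 1" unfolding box_bump_def abs_prod abs_mult
    by (intro prod_le_1 conjI mult_le_one mult_nonneg_nonneg) auto
  then show ?thesis using True by simp
next
  case False
  then obtain b where b: "b \<in> Basis" "x \<bullet> b \<le> a \<bullet> b \<or> c \<bullet> b \<le> x \<bullet> b" by (auto simp: mem_box not_less)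
  then have "box_bump k a c x = 0"
    by (auto simp: box_bump_def mult_le_0_iff intro!: bexI[of _ b])
  then show ?thesis by simp
qed

lemma box_bump_tendsto: "(\<lambda>k. box_bump (Suc k) a c x) \<longlonglongrightarrow> indicator (box a c) x"
proof (cases "x \<in> box a c")
  case True
  have *: "(\<lambda>k. bump 0 (real (Suc k) * t)) \<longlonglongrightarrow> 1" if "t > 0" for t
  proof -
    have "(\<lambda>k. exp (- (1 / t) * (1 / real (Suc k)))) \<longlonglongrightarrow> exp (- (1 / t) * 0)"
      using LIMSEQ_inverse_real_of_nat by (intro tendsto_intros) (simp add: inverse_eq_divide)
    moreover have "bump 0 (real (Suc k) * t) = exp (- (1 / t) * (1 / real (Suc k)))" for k
      using that by (subst bump_0) (simp_all add: field_simps del: of_nat_Suc)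
    ultimately show ?thesis by simp
  qed
  have "(\<lambda>k. box_bump (Suc k) a c x) \<longlonglongrightarrow> (\<Prod>b\<in>(Basis::'a set). 1 * 1)"
    unfolding box_bump_def using True by (intro tendsto_intros *) (auto simp: mem_box)
  then show ?thesis using True by simp
next
  case False
  then have "box_bump k a c x = 0" for k using box_bump_bound[of k a c x] by simp
  then show ?thesis using False by simp
qed

text \<open>Smoothed boxes recover the integral of \<open>h\<close> over each box by dominated
  convergence. As \<open>h\<close> is only locally integrable, the box criterion is applied to
  \<open>h\<close> cut off to growing boxes; intersections of boxes being boxes, the cut-off
  functions still satisfy it.\<close>

lemma fundamental_lemma:
  fixes h :: "'a::euclidean_space \<Rightarrow> real"
  assumes h: "h \<in> borel_measurable borel" "\<And>r. set_integrable lborel (cball 0 r) h"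
    and z: "\<And>\<phi>. test_function \<phi> \<Longrightarrow> (LINT x|lborel. \<phi> x * h x) = 0"
  shows "AE x in lborel. h x = 0"
proof -
  note [measurable] = h(1)
  have int: "set_integrable lborel (box a c) h" for a c
  proof -
    obtain r where "box a c \<subseteq> cball 0 r" using bounded_subset_cball_0[OF bounded_box] by blast
    then show ?thesis using set_integrable_subset[OF h(2)[of r]] by auto
  qed
  have box: "(LINT x:box a c|lborel. h x) = 0" for a c
  proof -
    have "(\<lambda>k. LINT x|lborel. box_bump (Suc k) a c x * h x) \<longlonglongrightarrow> (LINT x|lborel. indicator (box a c) x * h x)"
    proof (rule integral_dominated_convergence)
      show "integrable lborel (\<lambda>x. \<bar>indicator (box a c) x * h x\<bar>)"
        using int[of a c] by (intro integrable_abs) (simp add: set_integrable_def)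
      show "AE x in lborel. (\<lambda>k. box_bump (Suc k) a c x * h x) \<longlonglongrightarrow> indicator (box a c) x * h x"
        by (intro AE_I2 tendsto_intros box_bump_tendsto)
      have [measurable]: "box_bump k a c \<in> borel_measurable borel" if "k > 0" for k
        using test_function_cont[OF test_function_box_bump[OF that]] by (rule borel_measurable_continuous_onI)
      show "(\<lambda>x. box_bump (Suc k) a c x * h x) \<in> borel_measurable lborel" for k by simp
      show "AE x in lborel. norm (box_bump (Suc k) a c x * h x) \<le> \<bar>indicator (box a c) x * h x\<bar>" for k
        using box_bump_bound[of "Suc k" a c] by (auto simp: abs_mult intro!: mult_right_mono)
    qed simp
    moreover have "(LINT x|lborel. box_bump (Suc k) a c x * h x) = 0" for k
      by (rule z[OF test_function_box_bump]) simp
    ultimately have "(LINT x|lborel. indicator (box a c) x * h x) = 0"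
      using LIMSEQ_unique[OF _ tendsto_const] by fastforce
    then show ?thesis by (simp add: set_lebesgue_integral_def)
  qed
  have "AE x in lborel. \<forall>m::nat. indicator (box (- (real m *\<^sub>R One)) (real m *\<^sub>R One)) x *\<^sub>R h x = 0"
  proof (subst AE_all_countable, intro allI)
    fix m :: nat
    let ?D = "box (- (real m *\<^sub>R One)) (real m *\<^sub>R One) :: 'a set"
    show "AE x in lborel. indicator ?D x *\<^sub>R h x = 0"
    proof (rule AE_zero_of_box_integrals)
      show "integrable lborel (\<lambda>x. indicator ?D x *\<^sub>R h x)" using int by (simp add: set_integrable_def)
      show "(LINT x|lborel. indicator ?D x *\<^sub>R h x) = 0" using box by (simp add: set_lebesgue_integral_def)
      fix a b :: 'a
      show "(LINT x:box a b|lborel. indicator ?D x *\<^sub>R h x) = 0"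
        using box unfolding set_lebesgue_integral_def
        by (simp add: mult.assoc[symmetric] indicator_inter_arith[symmetric] box_Int_box)
    qed
  qed
  then show ?thesis
  proof eventually_elim
    case (elim x)
    obtain m :: nat where "x \<in> box (- (real m *\<^sub>R One)) (real m *\<^sub>R One)"
      using UN_box_eq_UNIV by blast
    with elim[rule_format, of m] show ?case by simp
  qed
qed

section \<open>Weak Laplacians\<close>

definition laplacian :: "('a::euclidean_space \<Rightarrow> real) \<Rightarrow> 'a \<Rightarrow> real" where
  "laplacian v x = (\<Sum>b\<in>Basis. partial_deriv b (partial_deriv b v) x)"

definition locally_integrable :: "('a::euclidean_space \<Rightarrow> real) \<Rightarrow> bool" where
  "locally_integrable f \<longleftrightarrow> f \<in> borel_measurable borel \<and> (\<forall>x r. set_integrable lborel (cball x r) f)"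

text \<open>The distributional Laplacian. Both regularity conditions are bundled in so that all
  pairings with test functions converge, and continuity gives \<open>g\<close> point values as
  limits of its averages.\<close>

definition weak_laplacian :: "('a::euclidean_space \<Rightarrow> real) \<Rightarrow> ('a \<Rightarrow> real) \<Rightarrow> bool" where
  "weak_laplacian g f \<longleftrightarrow> continuous_on UNIV g \<and> locally_integrable f \<and>
    (\<forall>v. test_function v \<longrightarrow> (LINT x|lborel. g x * laplacian v x) = (LINT x|lborel. f x * v x))"

lemma locally_integrable_mult_continuous:
  assumes f: "locally_integrable f" and g: "continuous_on UNIV g"
  shows "locally_integrable (\<lambda>x. f x * g x)"
proof -
  have [measurable]: "f \<in> borel_measurable borel" "g \<in> borel_measurable borel"
    using f g by (auto simp: locally_integrable_def intro: borel_measurable_continuous_onI)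
  have "set_integrable lborel (cball x r) (\<lambda>x. f x * g x)" for x r
  proof -
    have "compact (g ` cball x r)"
      using g by (intro compact_continuous_image) (auto intro: continuous_on_subset)
    then obtain B where B: "\<And>y. y \<in> cball x r \<Longrightarrow> \<bar>g y\<bar> \<le> B"
      using bounded_pos[of "g ` cball x r"] compact_imp_bounded by (auto simp del: mem_cball)
    have "integrable lborel (\<lambda>y. B * (indicator (cball x r) y *\<^sub>R f y))"
      using f by (intro integrable_mult_right) (auto simp: locally_integrable_def set_integrable_def)
    then show ?thesis unfolding set_integrable_def
    proof (rule Bochner_Integration.integrable_bound)
      show "AE y in lborel. norm (indicator (cball x r) y *\<^sub>R (f y * g y)) \<le> norm (B * (indicator (cball x r) y *\<^sub>R f y))"
      proof (rule AE_I2)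
        fix y
        have "\<bar>f y\<bar> * \<bar>g y\<bar> \<le> \<bar>B\<bar> * \<bar>f y\<bar>" if "y \<in> cball x r"
          using mult_right_mono[OF order_trans[OF B[OF that] abs_ge_self[of B]], of "\<bar>f y\<bar>"] by (simp add: mult.commute)
        then show "norm (indicator (cball x r) y *\<^sub>R (f y * g y)) \<le> norm (B * (indicator (cball x r) y *\<^sub>R f y))"
          by (simp add: abs_mult indicator_def)
      qed
    next
      have [measurable]: "cball x r \<in> sets borel" by simp
      show "(\<lambda>y. indicator (cball x r) y *\<^sub>R (f y * g y)) \<in> borel_measurable lborel" by measurable
    qed
  qed
  then show ?thesis by (simp add: locally_integrable_def)
qed

lemma integrable_locally_integrable_mult:
  assumes f: "locally_integrable f" and g: "continuous_on UNIV g" "\<And>x. x \<notin> cball a r \<Longrightarrow> g x = 0"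
  shows "integrable lborel (\<lambda>x. f x * g x)"
proof -
  have "set_integrable lborel (cball a r) (\<lambda>x. f x * g x)"
    using locally_integrable_mult_continuous[OF f g(1)] by (simp add: locally_integrable_def)
  moreover have "(\<lambda>x. indicator (cball a r) x *\<^sub>R (f x * g x)) = (\<lambda>x. f x * g x)"
  proof
    show "indicator (cball a r) x *\<^sub>R (f x * g x) = f x * g x" for x
      using g(2)[of x] by (cases "x \<in> cball a r") auto
  qed
  ultimately show ?thesis by (simp add: set_integrable_def)
qed

lemma locally_integrable_continuous:
  assumes "continuous_on UNIV f" shows "locally_integrable f"
proof -
  have "integrable lborel (\<lambda>y. indicator (cball x r) y *\<^sub>R f y)" for x r
    using assms by (intro borel_integrable_compact) (auto intro: continuous_on_subset)
  then show ?thesis using assms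
    by (auto simp: locally_integrable_def set_integrable_def intro: borel_measurable_continuous_onI)
qed

lemma locally_integrable_add: "locally_integrable f \<Longrightarrow> locally_integrable g \<Longrightarrow> locally_integrable (\<lambda>x. f x + g x)"
  by (auto simp: locally_integrable_def)

lemma locally_integrable_cmult: "locally_integrable f \<Longrightarrow> locally_integrable (\<lambda>x. c * f x)"
  by (auto simp: locally_integrable_def)

lemma test_function_laplacian:
  assumes "test_function v" obtains r where "continuous_on UNIV (laplacian v)"
    "\<And>x. x \<notin> cball 0 r \<Longrightarrow> laplacian v x = 0" "\<And>x. x \<notin> cball 0 r \<Longrightarrow> v x = 0"
proof -
  obtain r where r: "\<And>x. x \<notin> cball 0 r \<Longrightarrow> v x = 0" using test_function_cball[OF assms] by blast
  have "continuous_on UNIV (laplacian v)" unfolding laplacian_def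
    using assms by (intro continuous_on_sum test_function_cont test_function_partial_deriv)
  moreover have "partial_deriv b (partial_deriv b v) x = 0" if "x \<notin> cball 0 r" for b x
    by (rule partial_deriv_zero_outside[OF partial_deriv_zero_outside[OF r] that])
  then have "laplacian v x = 0" if "x \<notin> cball 0 r" for x
    unfolding laplacian_def using that by (intro sum.neutral) auto
  ultimately show ?thesis using r that by blast
qed

lemma weak_laplacian_add:
  assumes "weak_laplacian g f" "weak_laplacian g' f'"
  shows "weak_laplacian (\<lambda>x. g x + g' x) (\<lambda>x. f x + f' x)"
  unfolding weak_laplacian_def
proof (intro conjI allI impI)
  show "continuous_on UNIV (\<lambda>x. g x + g' x)"
    using assms by (auto simp: weak_laplacian_def intro: continuous_on_add)
  show "locally_integrable (\<lambda>x. f x + f' x)"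
    using assms by (auto simp: weak_laplacian_def intro: locally_integrable_add)
  fix v :: "'a \<Rightarrow> real" assume v: "test_function v"
  obtain r where r: "continuous_on UNIV (laplacian v)"
    "\<And>x. x \<notin> cball 0 r \<Longrightarrow> laplacian v x = 0" "\<And>x. x \<notin> cball 0 r \<Longrightarrow> v x = 0"
    using test_function_laplacian[OF v] by blast
  have "integrable lborel (\<lambda>x. g x * laplacian v x)" "integrable lborel (\<lambda>x. g' x * laplacian v x)"
    "integrable lborel (\<lambda>x. f x * v x)" "integrable lborel (\<lambda>x. f' x * v x)"
    using assms r test_function_cont[OF v]
    by (auto simp: weak_laplacian_def locally_integrable_continuous simp del: mem_cball
        intro!: integrable_locally_integrable_mult[of _ _ 0 r])
  then show "(LINT x|lborel. (g x + g' x) * laplacian v x) = (LINT x|lborel. (f x + f' x) * v x)"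
    using assms v by (simp add: distrib_right weak_laplacian_def)
qed

lemma weak_laplacian_cmult:
  assumes "weak_laplacian g f" shows "weak_laplacian (\<lambda>x. c * g x) (\<lambda>x. c * f x)"
  using assms unfolding weak_laplacian_def
  by (auto intro!: continuous_intros locally_integrable_cmult simp: mult.assoc)

text \<open>In substance: the Laplacian of a test function has integral 0. It is used in this form
  to subtract constants under Green's formula.\<close>

lemma weak_laplacian_const: "weak_laplacian (\<lambda>x::'a::euclidean_space. c) (\<lambda>x. 0)"
  unfolding weak_laplacian_def
proof (intro conjI allI impI)
  fix v :: "'a \<Rightarrow> real" assume v: "test_function v"
  have *: "(LINT x|lborel. partial_deriv b (partial_deriv b v) x) = 0" if "b \<in> Basis" for b
  proof -
    have t: "test_function (partial_deriv b v)" using test_function_partial_deriv[OF v that] .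
    obtain r where "\<And>x. x \<notin> cball 0 r \<Longrightarrow> partial_deriv b v x = 0" using test_function_cball[OF t] by blast
    with test_function_diff[OF t] test_function_cont[OF test_function_partial_deriv[OF t that]] that
    show ?thesis by (intro integral_partial_deriv_eq_0)
  qed
  have "(LINT x|lborel. laplacian v x) = (\<Sum>b\<in>Basis. LINT x|lborel. partial_deriv b (partial_deriv b v) x)"
    unfolding laplacian_def
  proof (rule Bochner_Integration.integral_sum)
    fix b :: 'a assume "b \<in> Basis"
    then have t: "test_function (partial_deriv b (partial_deriv b v))" using v test_function_partial_deriv by blast
    obtain r where "\<And>x. x \<notin> cball 0 r \<Longrightarrow> partial_deriv b (partial_deriv b v) x = 0"
      using test_function_cball[OF t] by blast
    then show "integrable lborel (partial_deriv b (partial_deriv b v))"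
      using test_function_cont[OF t] by (intro integrable_continuous_cball)
  qed
  with * show "(LINT x|lborel. c * laplacian v x) = (LINT x|lborel. 0 * v x)" by simp
qed (auto intro: locally_integrable_continuous)

lemma weak_laplacian_sum:
  "finite I \<Longrightarrow> (\<And>i. i \<in> I \<Longrightarrow> weak_laplacian (g i) (f i)) \<Longrightarrow> weak_laplacian (\<lambda>x. \<Sum>i\<in>I. g i x) (\<lambda>x. \<Sum>i\<in>I. f i x)"
  by (induction I rule: finite_induct) (auto intro: weak_laplacian_const weak_laplacian_add)

section \<open>Eigenfunctions are distributional solutions\<close>

lemma integral_lebesgue_lborel:
  fixes f :: "'a::euclidean_space \<Rightarrow> 'b::{banach, second_countable_topology}"
  shows "f \<in> borel_measurable borel \<Longrightarrow> (LINT x|lebesgue. f x) = (LINT x|lborel. f x)"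
  by (rule integral_completion) simp

text \<open>Members of \<open>L2\<close> are measurable only for the completed measure; a Borel
  function equal to \<open>h\<close> almost everywhere reduces this to the Borel case.\<close>

lemma fundamental_lemma_lebesgue:
  fixes h :: "'a::euclidean_space \<Rightarrow> real"
  assumes h: "h \<in> borel_measurable lebesgue" "\<And>r. integrable lebesgue (\<lambda>x. indicator (cball 0 r) x * h x)"
    and z: "\<And>\<phi>. test_function \<phi> \<Longrightarrow> (LINT x|lebesgue. \<phi> x * h x) = 0"
  shows "AE x in lebesgue. h x = 0"
proof -
  obtain h' where h': "h' \<in> borel_measurable lborel" "AE x in lborel. h x = h' x"
    using completion_ex_borel_measurable_real[OF h(1)] by blast
  have [measurable]: "h' \<in> borel_measurable borel" "h \<in> borel_measurable lebesgue" using h' h by auto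
  have [measurable]: "h' \<in> borel_measurable lebesgue" using h' by (auto intro: measurable_completion)
  have ae: "AE x in lebesgue. h x = h' x" using h'(2) by (rule AE_completion)
  have "AE x in lborel. h' x = 0"
  proof (rule fundamental_lemma)
    fix r
    have "integrable lebesgue (\<lambda>x. indicator (cball 0 r) x * h' x)"
    proof (rule integrable_cong_AE_imp[OF h(2)[of r]])
      have [measurable]: "cball (0::'a) r \<in> sets lebesgue" by simp
      show "(\<lambda>x. indicator (cball 0 r) x * h' x) \<in> borel_measurable lebesgue" by measurable
    qed (use ae in auto)
    then show "set_integrable lborel (cball 0 r) h'"
      unfolding set_integrable_def
    proof (subst (asm) integrable_completion)
      have [measurable]: "cball (0::'a) r \<in> sets borel" by simp
      show "(\<lambda>x. indicator (cball 0 r) x * h' x) \<in> borel_measurable lborel" by measurable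
    qed simp
  next
    fix \<phi> :: "'a \<Rightarrow> real" assume "test_function \<phi>"
    note t = this
    have [measurable]: "\<phi> \<in> borel_measurable borel" using test_function_cont[OF t] by (rule borel_measurable_continuous_onI)
    then have [measurable]: "\<phi> \<in> borel_measurable lebesgue" by (auto intro: measurable_completion)
    have "(LINT x|lborel. \<phi> x * h' x) = (LINT x|lebesgue. \<phi> x * h' x)"
      by (rule integral_lebesgue_lborel[symmetric]) simp
    also have "\<dots> = (LINT x|lebesgue. \<phi> x * h x)"
      by (rule integral_cong_AE) (use ae in auto)
    finally show "(LINT x|lborel. \<phi> x * h' x) = 0" using z[OF t] by simp
  qed simp
  from AE_completion[OF this] ae show ?thesis by eventually_elim simp
qed

text \<open>On the bounded support square integrability dominates integrability:
  \<open>|g| \<le> 1 + |g|^2\<close>, which comes from expanding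
  \<open>(|g| - 1)^2 \<ge> 0\<close>.\<close>

lemma L2_mult_integrable:
  fixes \<phi> :: "'a::euclidean_space \<Rightarrow> real"
  assumes g: "g \<in> L2" and \<phi>: "\<phi> \<in> borel_measurable borel" "\<And>x. \<bar>\<phi> x\<bar> \<le> B" "\<And>x. x \<notin> cball 0 r \<Longrightarrow> \<phi> x = 0"
  shows "integrable lebesgue (\<lambda>x. \<phi> x *\<^sub>R g x)"
proof (rule Bochner_Integration.integrable_bound)
  have "integrable lebesgue (indicator (cball (0::'a) r) :: 'a \<Rightarrow> real)"
    using integrable_indicator_cball by (subst integrable_completion) auto
  then show "integrable lebesgue (\<lambda>x. B * (indicator (cball 0 r) x + (cmod (g x))\<^sup>2))"
    using g by (auto simp: L2_def)
  have [measurable]: "\<phi> \<in> borel_measurable lebesgue" using \<phi> by (auto intro: measurable_completion)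
  have [measurable]: "g \<in> borel_measurable lebesgue" using g by (auto simp: L2_def)
  show "(\<lambda>x. \<phi> x *\<^sub>R g x) \<in> borel_measurable lebesgue" by measurable
  have B: "B \<ge> 0" using \<phi>(2)[of 0] by linarith
  show "AE x in lebesgue. norm (\<phi> x *\<^sub>R g x) \<le> norm (B * (indicator (cball 0 r) x + (cmod (g x))\<^sup>2))"
  proof (rule AE_I2)
    fix x
    have "\<bar>\<phi> x\<bar> * cmod (g x) \<le> B * (indicator (cball 0 r) x + (cmod (g x))\<^sup>2)"
    proof (cases "x \<in> cball 0 r")
      case True
      have "0 \<le> (cmod (g x) - 1)\<^sup>2" by simp
      moreover have "0 \<le> (cmod (g x))\<^sup>2" by simp
      ultimately have "cmod (g x) \<le> 1 + (cmod (g x))\<^sup>2" unfolding power2_diff by (simp add: add.commute) (use norm_ge_zero[of "g x"] in linarith)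
      then show ?thesis using True \<phi>(2)[of x] B by (auto intro!: mult_mono simp del: mem_cball)
    next
      case False
      then show ?thesis using \<phi>(3)[OF False] B by simp
    qed
    then show "norm (\<phi> x *\<^sub>R g x) \<le> norm (B * (indicator (cball 0 r) x + (cmod (g x))\<^sup>2))"
      using B by (simp add: abs_mult)
  qed
qed

text \<open>\<open>weak_partial\<close> is a choice. Uniqueness, obtained from the fundamental lemma
  for real and imaginary parts, identifies it with the classical derivative for test
  functions.\<close>

lemma weak_partial_unique:
  fixes u :: "'a::euclidean_space \<Rightarrow> complex"
  assumes g: "g \<in> L2" "has_weak_partial b u g" and h: "h \<in> L2" "has_weak_partial b u h"
  shows "AE x in lebesgue. g x = h x"
proof -
  have [measurable]: "g \<in> borel_measurable lebesgue" "h \<in> borel_measurable lebesgue"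
    using g h by (auto simp: L2_def)
  have int: "integrable lebesgue (\<lambda>x. indicator (cball 0 r) x *\<^sub>R f x)" if "f \<in> L2" for f :: "'a \<Rightarrow> complex" and r
    by (rule L2_mult_integrable[OF that, where B=1 and r=r]) (auto simp: indicator_def)
  have *: "integrable lebesgue (\<lambda>x. \<phi> x *\<^sub>R g x)" "integrable lebesgue (\<lambda>x. \<phi> x *\<^sub>R h x)"
    "(LINT x|lebesgue. \<phi> x *\<^sub>R g x) = (LINT x|lebesgue. \<phi> x *\<^sub>R h x)" if t: "test_function \<phi>" for \<phi>
  proof -
    obtain r where r: "\<And>x. x \<notin> cball 0 r \<Longrightarrow> \<phi> x = 0" using test_function_cball[OF t] by blast
    obtain B where B: "\<And>x. \<bar>\<phi> x\<bar> \<le> B"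
      using continuous_compact_support_bounded[OF test_function_cont[OF t] r] by blast
    have "\<phi> \<in> borel_measurable borel" using test_function_cont[OF t] by (rule borel_measurable_continuous_onI)
    then show "integrable lebesgue (\<lambda>x. \<phi> x *\<^sub>R g x)" "integrable lebesgue (\<lambda>x. \<phi> x *\<^sub>R h x)"
      using L2_mult_integrable g h B r by blast+
    show "(LINT x|lebesgue. \<phi> x *\<^sub>R g x) = (LINT x|lebesgue. \<phi> x *\<^sub>R h x)"
      using g(2) h(2) t unfolding has_weak_partial_def by (metis neg_equal_iff_equal)
  qed
  have "AE x in lebesgue. Re (g x) - Re (h x) = 0"
  proof (rule fundamental_lemma_lebesgue)
    show "integrable lebesgue (\<lambda>x. indicator (cball 0 r) x * (Re (g x) - Re (h x)))" for r
      using integrable_Re[OF int[OF g(1), of r]] integrable_Re[OF int[OF h(1), of r]]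
      by (simp add: right_diff_distrib)
    show "(LINT x|lebesgue. \<phi> x * (Re (g x) - Re (h x))) = 0" if "test_function \<phi>" for \<phi>
      using *[OF that] integrable_Re[OF *(1)[OF that]] integrable_Re[OF *(2)[OF that]]
        integral_Re[OF *(1)[OF that]] integral_Re[OF *(2)[OF that]]
      by (simp add: right_diff_distrib)
  qed simp
  moreover have "AE x in lebesgue. Im (g x) - Im (h x) = 0"
  proof (rule fundamental_lemma_lebesgue)
    show "integrable lebesgue (\<lambda>x. indicator (cball 0 r) x * (Im (g x) - Im (h x)))" for r
      using integrable_Im[OF int[OF g(1), of r]] integrable_Im[OF int[OF h(1), of r]]
      by (simp add: right_diff_distrib)
    show "(LINT x|lebesgue. \<phi> x * (Im (g x) - Im (h x))) = 0" if "test_function \<phi>" for \<phi>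
      using *[OF that] integrable_Im[OF *(1)[OF that]] integrable_Im[OF *(2)[OF that]]
        integral_Im[OF *(1)[OF that]] integral_Im[OF *(2)[OF that]]
      by (simp add: right_diff_distrib)
  qed simp
  ultimately show ?thesis by eventually_elim (simp add: complex_eq_iff)
qed

lemma test_function_L2:
  fixes v :: "'a::euclidean_space \<Rightarrow> real"
  assumes "test_function v" shows "(\<lambda>x. complex_of_real (v x)) \<in> L2"
proof -
  obtain r where r: "\<And>x. x \<notin> cball 0 r \<Longrightarrow> v x = 0" using test_function_cball[OF assms] by blast
  have c: "continuous_on UNIV v" using test_function_cont[OF assms] .
  then have [measurable]: "v \<in> borel_measurable borel" by (rule borel_measurable_continuous_onI)
  have "(\<lambda>x. complex_of_real (v x)) \<in> borel_measurable lebesgue"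
    by (rule measurable_completion) simp
  moreover have "integrable lborel (\<lambda>x. (v x)\<^sup>2)"
    using c r by (intro integrable_continuous_cball[of _ 0 r] continuous_intros) (auto simp del: mem_cball)
  then have "integrable lebesgue (\<lambda>x. (v x)\<^sup>2)" by (subst integrable_completion) auto
  ultimately show ?thesis by (simp add: L2_def)
qed

lemma test_function_has_weak_partial:
  fixes v :: "'a::euclidean_space \<Rightarrow> real"
  assumes v: "test_function v" and b: "b \<in> Basis"
  shows "has_weak_partial b (\<lambda>x. complex_of_real (v x)) (\<lambda>x. complex_of_real (partial_deriv b v x))"
  unfolding has_weak_partial_def
proof (intro allI impI)
  fix \<phi> :: "'a \<Rightarrow> real" assume \<phi>: "test_function \<phi>"
  have c: "continuous_on UNIV v" "continuous_on UNIV \<phi>"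
    "continuous_on UNIV (partial_deriv b v)" "continuous_on UNIV (partial_deriv b \<phi>)"
    using v \<phi> b by (auto intro: test_function_cont test_function_partial_deriv)
  have m: "(\<lambda>x. f x * g x) \<in> borel_measurable borel"
    if "continuous_on UNIV f" "continuous_on UNIV g" for f g :: "'a \<Rightarrow> real"
    using that by (intro borel_measurable_continuous_onI continuous_intros)
  have "(LINT x|lebesgue. partial_deriv b \<phi> x * v x) = - (LINT x|lebesgue. \<phi> x * partial_deriv b v x)"
    using test_function_by_parts[OF \<phi> test_function_diff[OF v] c(3) b] c
    by (simp add: integral_lebesgue_lborel m)
  then show "(LINT x|lebesgue. partial_deriv b \<phi> x *\<^sub>R complex_of_real (v x))
      = - (LINT x|lebesgue. \<phi> x *\<^sub>R complex_of_real (partial_deriv b v x))"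
    by (simp add: scaleR_conv_of_real of_real_mult[symmetric] del: of_real_mult)
qed

lemma test_function_W12:
  "test_function v \<Longrightarrow> (\<lambda>x. complex_of_real (v x)) \<in> W12"
  unfolding W12_def
  using test_function_L2 test_function_has_weak_partial test_function_partial_deriv by blast

lemma weak_partial_works:
  assumes "u \<in> W12" "b \<in> Basis"
  shows "weak_partial b u \<in> L2" "has_weak_partial b u (weak_partial b u)"
proof -
  have "\<exists>g. g \<in> L2 \<and> has_weak_partial b u g" using assms by (auto simp: W12_def)
  from someI_ex[OF this] show "weak_partial b u \<in> L2" "has_weak_partial b u (weak_partial b u)"
    by (simp_all add: weak_partial_def)
qed

text \<open>A real test function \<open>v\<close> is put into the form identity. One derivative
  already falls on \<open>v\<close>; the other is moved there by the definition of the weak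
  derivative of \<psi>, tested with \<open>partial_deriv b v\<close>. Summing over \<open>b\<close>
  gives minus the pairing of \<psi> with the Laplacian of \<open>v\<close>.\<close>

lemma hamiltonian_weak_laplacian:
  fixes \<psi> :: "'n::{finite,linorder} config \<Rightarrow> real"
  assumes c: "continuous_on UNIV \<psi>"
    and H: "((\<lambda>x. complex_of_real (\<psi> x)), (\<lambda>x. complex_of_real (E * \<psi> x))) \<in> hamiltonian Z"
    and V: "locally_integrable (coulomb_potential Z :: 'n config \<Rightarrow> real)"
  shows "weak_laplacian \<psi> (\<lambda>x. (coulomb_potential Z x - E) * \<psi> x)"
  unfolding weak_laplacian_def
proof (intro conjI allI impI c)
  have "locally_integrable (\<lambda>x::'n config. coulomb_potential Z x + (- E))"
    by (intro locally_integrable_add V locally_integrable_continuous) (auto intro: continuous_intros)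
  from locally_integrable_mult_continuous[OF this c]
  show "locally_integrable (\<lambda>x. (coulomb_potential Z x - E) * \<psi> x)" by simp
  fix v :: "'n config \<Rightarrow> real" assume v: "test_function v"
  let ?u = "\<lambda>x. complex_of_real (\<psi> x)" and ?v = "\<lambda>x. complex_of_real (v x)"
  have u: "?u \<in> W12" using H by (auto simp: hamiltonian_def)
  have m[measurable]: "\<psi> \<in> borel_measurable borel" "v \<in> borel_measurable borel"
      "(coulomb_potential Z :: 'n config \<Rightarrow> real) \<in> borel_measurable borel"
    using borel_measurable_continuous_onI[OF c] borel_measurable_continuous_onI[OF test_function_cont[OF v]] V
    by (simp_all add: locally_integrable_def)
  obtain r where r: "\<And>x. x \<notin> cball 0 r \<Longrightarrow> v x = 0" using test_function_cball[OF v] by blast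
  have *: "L2_inner (weak_partial b ?u) (weak_partial b ?v)
      = complex_of_real (- (LINT x|lborel. \<psi> x * partial_deriv b (partial_deriv b v) x))"
    if b: "b \<in> Basis" for b
  proof -
    have t: "test_function (partial_deriv b v)" using v b by (rule test_function_partial_deriv)
    have ae: "AE x in lebesgue. weak_partial b ?v x = complex_of_real (partial_deriv b v x)"
      using weak_partial_unique[OF weak_partial_works[OF test_function_W12[OF v] b]
          test_function_L2[OF t] test_function_has_weak_partial[OF v b]] .
    have "partial_deriv b v \<in> borel_measurable lebesgue"
      using borel_measurable_continuous_onI[OF test_function_cont[OF t]] by (auto intro: measurable_completion)
    moreover have "weak_partial b ?v \<in> borel_measurable lebesgue" "weak_partial b ?u \<in> borel_measurable lebesgue"
      using weak_partial_works(1)[OF test_function_W12[OF v] b] weak_partial_works(1)[OF u b] by (auto simp: L2_def)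
    moreover have [measurable]: "cnj \<in> borel_measurable borel"
      by (intro borel_measurable_continuous_onI continuous_intros)
    then have "(\<lambda>x. cnj (f x)) \<in> borel_measurable lebesgue"
      if "f \<in> borel_measurable lebesgue" for f :: "'n config \<Rightarrow> complex"
      using that by (rule measurable_compose[rotated])
    ultimately have "L2_inner (weak_partial b ?u) (weak_partial b ?v)
        = (LINT x|lebesgue. partial_deriv b v x *\<^sub>R weak_partial b ?u x)"
      unfolding L2_inner_def using ae
      by (intro integral_cong_AE) (auto simp: scaleR_conv_of_real)
    also have "\<dots> = - (LINT x|lebesgue. partial_deriv b (partial_deriv b v) x *\<^sub>R ?u x)"
      using weak_partial_works(2)[OF u b] t unfolding has_weak_partial_def by simp
    also have "\<dots> = - complex_of_real (LINT x|lebesgue. \<psi> x * partial_deriv b (partial_deriv b v) x)"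
      by (simp add: scaleR_conv_of_real of_real_mult[symmetric] mult.commute del: of_real_mult)
    also have "(LINT x|lebesgue. \<psi> x * partial_deriv b (partial_deriv b v) x)
        = (LINT x|lborel. \<psi> x * partial_deriv b (partial_deriv b v) x)"
      using c test_function_cont[OF test_function_partial_deriv[OF t b]]
      by (intro integral_lebesgue_lborel borel_measurable_continuous_onI continuous_intros)
    finally show ?thesis by simp
  qed
  have "energy_form Z ?u ?v = L2_inner (\<lambda>x. complex_of_real (E * \<psi> x)) ?v"
    using H test_function_W12[OF v] by (auto simp: hamiltonian_def)
  moreover have "(LINT x|lebesgue. complex_of_real (coulomb_potential Z x) * ?u x * cnj (?v x))
      = complex_of_real (LINT x|lborel. coulomb_potential Z x * \<psi> x * v x)"
    by (subst integral_lebesgue_lborel[symmetric], simp)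
      (simp add: of_real_mult[symmetric] del: of_real_mult)
  moreover have "L2_inner (\<lambda>x. complex_of_real (E * \<psi> x)) ?v = complex_of_real (LINT x|lborel. E * \<psi> x * v x)"
    unfolding L2_inner_def by (subst integral_lebesgue_lborel[symmetric], simp)
      (simp add: of_real_mult[symmetric] del: of_real_mult)
  ultimately have "complex_of_real ((\<Sum>b\<in>Basis. - (LINT x|lborel. \<psi> x * partial_deriv b (partial_deriv b v) x))
      + (LINT x|lborel. coulomb_potential Z x * \<psi> x * v x)) = complex_of_real (LINT x|lborel. E * \<psi> x * v x)"
    unfolding energy_form_def using * by simp
  then have eq: "(\<Sum>b\<in>Basis. (LINT x|lborel. \<psi> x * partial_deriv b (partial_deriv b v) x))
      = (LINT x|lborel. coulomb_potential Z x * \<psi> x * v x) - (LINT x|lborel. E * \<psi> x * v x)"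
    unfolding of_real_eq_iff by (simp add: sum_negf)
  have "(\<Sum>b\<in>Basis. (LINT x|lborel. \<psi> x * partial_deriv b (partial_deriv b v) x)) = (LINT x|lborel. \<psi> x * laplacian v x)"
    unfolding laplacian_def sum_distrib_left
  proof (rule Bochner_Integration.integral_sum[symmetric])
    fix b :: "'n config" assume b: "b \<in> Basis"
    have "partial_deriv b (partial_deriv b v) x = 0" if "x \<notin> cball 0 r" for x
      by (rule partial_deriv_zero_outside[OF partial_deriv_zero_outside[OF r] that])
    then show "integrable lborel (\<lambda>x. \<psi> x * partial_deriv b (partial_deriv b v) x)"
      using test_function_cont[OF test_function_partial_deriv[OF test_function_partial_deriv[OF v b] b]]
      by (intro integrable_locally_integrable_mult[where a=0 and r=r] locally_integrable_continuous[OF c])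
  qed
  moreover have "integrable lborel (\<lambda>x. coulomb_potential Z x * (\<psi> x * v x))" "integrable lborel (\<lambda>x. E * (\<psi> x * v x))"
    using c test_function_cont[OF v] r
    by (auto intro!: integrable_locally_integrable_mult[where a=0 and r=r] V locally_integrable_continuous continuous_intros
        simp del: mem_cball)
  ultimately show "(LINT x|lborel. \<psi> x * laplacian v x) = (LINT x|lborel. (coulomb_potential Z x - E) * \<psi> x * v x)"
    using eq by (simp add: left_diff_distrib mult.assoc)
qed

section \<open>A mean value representation\<close>

lemma integral_mult_bound:
  fixes f h k :: "'a::euclidean_space \<Rightarrow> real"
  assumes h: "locally_integrable h" and fh: "\<And>y. y \<in> cball x r \<Longrightarrow> \<bar>f y\<bar> \<le> h y"
    and k: "\<And>y. \<bar>k y\<bar> \<le> \<kappa>" "\<And>y. y \<notin> cball x r \<Longrightarrow> k y = 0"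
  shows "\<bar>LINT y|lborel. f y * k y\<bar> \<le> \<kappa> * (LINT y:cball x r|lborel. h y)"
proof -
  have i: "integrable lborel (\<lambda>y. indicator (cball x r) y *\<^sub>R h y)"
    using h by (auto simp: locally_integrable_def set_integrable_def)
  have "norm (LINT y|lborel. f y * k y) \<le> (LINT y|lborel. \<kappa> * (indicator (cball x r) y *\<^sub>R h y))"
  proof (rule order_trans[OF integral_norm_bound integral_mono'])
    show "integrable lborel (\<lambda>y. \<kappa> * (indicator (cball x r) y *\<^sub>R h y))" using i by (rule integrable_mult_right)
    fix y
    have "\<bar>k y\<bar> * \<bar>f y\<bar> \<le> \<kappa> * h y" if "y \<in> cball x r"
      using k(1)[of y] fh[OF that] by (intro mult_mono) auto
    then show "norm (f y * k y) \<le> \<kappa> * (indicator (cball x r) y *\<^sub>R h y)"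
      using k(2)[of y] by (cases "y \<in> cball x r") (auto simp: abs_mult mult.commute)
    then show "0 \<le> \<kappa> * (indicator (cball x r) y *\<^sub>R h y)" by (meson norm_ge_zero order_trans)
  qed
  then show ?thesis by (simp add: set_lebesgue_integral_def)
qed

text \<open>The radial kernels evaluate the profiles at \<open>1 - r^2 \<le> 1\<close>, hence the
  range of \<open>t\<close>. Strict positivity is built in because it makes the constants below
  positive.\<close>

definition bump_bound :: "nat \<Rightarrow> real" where
  "bump_bound i = (SOME B. B > 0 \<and> (\<forall>t\<le>1. \<bar>bump i t\<bar> \<le> B))"

lemma bump_bound_pos: "bump_bound i > 0" and bump_le_bound: "t \<le> 1 \<Longrightarrow> \<bar>bump i t\<bar> \<le> bump_bound i"
proof -
  have "compact (bump i ` {0..1})"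
    by (intro compact_continuous_image continuous_on_bump) auto
  then obtain B where "B > 0" and B: "\<And>t. t \<in> {0..1} \<Longrightarrow> \<bar>bump i t\<bar> \<le> B"
    using bounded_pos[of "bump i ` {0..1}"] compact_imp_bounded by auto
  have "\<bar>bump i t\<bar> \<le> B" if "t \<le> 1" for t
    using that B[of t] \<open>B > 0\<close> by (cases "t \<ge> 0") auto
  with \<open>B > 0\<close> have "\<exists>B. B > 0 \<and> (\<forall>t\<le>1. \<bar>bump i t\<bar> \<le> B)" by blast
  from someI_ex[OF this] show "bump_bound i > 0" "t \<le> 1 \<Longrightarrow> \<bar>bump i t\<bar> \<le> bump_bound i"
    unfolding bump_bound_def by auto
qed

text \<open>A smooth kernel supported in \<open>cball x t\<close>. The index counts derivatives of
  the profile with respect to its argument, not derivatives in \<open>y\<close> or \<open>t\<close>;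
  using the squared norm keeps the kernel smooth at the centre.\<close>

definition radial :: "nat \<Rightarrow> 'a::euclidean_space \<Rightarrow> real \<Rightarrow> 'a \<Rightarrow> real" where
  "radial i x t y = bump i (1 - (norm (y - x))\<^sup>2 / t\<^sup>2)"

lemma radial_zero: "t > 0 \<Longrightarrow> y \<notin> cball x t \<Longrightarrow> radial i x t y = 0"
proof -
  assume "t > 0" "y \<notin> cball x t"
  then have "t\<^sup>2 \<le> (norm (y - x))\<^sup>2" by (intro power_mono) (auto simp: dist_norm norm_minus_commute)
  then show ?thesis using \<open>t > 0\<close> by (simp add: radial_def)
qed

lemma radial_bound: "\<bar>radial i x t y\<bar> \<le> bump_bound i"
  unfolding radial_def by (rule bump_le_bound) simp

lemma C_k_radial: "C_k k (radial i x t)"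
  unfolding radial_def divide_inverse
  by (intro C_k_compose[where G=bump] bump_deriv C_k_diff C_k_const C_k_mult C_k_norm_sq)

lemma test_function_radial: "t > 0 \<Longrightarrow> test_function (radial i x t)"
  using C_k_radial radial_zero by (rule test_functionI)

lemma continuous_on_radial: "continuous_on S (radial i x t)"
  using C_k_radial[of 0 i x t] continuous_on_subset by auto

text \<open>The derivative \<open>- 2 r * bump (Suc i) (1 - r^2)\<close> vanishes for
  \<open>|r| \<ge> 1\<close>, so the growing factor \<open>r\<close> does no harm.\<close>

lemma bump_square_lipschitz: "\<bar>bump i (1 - a\<^sup>2) - bump i (1 - b\<^sup>2)\<bar> \<le> 2 * bump_bound (Suc i) * \<bar>a - b\<bar>"
proof -
  have d: "((\<lambda>r. bump i (1 - r\<^sup>2)) has_real_derivative - 2 * r * bump (Suc i) (1 - r\<^sup>2)) (at r)" for r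
    by (rule DERIV_cong[OF DERIV_chain2[OF bump_deriv]]) (auto intro!: derivative_eq_intros)
  have "norm (- 2 * r * bump (Suc i) (1 - r\<^sup>2)) \<le> 2 * bump_bound (Suc i)" for r :: real
  proof (cases "\<bar>r\<bar> \<le> 1")
    case True
    have "\<bar>r\<bar> * \<bar>bump (Suc i) (1 - r\<^sup>2)\<bar> \<le> 1 * bump_bound (Suc i)"
      using True by (intro mult_mono bump_le_bound) auto
    then show ?thesis by (simp add: abs_mult)
  next
    case False
    then have "1 \<le> r\<^sup>2" by (simp add: abs_square_le_1 not_le[symmetric] power2_eq_square abs_le_square_iff)
      (metis abs_square_less_1 less_eq_real_def linorder_not_less power2_eq_square)
    then show ?thesis using bump_bound_pos[of "Suc i"] by simp
  qed
  from field_differentiable_bound[OF convex_UNIV DERIV_subset[OF d] this, of a b]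
  show ?thesis by (simp add: norm_minus_commute abs_minus_commute)
qed

lemma radial_lipschitz:
  assumes "t > 0"
  shows "\<bar>radial i x t y - radial i z t y\<bar> \<le> 2 * bump_bound (Suc i) * norm (x - z) / t"
proof -
  have "\<bar>radial i x t y - radial i z t y\<bar> \<le> 2 * bump_bound (Suc i) * \<bar>norm (y - x) / t - norm (y - z) / t\<bar>"
    using bump_square_lipschitz[of i "norm (y - x) / t" "norm (y - z) / t"] by (simp add: radial_def power_divide)
  also have "\<bar>norm (y - x) / t - norm (y - z) / t\<bar> = \<bar>norm (y - x) - norm (y - z)\<bar> / t"
    using assms by (simp add: diff_divide_distrib[symmetric])
  also have "\<dots> \<le> norm (x - z) / t"
    using norm_triangle_ineq3[of "y - x" "y - z"] assms by (simp add: divide_right_mono norm_minus_commute)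
  finally show ?thesis using bump_bound_pos[of "Suc i"] by (simp add: mult_left_mono)
qed

section \<open>Derivatives of the radial kernels\<close>

lemma radial_has_derivative:
  "(radial i x t has_derivative (\<lambda>h. (- 2 / t\<^sup>2) * (((y - x) \<bullet> h) * radial (Suc i) x t y))) (at y)"
proof -
  have "((\<lambda>y. 1 - inverse (t\<^sup>2) * ((y - x) \<bullet> (y - x))) has_derivative (\<lambda>h. - (2 * ((y - x) \<bullet> h)) / t\<^sup>2)) (at y)"
    by (auto intro!: derivative_eq_intros simp: inner_commute divide_inverse)
  then have "((\<lambda>y. 1 - (norm (y - x))\<^sup>2 / t\<^sup>2) has_derivative (\<lambda>h. - (2 * ((y - x) \<bullet> h)) / t\<^sup>2)) (at y)"
    by (simp add: power2_norm_eq_inner divide_inverse mult.commute)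
  from has_derivative_compose[OF this bump_deriv[unfolded has_field_derivative_def], of i]
  show ?thesis unfolding radial_def[abs_def]
    by (rule has_derivative_eq_rhs) (auto simp: field_simps)
qed

lemma partial_deriv_radial:
  "partial_deriv b (radial i x t) = (\<lambda>y. (- 2 / t\<^sup>2) * ((y \<bullet> b - x \<bullet> b) * radial (Suc i) x t y))"
  by (rule ext, subst partial_deriv_eq[OF radial_has_derivative]) (simp add: inner_diff_left)

text \<open>For \<open>s = 1 - |y - x|^2 / t^2\<close> the chain rule gives
  \<open>bump 2 s * |grad s|^2 + bump 1 s * (Laplacian of s)\<close>, with
  \<open>|grad s|^2 = 4 |y - x|^2 / t^4\<close> and Laplacian of \<open>s\<close> equal to
  \<open>- 2 n / t^2\<close>.\<close>

lemma laplacian_radial_0: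
  fixes x y :: "'a::euclidean_space"
  shows "laplacian (radial 0 x t) y = 4 * (norm (y - x))\<^sup>2 / t^4 * radial 2 x t y - 2 * DIM('a) / t\<^sup>2 * radial 1 x t y"
proof -
  have "partial_deriv b (partial_deriv b (radial 0 x t)) y
      = 4 * (y \<bullet> b - x \<bullet> b)\<^sup>2 / t^4 * radial 2 x t y - 2 / t\<^sup>2 * radial 1 x t y" if "b \<in> Basis" for b
  proof -
    have d1: "(radial 1 x t has_derivative frechet_derivative (radial 1 x t) (at y)) (at y)"
      using C_k_radial[of "Suc 0" 1 x t] by (intro frechet_derivative_worksI) auto
    have "((\<lambda>y. (- 2 / t\<^sup>2) * ((y \<bullet> b - x \<bullet> b) * radial 1 x t y)) has_derivative
      (\<lambda>h. (- 2 / t\<^sup>2) * ((y \<bullet> b - x \<bullet> b) * frechet_derivative (radial 1 x t) (at y) h + (h \<bullet> b) * radial 1 x t y))) (at y)"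
      by (rule has_derivative_mult_right, rule has_derivative_mult[OF _ d1]) (auto intro!: derivative_eq_intros)
    from partial_deriv_eq[OF this, of b]
    have "partial_deriv b (partial_deriv b (radial 0 x t)) y
      = (- 2 / t\<^sup>2) * ((y \<bullet> b - x \<bullet> b) * partial_deriv b (radial 1 x t) y + radial 1 x t y)"
      using that by (simp add: partial_deriv_radial[of b 0] partial_deriv_def[of b "radial (Suc 0) x t"])
    then have "partial_deriv b (partial_deriv b (radial 0 x t)) y
      = (- 2 / t\<^sup>2) * ((y \<bullet> b - x \<bullet> b) * ((- 2 / t\<^sup>2) * ((y \<bullet> b - x \<bullet> b) * radial 2 x t y)) + radial 1 x t y)"
      by (simp only: partial_deriv_radial Suc_1)
    also have "\<dots> = 4 * (y \<bullet> b - x \<bullet> b)\<^sup>2 / t^4 * radial 2 x t y - 2 / t\<^sup>2 * radial 1 x t y"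
      by (cases "t = 0") (simp_all add: field_simps power4_eq_xxxx power2_eq_square)
    finally show ?thesis .
  qed
  then have "laplacian (radial 0 x t) y
      = (\<Sum>b\<in>Basis. 4 * (y \<bullet> b - x \<bullet> b)\<^sup>2 / t^4 * radial 2 x t y - 2 / t\<^sup>2 * radial 1 x t y)"
    unfolding laplacian_def by (intro sum.cong) auto
  also have "\<dots> = 4 * (\<Sum>b\<in>Basis. (y \<bullet> b - x \<bullet> b)\<^sup>2) / t^4 * radial 2 x t y - 2 * DIM('a) / t\<^sup>2 * radial 1 x t y"
    by (simp add: sum_subtractf sum_distrib_left sum_distrib_right sum_divide_distrib)
  also have "(\<Sum>b\<in>Basis. (y \<bullet> b - x \<bullet> b)\<^sup>2) = (norm (y - x))\<^sup>2"
    unfolding power2_norm_eq_inner by (subst euclidean_inner) (simp add: inner_diff_left power2_eq_square)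
  finally show ?thesis .
qed

lemma laplacian_radial_bound:
  fixes x y :: "'a::euclidean_space"
  assumes "t > 0"
  shows "\<bar>laplacian (radial 0 x t) y\<bar> \<le> (4 * bump_bound 2 + 2 * DIM('a) * bump_bound 1) / t\<^sup>2"
proof -
  have "\<bar>4 * (norm (y - x))\<^sup>2 / t^4 * radial 2 x t y\<bar> \<le> 4 * bump_bound 2 / t\<^sup>2"
  proof (cases "y \<in> cball x t")
    case True
    then have "(norm (y - x))\<^sup>2 \<le> t\<^sup>2" by (intro power_mono) (auto simp: dist_norm norm_minus_commute)
    then have "(norm (y - x))\<^sup>2 * \<bar>radial 2 x t y\<bar> \<le> t\<^sup>2 * bump_bound 2"
      by (intro mult_mono radial_bound) auto
    then show ?thesis using assms
      by (simp add: abs_mult divide_simps power4_eq_xxxx power2_eq_square mult_ac)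
  next
    case False
    then show ?thesis using radial_zero[OF assms False] bump_bound_pos[of 2] by simp
  qed
  moreover have "\<bar>2 * DIM('a) / t\<^sup>2 * radial 1 x t y\<bar> \<le> 2 * DIM('a) * bump_bound 1 / t\<^sup>2"
    using radial_bound[of 1 x t y] by (simp add: abs_mult divide_right_mono mult_left_mono)
  ultimately show ?thesis unfolding laplacian_radial_0 add_divide_distrib by linarith
qed

text \<open>An average up to normalisation: the total mass is not 1 but \<open>mean_mass\<close>,
  the same for all centres and scales. It is divided out only at the end of the estimates.\<close>

definition mean :: "('a::euclidean_space \<Rightarrow> real) \<Rightarrow> 'a \<Rightarrow> real \<Rightarrow> real" where
  "mean g x t = (LINT y|lborel. g y * (2 * radial 1 x t y / t ^ DIM('a)))"

text \<open>A bridge to the gauge integral over a fixed box, for which \<open>leibniz_rule\<close>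
  is stated.\<close>

lemma integral_lborel_eq_integral_cbox:
  fixes f :: "'a::euclidean_space \<Rightarrow> real"
  assumes "continuous_on UNIV f" "\<And>y. y \<notin> cbox a b \<Longrightarrow> f y = 0"
  shows "(LINT y|lborel. f y) = integral (cbox a b) f"
proof -
  obtain r where "cbox a b \<subseteq> cball 0 r" using bounded_subset_cball_0[OF bounded_cbox] by blast
  then have "integrable lborel f" using assms by (intro integrable_continuous_cball[of f 0 r]) blast+
  then have "(f has_integral (LINT y|lborel. f y)) UNIV" by (rule has_integral_integral_lborel)
  moreover have "f = (\<lambda>y. if y \<in> cbox a b then f y else 0)" using assms(2) by auto
  ultimately have "((\<lambda>y. if y \<in> cbox a b then f y else 0) has_integral (LINT y|lborel. f y)) UNIV" by simp
  then show ?thesis by (simp add: has_integral_restrict_UNIV integral_unique)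
qed

text \<open>The two profiles are matched so that
  \<open>(d/dt) (2 * radial 1 x t y / t ^ n) = t / t ^ n * laplacian (radial 0 x t) y\<close> with \<open>n = DIM('a)\<close>;
  hence no fundamental solution is needed.\<close>

lemma mean_deriv:
  fixes x :: "'a::euclidean_space"
  assumes w: "weak_laplacian g f" and t: "t > 0"
  shows "(mean g x has_real_derivative t / t ^ DIM('a) * (LINT y|lborel. f y * radial 0 x t y)) (at t)"
proof -
  let ?n = "DIM('a)"
  \<comment> \<open>An open neighbourhood of \<open>t\<close> whose scales all have their kernels
    supported in one fixed box.\<close>
  let ?U = "{0<..<2 * t}"
  obtain a where a: "cball x (2 * t) \<subseteq> cbox (- a) a"
    using bounded_subset_cbox_symmetric[OF bounded_cball] by blast
  have g: "continuous_on UNIV g" using w by (simp add: weak_laplacian_def)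
  define F' where "F' s y = g y * (s / s ^ ?n * laplacian (radial 0 x s) y)" for s y
  have eq: "mean g x s = integral (cbox (- a) a) (\<lambda>y. g y * (2 * radial 1 x s y / s ^ ?n))" if "s \<in> ?U" for s
    unfolding mean_def
  proof (rule integral_lborel_eq_integral_cbox)
    show "continuous_on UNIV (\<lambda>y. g y * (2 * radial 1 x s y / s ^ ?n))"
      using that by (intro continuous_intros g continuous_on_radial) auto
    fix y assume "y \<notin> cbox (- a) a"
    then have "y \<notin> cball x s" using a that by (auto simp: subset_iff)
    then show "g y * (2 * radial 1 x s y / s ^ ?n) = 0" using radial_zero[of s y x 1] that by simp
  qed
  have "((\<lambda>s. integral (cbox (- a) a) (\<lambda>y. g y * (2 * radial 1 x s y / s ^ ?n))) has_field_derivative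
      integral (cbox (- a) a) (F' t)) (at t within ?U)"
  proof (rule leibniz_rule_field_derivative)
    fix s y assume s: "s \<in> ?U"
    have n: "s * s ^ (?n - 1) = s ^ ?n" by (simp add: power_eq_if)
    have "((\<lambda>s. radial 1 x s y) has_real_derivative radial 2 x s y * (2 * (norm (y - x))\<^sup>2 / s ^ 3)) (at s)"
      unfolding radial_def
      by (rule DERIV_cong[OF DERIV_chain2[OF bump_deriv]])
        (use s in \<open>auto intro!: derivative_eq_intros simp: numeral_2_eq_2[symmetric] power3_eq_cube power2_eq_square field_simps\<close>)
    then have "((\<lambda>s. g y * (2 * radial 1 x s y / s ^ ?n)) has_real_derivative
        g y * (2 * ((radial 2 x s y * (2 * (norm (y - x))\<^sup>2 / s ^ 3)) * s ^ ?n - radial 1 x s y * (?n * s ^ (?n - 1))) / (s ^ ?n * s ^ ?n))) (at s)"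
      using s by (auto intro!: derivative_eq_intros simp: algebra_simps)
    moreover have "g y * (2 * ((radial 2 x s y * (2 * (norm (y - x))\<^sup>2 / s ^ 3)) * s ^ ?n - radial 1 x s y * (?n * s ^ (?n - 1))) / (s ^ ?n * s ^ ?n)) = F' s y"
      using s unfolding F'_def laplacian_radial_0 n[symmetric]
      by (simp add: field_simps power4_eq_xxxx power3_eq_cube power2_eq_square)
    ultimately show "((\<lambda>s. g y * (2 * radial 1 x s y / s ^ ?n)) has_real_derivative F' s y) (at s within ?U)"
      using has_field_derivative_at_within by metis
  next
    fix s assume "s \<in> ?U"
    then show "(\<lambda>y. g y * (2 * radial 1 x s y / s ^ ?n)) integrable_on cbox (- a) a"
      by (intro integrable_continuous continuous_intros continuous_on_radial continuous_on_subset[OF g]) auto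
  next
    show "continuous_on (?U \<times> cbox (- a) a) (\<lambda>(s, y). F' s y)"
      unfolding F'_def laplacian_radial_0 radial_def case_prod_unfold
      by (intro continuous_intros continuous_on_compose2[OF g]) auto
  qed (use t in auto)
  then have "((\<lambda>s. integral (cbox (- a) a) (\<lambda>y. g y * (2 * radial 1 x s y / s ^ ?n))) has_field_derivative
      integral (cbox (- a) a) (F' t)) (at t)"
    using t by (simp add: at_within_open[of t ?U])
  then have "(mean g x has_field_derivative integral (cbox (- a) a) (F' t)) (at t)"
    by (rule has_field_derivative_transform_within_open[of _ _ _ ?U]) (use t eq in auto)
  moreover have "integral (cbox (- a) a) (F' t) = (LINT y|lborel. F' t y)"
  proof (rule integral_lborel_eq_integral_cbox[symmetric])
    show "continuous_on UNIV (F' t)" unfolding F'_def laplacian_radial_0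
      using t by (intro continuous_intros g continuous_on_radial) auto
    fix y assume "y \<notin> cbox (- a) a"
    then have "y \<notin> cball x t" using a t by (auto simp: subset_iff)
    then show "F' t y = 0" by (simp add: F'_def laplacian_radial_0 radial_zero[OF t] del: mem_cball)
  qed
  moreover have "(LINT y|lborel. F' t y) = t / t ^ ?n * (LINT y|lborel. g y * laplacian (radial 0 x t) y)"
    unfolding F'_def by (simp add: mult.left_commute)
  moreover have "(LINT y|lborel. g y * laplacian (radial 0 x t) y) = (LINT y|lborel. f y * radial 0 x t y)"
    using w test_function_radial[OF t, of 0 x] unfolding weak_laplacian_def by blast
  ultimately show ?thesis by simp
qed

definition mean_mass :: "'a::euclidean_space itself \<Rightarrow> real" where
  "mean_mass _ = mean (\<lambda>_. 1) (0::'a) 1"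

text \<open>Constants have Laplacian 0, so \<open>mean_deriv\<close> makes the mass constant in
  \<open>t\<close>; this stands in for a change of variables by scaling. Translation removes the
  dependence on \<open>x\<close>.\<close>

lemma mean_const:
  fixes x :: "'a::euclidean_space"
  assumes t: "t > 0" shows "mean (\<lambda>_. c) x t = c * mean_mass TYPE('a)"
proof -
  have "(mean (\<lambda>_. 1) x has_real_derivative 0) (at s)" if "s > 0" for s
    using mean_deriv[OF weak_laplacian_const that, of 1 x] by simp
  then have "\<exists>c. \<forall>s\<in>{0<..}. mean (\<lambda>_. 1) x s = c"
    by (intro has_field_derivative_zero_constant) (auto intro: has_field_derivative_at_within)
  then have "mean (\<lambda>_. 1) x t = mean (\<lambda>_. 1) x 1" using t by auto
  also have "mean (\<lambda>_. 1) x 1 = mean (\<lambda>_. 1) (0::'a) 1"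
  proof -
    have "(\<lambda>y::'a. 2 * radial 1 0 1 y) \<in> borel_measurable borel"
      by (intro borel_measurable_continuous_onI continuous_intros continuous_on_radial)
    from integral_lborel_translation[OF this, of "- x"] show ?thesis by (simp add: mean_def radial_def)
  qed
  moreover have "mean (\<lambda>_. c) x t = c * mean (\<lambda>_. 1) x t"
    unfolding mean_def by (subst integral_mult_right_zero[symmetric]) simp
  ultimately show ?thesis by (simp add: mean_mass_def)
qed

lemma mean_mass_pos: "mean_mass TYPE('a::euclidean_space) > 0"
proof -
  \<comment> \<open>On the ball of radius 1/2 the argument \<open>s = 1 - |y|^2\<close> lies between
    3/4 and 1, so \<open>exp (-1/s) / s^2 \<ge> exp (-4/3)\<close>; the 2 is the factor in
    \<open>mean\<close>.\<close>
  let ?c = "2 * exp (- (4 / 3)) :: real"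
  have i: "integrable lborel (\<lambda>y::'a. 2 * radial 1 0 1 y)"
    by (rule integrable_continuous_cball[of _ 0 1]) (auto intro!: continuous_intros continuous_on_radial radial_zero simp del: mem_cball)
  have "(LINT y|lborel. ?c * indicator (cball (0::'a) (1/2)) y) \<le> (LINT y|lborel. 2 * radial 1 (0::'a) 1 y)"
  proof (rule integral_mono[OF _ i])
    show "integrable lborel (\<lambda>y. ?c * indicator (cball (0::'a) (1/2)) y)"
      by (intro integrable_mult_right integrable_indicator_cball)
    fix y :: 'a
    show "?c * indicator (cball 0 (1/2)) y \<le> 2 * radial 1 0 1 y"
    proof (cases "y \<in> cball 0 (1/2)")
      case True
      then have "(norm y)\<^sup>2 \<le> (1/2)\<^sup>2" by (intro power_mono) auto
      then have s: "1 - (norm y)\<^sup>2 \<ge> 3/4" by (simp add: power2_eq_square)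
      let ?s = "1 - (norm y)\<^sup>2"
      have "exp (- (4/3)) \<le> exp (- (1 / ?s))" using s by (simp add: field_simps)
      also have "\<dots> \<le> exp (- (1 / ?s)) / ?s\<^sup>2"
      proof -
        have "?s\<^sup>2 \<le> 1" "0 < ?s" using s by (auto intro!: power_le_one)
        then show ?thesis by (simp add: le_divide_eq mult_left_le)
      qed
      also have "\<dots> = radial 1 0 1 y" using s bump_1[of ?s] by (simp add: radial_def)
      finally show ?thesis using True by simp
    qed (simp add: radial_def bump_1_nonneg)
  qed
  moreover have "(LINT y|lborel. ?c * indicator (cball (0::'a) (1/2)) y) = ?c * measure lborel (cball (0::'a) (1/2))"
    by simp
  moreover have "?c * measure lborel (cball (0::'a) (1/2)) > 0" by (simp add: content_cball)
  moreover have "mean_mass TYPE('a) = (LINT y|lborel. 2 * radial 1 (0::'a) 1 y)" by (simp add: mean_mass_def mean_def)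
  ultimately show ?thesis by linarith
qed

section \<open>Averages near scale 0\<close>

lemma integrable_mean:
  fixes x :: "'a::euclidean_space"
  assumes "continuous_on UNIV g" "t > 0"
  shows "integrable lborel (\<lambda>y. g y * (2 * radial 1 x t y / t ^ DIM('a)))"
  using assms radial_zero[OF assms(2)]
  by (intro integrable_continuous_cball[of _ x t] continuous_intros continuous_on_radial) auto

lemma mean_diff:
  fixes x :: "'a::euclidean_space"
  assumes "continuous_on UNIV g" "continuous_on UNIV h" "t > 0"
  shows "mean (\<lambda>y. g y - h y) x t = mean g x t - mean h x t"
  unfolding mean_def left_diff_distrib using assms by (intro Bochner_Integration.integral_diff integrable_mean)

text \<open>The kernel is nonnegative, so an oscillation of at most \<open>e\<close> over its
  support costs only the total mass times \<open>e\<close>.\<close>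

lemma mean_close:
  fixes x :: "'a::euclidean_space"
  assumes g: "continuous_on UNIV g" and t: "t > 0" and e: "\<And>y. y \<in> cball x t \<Longrightarrow> \<bar>g y - g x\<bar> \<le> e"
  shows "\<bar>mean g x t - mean_mass TYPE('a) * g x\<bar> \<le> mean_mass TYPE('a) * e"
proof -
  have nn: "0 \<le> 2 * radial 1 x t y / t ^ DIM('a)" for y
    using t bump_1_nonneg by (simp add: radial_def)
  have "mean g x t - mean_mass TYPE('a) * g x = mean (\<lambda>y. g y - g x) x t"
    using t by (simp add: mean_diff[OF g] continuous_intros mean_const mult.commute)
  also have "\<bar>\<dots>\<bar> \<le> mean (\<lambda>_. e) x t" unfolding mean_def real_norm_def[symmetric]
  proof (rule Bochner_Integration.integral_norm_bound_integral)
    show "integrable lborel (\<lambda>y. (g y - g x) * (2 * radial 1 x t y / t ^ DIM('a)))"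
      "integrable lborel (\<lambda>y. e * (2 * radial 1 x t y / t ^ DIM('a)))"
      using t by (intro integrable_mean continuous_intros g; simp)+
    fix y
    show "norm ((g y - g x) * (2 * radial 1 x t y / t ^ DIM('a))) \<le> e * (2 * radial 1 x t y / t ^ DIM('a))"
    proof (cases "y \<in> cball x t")
      case True
      from mult_right_mono[OF e[OF True] nn[of y]] show ?thesis
        by (simp only: real_norm_def abs_mult abs_of_nonneg[OF nn])
    qed (simp add: radial_zero[OF t])
  qed
  finally show ?thesis using t by (simp add: mean_const mult.commute)
qed

lemma mean_tendsto:
  fixes x :: "'a::euclidean_space"
  assumes g: "continuous_on UNIV g"
  shows "(mean g x \<longlongrightarrow> mean_mass TYPE('a) * g x) (at_right 0)"
proof (rule tendstoI)
  fix e :: real assume "e > 0"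
  let ?m = "mean_mass TYPE('a)"
  have m: "?m > 0" by (rule mean_mass_pos)
  have "isCont g x" using g by (simp add: continuous_on_eq_continuous_at)
  moreover have "e / (2 * ?m) > 0" using \<open>e > 0\<close> m by simp
  ultimately obtain d where "d > 0" and d: "\<And>y. dist y x < d \<Longrightarrow> dist (g y) (g x) < e / (2 * ?m)"
    unfolding continuous_at_eps_delta by blast
  have "dist (mean g x t) (?m * g x) < e" if "0 < t" "t < d" for t
  proof -
    have "\<bar>mean g x t - ?m * g x\<bar> \<le> ?m * (e / (2 * ?m))"
      using that d by (intro mean_close g) (auto simp: dist_commute dist_real_def[symmetric] intro!: less_imp_le)
    also have "\<dots> < e" using m \<open>e > 0\<close> by simp
    finally show ?thesis by (simp add: dist_real_def)
  qed
  then show "\<forall>\<^sub>F t in at_right 0. dist (mean g x t) (?m * g x) < e"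
    unfolding eventually_at_right_field using \<open>d > 0\<close> by blast
qed

text \<open>Replaces integration of \<open>D'\<close> by an explicit primitive \<open>G\<close> of a
  majorant: both \<open>G - D\<close> and \<open>G + D\<close> are nondecreasing.\<close>

lemma deriv_bound_diff:
  fixes D G :: "real \<Rightarrow> real"
  assumes "a \<le> b" "\<And>t. a \<le> t \<Longrightarrow> t \<le> b \<Longrightarrow> (D has_real_derivative D' t) (at t)"
    "\<And>t. a \<le> t \<Longrightarrow> t \<le> b \<Longrightarrow> (G has_real_derivative G' t) (at t)"
    "\<And>t. a \<le> t \<Longrightarrow> t \<le> b \<Longrightarrow> \<bar>D' t\<bar> \<le> G' t"
  shows "\<bar>D b - D a\<bar> \<le> G b - G a"
proof -
  have "G a - D a \<le> G b - D b"
    by (rule DERIV_nonneg_imp_nondecreasing[OF assms(1)])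
      (use assms in \<open>force intro!: exI derivative_eq_intros\<close>)
  moreover have "G a + D a \<le> G b + D b"
    by (rule DERIV_nonneg_imp_nondecreasing[OF assms(1)])
      (use assms in \<open>force intro!: exI derivative_eq_intros\<close>)
  ultimately show ?thesis by linarith
qed

section \<open>Coulomb singularities\<close>

text \<open>The sum is the squared norm of the adjoint of \<open>L\<close> applied to
  \<open>v\<close>, so \<open>L\<close> composed with its adjoint is \<open>c\<close> times the
  identity of the three-dimensional space. Then the Laplacian of \<open>f (L y)\<close> is
  \<open>c\<close> times that of \<open>f\<close> taken at \<open>L y\<close>; this treats
  \<open>x_j\<close> and \<open>x_j - x_k\<close> alike.\<close>

definition similar_projection :: "('a::euclidean_space \<Rightarrow> real^3) \<Rightarrow> real \<Rightarrow> bool" where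
  "similar_projection L c \<longleftrightarrow> bounded_linear L \<and> c > 0 \<and> (\<forall>v. (\<Sum>b\<in>Basis. (v \<bullet> L b)\<^sup>2) = c * (norm v)\<^sup>2)"

text \<open>The Hilbert-Schmidt norms of \<open>L\<close> and of its adjoint agree, and the latter
  is a sum over the three basis vectors of the target.\<close>

lemma similar_projection_trace:
  assumes "similar_projection L c" shows "(\<Sum>b\<in>Basis. L b \<bullet> L b) = 3 * c"
proof -
  have "(\<Sum>b\<in>Basis. L b \<bullet> L b) = (\<Sum>b\<in>Basis. \<Sum>i\<in>(Basis::(real^3) set). (i \<bullet> L b)\<^sup>2)"
    by (subst euclidean_inner) (simp add: power2_eq_square inner_commute)
  also have "\<dots> = (\<Sum>i\<in>(Basis::(real^3) set). \<Sum>b\<in>Basis. (i \<bullet> L b)\<^sup>2)" by (rule sum.swap)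
  also have "\<dots> = (\<Sum>i\<in>(Basis::(real^3) set). c)"
    using assms by (intro sum.cong) (auto simp: similar_projection_def)
  finally show ?thesis by simp
qed

text \<open>The kernel of \<open>L\<close> lies in the hyperplane orthogonal to the adjoint image of
  one basis vector, which is nonzero because \<open>c > 0\<close>.\<close>

lemma similar_projection_AE_nonzero:
  fixes L :: "'a::euclidean_space \<Rightarrow> real^3"
  assumes "similar_projection L c" shows "AE y in lborel. L y \<noteq> 0"
proof -
  obtain i :: "real^3" where i: "i \<in> Basis" using nonempty_Basis by blast
  have lin: "linear L" using assms by (simp add: similar_projection_def bounded_linear.linear)
  define w where "w = adjoint L i"
  have w: "y \<bullet> w = L y \<bullet> i" for y unfolding w_def by (rule adjoint_works[OF lin])
  have "(\<Sum>b\<in>Basis. (i \<bullet> L b)\<^sup>2) > 0" using assms i by (simp add: similar_projection_def)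
  then have "w \<noteq> 0" using w by (auto simp: inner_commute)
  then have "negligible {y. w \<bullet> y = 0}" by (intro negligible_hyperplane) auto
  moreover have "closed {y. w \<bullet> y = 0}" by (rule closed_hyperplane)
  ultimately have "{y. w \<bullet> y = 0} \<in> null_sets lborel"
    by (subst null_sets_completion_iff[symmetric]) (auto simp: negligible_iff_null_sets)
  then show ?thesis by (rule AE_I') (use w in \<open>auto simp: inner_commute\<close>)
qed

lemma norm_projection_lipschitz:
  assumes L: "bounded_linear L"
  shows "\<bar>norm (L x) - norm (L y)\<bar> \<le> onorm L * norm (x - y)"
proof -
  have "\<bar>norm (L x) - norm (L y)\<bar> \<le> norm (L (x - y))"
    using norm_triangle_ineq3[of "L x" "L y"] by (simp add: linear_diff[OF bounded_linear.linear[OF L]])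
  also have "\<dots> \<le> onorm L * norm (x - y)" by (rule onorm[OF L])
  finally show ?thesis .
qed

text \<open>The norm of the pair \<open>(L y, e)\<close>: for \<open>e > 0\<close> it stays away
  from 0 and is therefore smooth.\<close>

definition soft_norm :: "('a::euclidean_space \<Rightarrow> real^3) \<Rightarrow> real \<Rightarrow> 'a \<Rightarrow> real" where
  "soft_norm L e y = sqrt ((norm (L y))\<^sup>2 + e\<^sup>2)"

lemma soft_norm_pos: "e > 0 \<Longrightarrow> soft_norm L e y > 0"
  unfolding soft_norm_def by (simp add: add_nonneg_pos)

lemma soft_norm_ge: "norm (L y) \<le> soft_norm L e y"
  unfolding soft_norm_def by (rule real_le_rsqrt) simp

text \<open>The reverse triangle inequality in the plane; the resulting Lipschitz bound is uniform
  in \<open>e\<close>.\<close>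

lemma soft_norm_diff: "\<bar>soft_norm L e y - soft_norm L e x\<bar> \<le> \<bar>norm (L y) - norm (L x)\<bar>"
  using norm_triangle_ineq3[of "(norm (L y), e)" "(norm (L x), e)"]
  by (simp add: soft_norm_def norm_Pair)

lemma soft_norm_deriv:
  assumes L: "bounded_linear L" and e: "e > 0"
  shows "(soft_norm L e has_derivative (\<lambda>h. (L y \<bullet> L h) / soft_norm L e y)) (at y)"
proof -
  have p: "(norm (L y))\<^sup>2 + e\<^sup>2 > 0" using e by (simp add: add_nonneg_pos)
  have "((\<lambda>y. L y \<bullet> L y + e\<^sup>2) has_derivative (\<lambda>h. 2 * (L y \<bullet> L h))) (at y)"
    by (auto intro!: derivative_eq_intros bounded_linear_imp_has_derivative[OF L] simp: inner_commute)
  then have d: "((\<lambda>y. (norm (L y))\<^sup>2 + e\<^sup>2) has_derivative (\<lambda>h. 2 * (L y \<bullet> L h))) (at y)"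
    by (simp add: power2_norm_eq_inner)
  show ?thesis unfolding soft_norm_def
    by (rule has_derivative_eq_rhs[OF has_derivative_real_sqrt[OF p d]]) (simp add: field_simps)
qed

lemma continuous_on_soft_norm:
  assumes "bounded_linear L" shows "continuous_on UNIV (soft_norm L e)"
  unfolding soft_norm_def
  by (intro continuous_intros bounded_linear.continuous_on[OF assms])

lemma soft_norm_deriv2:
  assumes L: "bounded_linear L" and e: "e > 0"
  shows "((\<lambda>y. (L y \<bullet> L b) / soft_norm L e y) has_derivative
    (\<lambda>h. (L h \<bullet> L b) / soft_norm L e y - (L y \<bullet> L b) * (L y \<bullet> L h) / soft_norm L e y ^ 3)) (at y)"
proof -
  have p: "soft_norm L e y \<noteq> 0" using soft_norm_pos[OF e, of L y] by simp
  have "((\<lambda>y. L y \<bullet> L b) has_derivative (\<lambda>h. L h \<bullet> L b)) (at y)"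
    by (auto intro!: derivative_eq_intros bounded_linear_imp_has_derivative[OF L])
  from has_derivative_divide'[OF this soft_norm_deriv[OF L e] p]
  show ?thesis by (rule has_derivative_eq_rhs) (use p in \<open>simp add: field_simps power3_eq_cube power2_eq_square\<close>)
qed

text \<open>With \<open>S\<close> the soft norm, the second derivatives add up to
  \<open>3 c / S - c |L y|^2 / S^3\<close>: the trace of \<open>L\<close> gives the first term, the
  defining identity of \<open>similar_projection\<close> at \<open>v = L y\<close> the second.
  Inserting \<open>S^2 = |L y|^2 + e^2\<close> gives the density on the right.\<close>

lemma soft_norm_green:
  fixes L :: "'a::euclidean_space \<Rightarrow> real^3"
  assumes P: "similar_projection L c" and e: "e > 0" and v: "test_function v"
  shows "(LINT y|lborel. soft_norm L e y * laplacian v y)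
    = (LINT y|lborel. v y * (c * (2 * (norm (L y))\<^sup>2 + 3 * e\<^sup>2) / soft_norm L e y ^ 3))"
proof -
  have L: "bounded_linear L" using P by (simp add: similar_projection_def)
  note cL = bounded_linear.continuous_on[OF L]
  have p: "soft_norm L e y \<noteq> 0" for y using soft_norm_pos[OF e, of L y] by simp
  let ?g = "soft_norm L e"
  have d: "?g differentiable (at y)" for y by (rule has_derivative_differentiable[OF soft_norm_deriv[OF L e]])
  have d1: "partial_deriv b ?g = (\<lambda>y. (L y \<bullet> L b) / ?g y)" for b
    by (rule ext, rule partial_deriv_eq[OF soft_norm_deriv[OF L e]])
  have d2: "partial_deriv b (partial_deriv b ?g) = (\<lambda>y. (L b \<bullet> L b) / ?g y - (L y \<bullet> L b)\<^sup>2 / ?g y ^ 3)" for b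
    unfolding d1 by (rule ext, subst partial_deriv_eq[OF soft_norm_deriv2[OF L e]]) (simp add: power2_eq_square)
  have c1: "continuous_on UNIV (partial_deriv b ?g)" for b
    unfolding d1 by (intro continuous_intros cL continuous_on_soft_norm[OF L]) (use p in auto)
  have c2: "continuous_on UNIV (partial_deriv b (partial_deriv b ?g))" for b
    unfolding d2 by (intro continuous_intros cL continuous_on_soft_norm[OF L]) (use p in auto)
  have dd: "partial_deriv b ?g differentiable (at y)" for b y
    unfolding d1 by (rule has_derivative_differentiable[OF soft_norm_deriv2[OF L e]])
  obtain r where r: "\<And>x. x \<notin> cball 0 r \<Longrightarrow> v x = 0" using test_function_cball[OF v] by blast
  have *: "(LINT y|lborel. ?g y * partial_deriv b (partial_deriv b v) y)
      = (LINT y|lborel. v y * partial_deriv b (partial_deriv b ?g) y)" if b: "b \<in> Basis" for b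
  proof -
    have "(LINT y|lborel. v y * partial_deriv b (partial_deriv b ?g) y)
        = - (LINT y|lborel. partial_deriv b v y * partial_deriv b ?g y)"
      by (rule test_function_by_parts[OF v dd c2 b])
    also have "\<dots> = (LINT y|lborel. partial_deriv b (partial_deriv b v) y * ?g y)"
      using test_function_by_parts[OF test_function_partial_deriv[OF v b] d c1 b] by simp
    finally show ?thesis by (simp add: mult.commute)
  qed
  have "(LINT y|lborel. ?g y * laplacian v y) = (\<Sum>b\<in>Basis. LINT y|lborel. ?g y * partial_deriv b (partial_deriv b v) y)"
    unfolding laplacian_def sum_distrib_left
  proof (rule Bochner_Integration.integral_sum)
    fix b :: 'a assume b: "b \<in> Basis"
    have z: "partial_deriv b (partial_deriv b v) x = 0" if "x \<notin> cball 0 r" for x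
      by (rule partial_deriv_zero_outside[OF partial_deriv_zero_outside[OF r] that])
    show "integrable lborel (\<lambda>y. ?g y * partial_deriv b (partial_deriv b v) y)"
      using z test_function_cont[OF test_function_partial_deriv[OF test_function_partial_deriv[OF v b] b]]
      by (intro integrable_locally_integrable_mult[where a=0 and r=r] locally_integrable_continuous continuous_on_soft_norm[OF L])
  qed
  also have "\<dots> = (\<Sum>b\<in>Basis. LINT y|lborel. v y * partial_deriv b (partial_deriv b ?g) y)"
    by (intro sum.cong * refl)
  also have "\<dots> = (LINT y|lborel. (\<Sum>b\<in>Basis. v y * partial_deriv b (partial_deriv b ?g) y))"
  proof (rule Bochner_Integration.integral_sum[symmetric])
    fix b :: 'a
    show "integrable lborel (\<lambda>y. v y * partial_deriv b (partial_deriv b ?g) y)"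
      using integrable_locally_integrable_mult[OF locally_integrable_continuous[OF c2] test_function_cont[OF v], of 0 r b] r
      by (simp add: mult.commute del: mem_cball)
  qed
  also have "(\<lambda>y. \<Sum>b\<in>Basis. v y * partial_deriv b (partial_deriv b ?g) y)
      = (\<lambda>y. v y * (c * (2 * (norm (L y))\<^sup>2 + 3 * e\<^sup>2) / ?g y ^ 3))"
  proof
    fix y
    have "(\<Sum>b\<in>Basis. partial_deriv b (partial_deriv b ?g) y)
        = (\<Sum>b\<in>Basis. L b \<bullet> L b) / ?g y - (\<Sum>b\<in>Basis. (L y \<bullet> L b)\<^sup>2) / ?g y ^ 3"
      by (simp add: d2 sum_subtractf sum_divide_distrib)
    also have "\<dots> = 3 * c / ?g y - c * (norm (L y))\<^sup>2 / ?g y ^ 3"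
      using P similar_projection_trace[OF P] by (simp add: similar_projection_def)
    also have "\<dots> = c * (3 * (?g y)\<^sup>2 - (norm (L y))\<^sup>2) / ?g y ^ 3"
      using p[of y] by (simp add: field_simps power3_eq_cube power2_eq_square)
    also have "(?g y)\<^sup>2 = (norm (L y))\<^sup>2 + e\<^sup>2" by (simp add: soft_norm_def)
    finally show "(\<Sum>b\<in>Basis. v y * partial_deriv b (partial_deriv b ?g) y)
        = v y * (c * (2 * (norm (L y))\<^sup>2 + 3 * e\<^sup>2) / ?g y ^ 3)"
      by (simp add: sum_distrib_left[symmetric] algebra_simps)
  qed
  finally show ?thesis .
qed

text \<open>Fatou's lemma, with integrability of the limit as a conclusion. This is how
  \<open>1 / norm (L y)\<close> becomes integrable in the first place.\<close>

lemma integral_fatou_bound: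
  fixes u :: "nat \<Rightarrow> 'a \<Rightarrow> real" and M :: "'a measure"
  assumes i: "\<And>k. integrable M (u k)" and nn: "\<And>k x. 0 \<le> u k x" and lim: "\<And>x. (\<lambda>k. u k x) \<longlonglongrightarrow> w x"
    and K: "\<And>k. (LINT x|M. u k x) \<le> K"
  shows "integrable M w" "(LINT x|M. w x) \<le> K"
proof -
  have [measurable]: "u k \<in> borel_measurable M" for k using i by auto
  have m: "w \<in> borel_measurable M" by (rule borel_measurable_LIMSEQ_real[OF lim]) simp
  have w: "0 \<le> w x" for x by (rule LIMSEQ_le_const[OF lim]) (use nn in auto)
  have "0 \<le> (LINT x|M. u 0 x)" using nn by (intro integral_nonneg_AE) simp
  then have K0: "0 \<le> K" using K[of 0] by linarith
  have "(\<integral>\<^sup>+x. ennreal (w x) \<partial>M) = (\<integral>\<^sup>+x. liminf (\<lambda>k. ennreal (u k x)) \<partial>M)"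
    by (intro nn_integral_cong lim_imp_Liminf[symmetric] tendsto_ennrealI lim) simp
  also have "\<dots> \<le> liminf (\<lambda>k. \<integral>\<^sup>+x. ennreal (u k x) \<partial>M)" by (rule nn_integral_liminf) simp
  also have "\<dots> \<le> liminf (\<lambda>k::nat. ennreal K)"
    using i nn K by (intro Liminf_mono always_eventually) (auto simp: nn_integral_eq_integral intro!: ennreal_leI)
  also have "\<dots> = ennreal K" by (rule Liminf_const) simp
  finally have b: "(\<integral>\<^sup>+x. ennreal (w x) \<partial>M) \<le> ennreal K" .
  then show iw: "integrable M w"
    using m w by (intro integrableI_nonneg) (auto intro: le_less_trans)
  then show "(LINT x|M. w x) \<le> K"
    using b w K0 by (simp add: nn_integral_eq_integral)
qed

lemma soft_norm_tendsto: "(\<lambda>k. soft_norm L (1 / real (Suc k)) y) \<longlonglongrightarrow> norm (L y)"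
proof -
  have "(\<lambda>k. sqrt ((norm (L y))\<^sup>2 + (1 / real (Suc k))\<^sup>2)) \<longlonglongrightarrow> sqrt ((norm (L y))\<^sup>2 + 0\<^sup>2)"
    by (intro tendsto_intros) (use LIMSEQ_inverse_real_of_nat in \<open>simp add: inverse_eq_divide\<close>)
  then show ?thesis by (simp add: soft_norm_def)
qed

text \<open>Up to the factor \<open>2 c\<close>, the singular function is the Laplacian of the
  Lipschitz function \<open>norm (L y)\<close>. Oscillation \<open>O(t)\<close>, Laplacian of the
  kernel \<open>O(1/t^2)\<close> and volume \<open>O(t^n)\<close> multiply to
  \<open>t^n / t\<close>, uniformly in \<open>x\<close>.\<close>

lemma coulomb_integral_radial:
  fixes L :: "'a::euclidean_space \<Rightarrow> real^3"
  assumes P: "similar_projection L c"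
  obtains K where "K > 0" "\<And>x t. t > 0 \<Longrightarrow> integrable lborel (\<lambda>y. radial 0 x t y * (1 / norm (L y)))"
    "\<And>x t. t > 0 \<Longrightarrow> (LINT y|lborel. radial 0 x t y * (1 / norm (L y))) \<le> K * (t ^ DIM('a) / t)"
proof -
  have L: "bounded_linear L" and c: "c > 0" using P by (auto simp: similar_projection_def)
  note cL = bounded_linear.continuous_on[OF L]
  define B where "B = 4 * bump_bound 2 + 2 * DIM('a) * bump_bound 1"
  have B: "B > 0" unfolding B_def using bump_bound_pos by (intro add_pos_pos mult_pos_pos) auto
  \<comment> \<open>The added 1 makes \<open>l\<close>, and with it \<open>K\<close>, strictly
    positive.\<close>
  define l where "l = onorm L + 1"
  have l: "l > 0" using onorm_pos_le[OF L] by (simp add: l_def)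
  have lip: "\<bar>norm (L y) - norm (L x)\<bar> \<le> l * norm (y - x)" for x y
  proof -
    have "\<bar>norm (L y) - norm (L x)\<bar> \<le> onorm L * norm (y - x)" by (rule norm_projection_lipschitz[OF L])
    then show ?thesis by (simp add: l_def distrib_right) (use norm_ge_zero[of "y - x"] in linarith)
  qed
  define K where "K = B * l * unit_ball_vol DIM('a) / (2 * c)"
  let ?S = "\<lambda>k. soft_norm L (1 / real (Suc k))"
  have main: "integrable lborel (\<lambda>y. radial 0 x t y * (1 / norm (L y))) \<and>
      (LINT y|lborel. radial 0 x t y * (1 / norm (L y))) \<le> K * (t ^ DIM('a) / t)" if t: "t > 0" for x :: 'a and t
  proof -
    let ?v = "radial 0 x t :: 'a \<Rightarrow> real"
    have v0: "?v y \<ge> 0" for y by (simp add: radial_def bump_0_nonneg)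
    have tv: "test_function ?v" using test_function_radial[OF t] .
    \<comment> \<open>The part of the Laplacian without \<open>e^2\<close>, divided by
      \<open>2 c\<close>. It is 0 where \<open>L y = 0\<close>, so it converges at every point to
      the kernel times \<open>1 / norm (L y)\<close> with the convention \<open>1 / 0 = 0\<close>;
      the full Laplacian would blow up there.\<close>
    let ?u = "\<lambda>k y. ?v y * ((norm (L y))\<^sup>2 / ?S k y ^ 3)"
    have pS: "?S k y > 0" for k y by (rule soft_norm_pos) simp
    have nz: "?S k y \<noteq> 0" for k y using pS[of k y] by simp
    have int1: "integrable lborel (?u k)" for k
      using nz by (intro integrable_continuous_cball[of _ x t] continuous_intros cL continuous_on_soft_norm[OF L] continuous_on_radial)
        (auto simp: radial_zero[OF t] simp del: mem_cball)
    have int2: "integrable lborel (\<lambda>y. ?v y * (c * (2 * (norm (L y))\<^sup>2 + 3 * (1 / real (Suc k))\<^sup>2) / ?S k y ^ 3))" for k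
      using nz by (intro integrable_continuous_cball[of _ x t] continuous_intros cL continuous_on_soft_norm[OF L] continuous_on_radial)
        (auto simp: radial_zero[OF t] simp del: mem_cball)
    \<comment> \<open>Green's formula moves the Laplacian onto \<open>?v\<close>, whose Laplacian has integral \<open>0\<close>, so only the
      oscillation of the soft norm over the ball enters.\<close>
    have bound: "(LINT y|lborel. ?u k y) \<le> K * (t ^ DIM('a) / t)" for k
    proof -
      have "2 * c * (LINT y|lborel. ?u k y) = (LINT y|lborel. 2 * c * ?u k y)"
        by (rule integral_mult_right_zero[symmetric])
      also have "\<dots> \<le> (LINT y|lborel. ?v y * (c * (2 * (norm (L y))\<^sup>2 + 3 * (1 / real (Suc k))\<^sup>2) / ?S k y ^ 3))"
      proof (rule integral_mono[OF integrable_mult_right[OF int1] int2])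
        fix y
        have "2 * c * (norm (L y))\<^sup>2 / ?S k y ^ 3 \<le> c * (2 * (norm (L y))\<^sup>2 + 3 * (1 / real (Suc k))\<^sup>2) / ?S k y ^ 3"
          using pS[of k y] c by (intro divide_right_mono) (auto simp: algebra_simps)
        from mult_left_mono[OF this v0[of y]]
        show "2 * c * ?u k y \<le> ?v y * (c * (2 * (norm (L y))\<^sup>2 + 3 * (1 / real (Suc k))\<^sup>2) / ?S k y ^ 3)"
          by (simp add: algebra_simps)
      qed
      also have "\<dots> = (LINT y|lborel. ?S k y * laplacian ?v y)"
        by (rule soft_norm_green[OF P _ tv, symmetric]) simp
      also have "\<dots> = (LINT y|lborel. (?S k y - ?S k x) * laplacian ?v y)"
      proof -
        obtain r where r: "continuous_on UNIV (laplacian ?v)" "\<And>x. x \<notin> cball 0 r \<Longrightarrow> laplacian ?v x = 0"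
          "\<And>x. x \<notin> cball 0 r \<Longrightarrow> ?v x = 0"
          using test_function_laplacian[OF tv] by blast
        have "integrable lborel (\<lambda>y. ?S k y * laplacian ?v y)" "integrable lborel (\<lambda>y. ?S k x * laplacian ?v y)"
          using integrable_locally_integrable_mult[OF locally_integrable_continuous r(1,2)]
            continuous_on_soft_norm[OF L] continuous_on_const by blast+
        moreover have "(LINT y|lborel. ?S k x * laplacian ?v y) = 0"
        proof -
          have "(LINT y|lborel. ?S k x * laplacian ?v y) = (LINT y|lborel. 0 * ?v y)"
            using weak_laplacian_const[of "?S k x"] tv unfolding weak_laplacian_def by blast
          then show ?thesis by simp
        qed
        ultimately show ?thesis by (simp only: left_diff_distrib Bochner_Integration.integral_diff)
      qed
      also have "\<dots> \<le> \<bar>LINT y|lborel. (?S k y - ?S k x) * laplacian ?v y\<bar>" by simp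
      also have "\<dots> \<le> B / t\<^sup>2 * (LINT y:cball x t|lborel. l * t)"
      proof (rule integral_mult_bound)
        show "locally_integrable (\<lambda>y::'a. l * t)" by (intro locally_integrable_continuous continuous_intros)
        show "\<bar>?S k y - ?S k x\<bar> \<le> l * t" if "y \<in> cball x t" for y
        proof -
          have "\<bar>?S k y - ?S k x\<bar> \<le> l * norm (y - x)" by (rule order_trans[OF soft_norm_diff]) (rule lip)
          also have "\<dots> \<le> l * t" using that l by (intro mult_left_mono) (auto simp: dist_norm norm_minus_commute)
          finally show ?thesis .
        qed
        show "\<bar>laplacian ?v y\<bar> \<le> B / t\<^sup>2" for y unfolding B_def by (rule laplacian_radial_bound[OF t])
        show "laplacian ?v y = 0" if "y \<notin> cball x t" for y
          using that by (simp add: laplacian_radial_0 radial_zero[OF t] del: mem_cball)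
      qed
      also have "\<dots> = B * l * unit_ball_vol DIM('a) * (t ^ DIM('a) / t)"
        using t by (simp add: set_lebesgue_integral_def content_cball power2_eq_square field_simps)
      finally have "(LINT y|lborel. ?u k y) \<le> B * l * unit_ball_vol DIM('a) * (t ^ DIM('a) / t) / (2 * c)"
        using c by (subst pos_le_divide_eq) (simp_all only: mult.commute mult_pos_pos zero_less_numeral)
      then show ?thesis by (simp add: K_def mult_ac)
    qed
    have lim: "(\<lambda>k. ?u k y) \<longlonglongrightarrow> ?v y * (1 / norm (L y))" for y
    proof (cases "L y = 0")
      case False
      have "(\<lambda>k. ?u k y) \<longlonglongrightarrow> ?v y * ((norm (L y))\<^sup>2 / norm (L y) ^ 3)"
        by (intro tendsto_intros soft_norm_tendsto) (use False in auto)
      then show ?thesis using False by (simp add: power3_eq_cube power2_eq_square)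
    qed simp
    have nn: "0 \<le> ?u k y" for k y using v0[of y] pS[of k y] by simp
    show ?thesis using integral_fatou_bound[OF int1 nn lim bound] by blast
  qed
  moreover have "K > 0" unfolding K_def using B l c by simp
  ultimately show thesis using that by blast
qed

lemma coulomb_integral_cball:
  fixes L :: "'a::euclidean_space \<Rightarrow> real^3"
  assumes P: "similar_projection L c"
  shows "locally_integrable (\<lambda>y. 1 / norm (L y))"
    "\<exists>K>0. \<forall>x. \<forall>t>0. (LINT y:cball x t|lborel. 1 / norm (L y)) \<le> K * (t ^ DIM('a) / t)"
proof -
  have L: "bounded_linear L" using P by (auto simp: similar_projection_def)
  have [measurable]: "(\<lambda>y. norm (L y)) \<in> borel_measurable borel"
    by (intro borel_measurable_continuous_onI continuous_intros bounded_linear.continuous_on[OF L])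
  obtain K where K: "K > 0" "\<And>x t. t > 0 \<Longrightarrow> integrable lborel (\<lambda>y. radial 0 x t y * (1 / norm (L y)))"
    "\<And>x t. t > 0 \<Longrightarrow> (LINT y|lborel. radial 0 x t y * (1 / norm (L y))) \<le> K * (t ^ DIM('a) / t)"
    using coulomb_integral_radial[OF P] by blast
  \<comment> \<open>The kernel at the doubled radius dominates \<open>?c\<close> on the ball of
    radius \<open>t\<close>, because its argument is at least \<open>1 - 1/4\<close> there.\<close>
  let ?c = "exp (- (4 / 3)) :: real"
  have ge: "indicator (cball x t) y * (1 / norm (L y)) \<le> (radial 0 x (2 * t) y * (1 / norm (L y))) / ?c"
    if t: "t > 0" for x y :: 'a and t
  proof (cases "y \<in> cball x t")
    case True
    then have "(norm (y - x))\<^sup>2 \<le> t\<^sup>2" by (intro power_mono) (auto simp: dist_norm norm_minus_commute)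
    then have "(norm (y - x))\<^sup>2 / (2 * t)\<^sup>2 \<le> t\<^sup>2 / (2 * t)\<^sup>2" by (rule divide_right_mono) simp
    moreover have "t\<^sup>2 / (2 * t)\<^sup>2 = 1 / 4" using t by (simp add: power2_eq_square)
    ultimately have s: "1 - (norm (y - x))\<^sup>2 / (2 * t)\<^sup>2 \<ge> 3 / 4" by linarith
    let ?s = "1 - (norm (y - x))\<^sup>2 / (2 * t)\<^sup>2"
    have "1 / ?s \<le> 1 / (3 / 4)" using s by (intro divide_left_mono mult_pos_pos) linarith+
    then have "?c \<le> exp (- (1 / ?s))" by (subst exp_le_cancel_iff) simp
    also have "\<dots> = radial 0 x (2 * t) y" using s bump_0[of ?s] by (simp add: radial_def)
    finally have "1 \<le> radial 0 x (2 * t) y / ?c" by simp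
    from mult_right_mono[OF this, of "1 / norm (L y)"] show ?thesis using True by (simp add: mult.commute)
  next
    case False
    then show ?thesis by (simp add: radial_def bump_0_nonneg)
  qed
  have int: "set_integrable lborel (cball x t) (\<lambda>y. 1 / norm (L y))" if t: "t > 0" for x t
    unfolding set_integrable_def
  proof (rule Bochner_Integration.integrable_bound)
    show "integrable lborel (\<lambda>y. (radial 0 x (2 * t) y * (1 / norm (L y))) / ?c)"
      using K(2)[of "2 * t" x] t by (intro integrable_divide) simp
    have [measurable]: "cball x t \<in> sets borel" by simp
    show "(\<lambda>y. indicator (cball x t) y *\<^sub>R (1 / norm (L y))) \<in> borel_measurable lborel" by measurable
    show "AE y in lborel. norm (indicator (cball x t) y *\<^sub>R (1 / norm (L y))) \<le> norm ((radial 0 x (2 * t) y * (1 / norm (L y))) / ?c)"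
    proof (rule AE_I2)
      fix y
      show "norm (indicator (cball x t) y *\<^sub>R (1 / norm (L y))) \<le> norm ((radial 0 x (2 * t) y * (1 / norm (L y))) / ?c)"
        using order_trans[OF ge[OF t, of x y] abs_ge_self] by simp
    qed
  qed
  have "set_integrable lborel (cball x r) (\<lambda>y. 1 / norm (L y))" for x r
  proof (cases "r > 0")
    case False
    then show ?thesis using int[of 1 x] by (intro set_integrable_subset[OF int[of 1 x]]) auto
  qed (rule int)
  then show "locally_integrable (\<lambda>y. 1 / norm (L y))" by (simp add: locally_integrable_def)
  have "(LINT y:cball x t|lborel. 1 / norm (L y)) \<le> (K * 2 ^ DIM('a) / (2 * ?c)) * (t ^ DIM('a) / t)" if t: "t > 0" for x t
  proof -
    have "(LINT y:cball x t|lborel. 1 / norm (L y)) \<le> (LINT y|lborel. (radial 0 x (2 * t) y * (1 / norm (L y))) / ?c)"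
      unfolding set_lebesgue_integral_def
    proof (rule integral_mono)
      show "integrable lborel (\<lambda>y. indicator (cball x t) y *\<^sub>R (1 / norm (L y)))"
        using int[OF t] by (simp add: set_integrable_def)
      show "integrable lborel (\<lambda>y. (radial 0 x (2 * t) y * (1 / norm (L y))) / ?c)"
        using K(2)[of "2 * t" x] t by (intro integrable_divide) simp
    qed (use ge[OF t] in simp)
    also have "\<dots> = (LINT y|lborel. radial 0 x (2 * t) y * (1 / norm (L y))) / ?c"
      by (rule integral_divide_zero)
    also have "\<dots> \<le> (K * ((2 * t) ^ DIM('a) / (2 * t))) / ?c" using K(3)[of "2 * t" x] t by (intro divide_right_mono) auto
    also have "\<dots> = (K * 2 ^ DIM('a) / (2 * ?c)) * (t ^ DIM('a) / t)" by (simp add: power_mult_distrib mult_ac)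
    finally show ?thesis .
  qed
  moreover have "K * 2 ^ DIM('a) / (2 * ?c) > 0" using K by simp
  ultimately show "\<exists>K>0. \<forall>x. \<forall>t>0. (LINT y:cball x t|lborel. 1 / norm (L y)) \<le> K * (t ^ DIM('a) / t)" by blast
qed

text \<open>The limit \<open>e\<close> to 0 in \<open>soft_norm_green\<close>. The density is at
  most \<open>3 c / norm (L y)\<close>, which is locally integrable, and tends to
  \<open>2 c / norm (L y)\<close> off the null set \<open>L y = 0\<close>; dominated convergence
  shows that nothing concentrates on that set.\<close>

lemma weak_laplacian_norm_projection:
  fixes L :: "'a::euclidean_space \<Rightarrow> real^3"
  assumes P: "similar_projection L c"
  shows "weak_laplacian (\<lambda>y. norm (L y)) (\<lambda>y. 2 * c * (1 / norm (L y)))"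
  unfolding weak_laplacian_def
proof (intro conjI allI impI)
  have L: "bounded_linear L" and c: "c > 0" using P by (auto simp: similar_projection_def)
  note cL = bounded_linear.continuous_on[OF L]
  show cn: "continuous_on UNIV (\<lambda>y. norm (L y))" by (intro continuous_intros cL)
  then have [measurable]: "(\<lambda>y. norm (L y)) \<in> borel_measurable borel" by (rule borel_measurable_continuous_onI)
  have li: "locally_integrable (\<lambda>y. 1 / norm (L y))" by (rule coulomb_integral_cball(1)[OF P])
  then show "locally_integrable (\<lambda>y. 2 * c * (1 / norm (L y)))" by (rule locally_integrable_cmult)
  fix v :: "'a \<Rightarrow> real" assume v: "test_function v"
  obtain r where r: "continuous_on UNIV (laplacian v)"
    "\<And>x. x \<notin> cball 0 r \<Longrightarrow> laplacian v x = 0" "\<And>x. x \<notin> cball 0 r \<Longrightarrow> v x = 0"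
    using test_function_laplacian[OF v] by blast
  have [measurable]: "v \<in> borel_measurable borel" "laplacian v \<in> borel_measurable borel"
    using test_function_cont[OF v] r(1) by (auto intro: borel_measurable_continuous_onI)
  let ?e = "\<lambda>k::nat. 1 / real (Suc k)"
  let ?S = "\<lambda>k. soft_norm L (?e k)"
  have [measurable]: "?S k \<in> borel_measurable borel" for k
    by (rule borel_measurable_continuous_onI[OF continuous_on_soft_norm[OF L]])
  have pS: "?S k y > 0" for k y by (rule soft_norm_pos) simp
  have "(\<lambda>k. LINT y|lborel. ?S k y * laplacian v y) \<longlonglongrightarrow> (LINT y|lborel. norm (L y) * laplacian v y)"
  proof (rule integral_dominated_convergence)
    show "integrable lborel (\<lambda>y. (norm (L y) + 1) * \<bar>laplacian v y\<bar>)"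
      using r by (intro integrable_locally_integrable_mult[where a=0 and r=r] locally_integrable_continuous continuous_intros cL) auto
    show "AE y in lborel. (\<lambda>k. ?S k y * laplacian v y) \<longlonglongrightarrow> norm (L y) * laplacian v y"
      by (intro AE_I2 tendsto_intros soft_norm_tendsto)
    show "AE y in lborel. norm (?S k y * laplacian v y) \<le> (norm (L y) + 1) * \<bar>laplacian v y\<bar>" for k
    proof (rule AE_I2)
      fix y
      have "?S k y \<le> norm (L y) + ?e k"
        unfolding soft_norm_def by (rule order_trans[OF sqrt_add_le_add_sqrt]) auto
      also have "\<dots> \<le> norm (L y) + 1" by simp
      finally have "\<bar>?S k y\<bar> \<le> norm (L y) + 1" using pS[of k y] by simp
      then show "norm (?S k y * laplacian v y) \<le> (norm (L y) + 1) * \<bar>laplacian v y\<bar>"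
        by (simp add: abs_mult mult_right_mono)
    qed
  qed measurable
  moreover have "(\<lambda>k. LINT y|lborel. v y * (c * (2 * (norm (L y))\<^sup>2 + 3 * (?e k)\<^sup>2) / ?S k y ^ 3))
      \<longlonglongrightarrow> (LINT y|lborel. 2 * c * (1 / norm (L y)) * v y)"
  proof (rule integral_dominated_convergence)
    show "integrable lborel (\<lambda>y. (3 * c) * ((1 / norm (L y)) * \<bar>v y\<bar>))"
      using r test_function_cont[OF v] li
      by (intro integrable_mult_right integrable_locally_integrable_mult[where a=0 and r=r] continuous_intros) auto
    show "AE y in lborel. (\<lambda>k. v y * (c * (2 * (norm (L y))\<^sup>2 + 3 * (?e k)\<^sup>2) / ?S k y ^ 3))
        \<longlonglongrightarrow> 2 * c * (1 / norm (L y)) * v y"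
      using similar_projection_AE_nonzero[OF P]
    proof eventually_elim
      case (elim y)
      have "(\<lambda>k. v y * (c * (2 * (norm (L y))\<^sup>2 + 3 * (?e k)\<^sup>2) / ?S k y ^ 3))
        \<longlonglongrightarrow> v y * (c * (2 * (norm (L y))\<^sup>2 + 3 * 0\<^sup>2) / norm (L y) ^ 3)"
        by (intro tendsto_intros soft_norm_tendsto) (use LIMSEQ_inverse_real_of_nat elim in \<open>auto simp: inverse_eq_divide\<close>)
      then show ?case using elim by (simp add: power3_eq_cube power2_eq_square mult_ac)
    qed
    show "AE y in lborel. norm (v y * (c * (2 * (norm (L y))\<^sup>2 + 3 * (?e k)\<^sup>2) / ?S k y ^ 3))
        \<le> (3 * c) * ((1 / norm (L y)) * \<bar>v y\<bar>)" for k
      using similar_projection_AE_nonzero[OF P]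
    proof eventually_elim
      case (elim y)
      have S2: "(?S k y)\<^sup>2 = (norm (L y))\<^sup>2 + (?e k)\<^sup>2" by (simp add: soft_norm_def)
      have "c * (2 * (norm (L y))\<^sup>2 + 3 * (?e k)\<^sup>2) / ?S k y ^ 3 \<le> c * (3 * (?S k y)\<^sup>2) / ?S k y ^ 3"
        using pS[of k y] c unfolding S2 by (intro divide_right_mono mult_left_mono) auto
      also have "\<dots> = 3 * c / ?S k y" using pS[of k y] by (simp add: power3_eq_cube power2_eq_square)
      also have "\<dots> \<le> 3 * c / norm (L y)"
        using soft_norm_ge[of L y "?e k"] pS[of k y] c elim by (intro divide_left_mono mult_pos_pos) auto
      finally have 1: "c * (2 * (norm (L y))\<^sup>2 + 3 * (?e k)\<^sup>2) / ?S k y ^ 3 \<le> 3 * c / norm (L y)" .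
      have 2: "0 \<le> c * (2 * (norm (L y))\<^sup>2 + 3 * (?e k)\<^sup>2) / ?S k y ^ 3"
        using pS[of k y] c by (intro divide_nonneg_pos mult_nonneg_nonneg) auto
      from mult_left_mono[OF 1, of "\<bar>v y\<bar>"] show ?case
        by (simp only: real_norm_def abs_mult[of "v y"] abs_of_nonneg[OF 2]) (simp add: mult_ac)
    qed
  qed measurable
  moreover have "(LINT y|lborel. ?S k y * laplacian v y)
      = (LINT y|lborel. v y * (c * (2 * (norm (L y))\<^sup>2 + 3 * (?e k)\<^sup>2) / ?S k y ^ 3))" for k
    by (rule soft_norm_green[OF P _ v]) simp
  ultimately show "(LINT y|lborel. norm (L y) * laplacian v y) = (LINT y|lborel. 2 * c * (1 / norm (L y)) * v y)"
    using LIMSEQ_unique by simp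
qed

section \<open>Differentiability by approximation\<close>

lemma derivative_le_local_lipschitz:
  fixes \<phi> :: "'a::euclidean_space \<Rightarrow> real"
  assumes A: "(\<phi> has_derivative A) (at x)" and d: "d > 0"
    and l: "\<And>z. norm (z - x) < d \<Longrightarrow> \<bar>\<phi> z - \<phi> x\<bar> \<le> l * norm (z - x)"
  shows "\<bar>A h\<bar> \<le> l * norm h"
proof (cases "h = 0")
  case True
  then show ?thesis using linear_0[OF has_derivative_linear[OF A]] by simp
next
  case False
  have "((\<lambda>t. \<phi> (x + t *\<^sub>R h)) has_derivative (\<lambda>s. A (s *\<^sub>R h))) (at 0)"
    using A by (intro has_derivative_compose[where g=\<phi> and f="\<lambda>t. x + t *\<^sub>R h"]) (auto intro!: derivative_eq_intros)
  then have "((\<lambda>t. \<phi> (x + t *\<^sub>R h)) has_real_derivative A h) (at 0)"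
    unfolding has_field_derivative_def
    by (simp add: linear_scale[OF has_derivative_linear[OF A]] mult.commute[of _ "A h"] mult_commute_abs)
  then have "((\<lambda>t. (\<phi> (x + t *\<^sub>R h) - \<phi> x) / t) \<longlongrightarrow> A h) (at 0)"
    by (simp add: has_field_derivative_iff)
  then have lim: "((\<lambda>t. \<bar>(\<phi> (x + t *\<^sub>R h) - \<phi> x) / t\<bar>) \<longlongrightarrow> \<bar>A h\<bar>) (at 0)" by (rule tendsto_rabs)
  have "\<bar>(\<phi> (x + t *\<^sub>R h) - \<phi> x) / t\<bar> \<le> l * norm h" if "t \<noteq> 0" "\<bar>t\<bar> < d / norm h" for t
  proof -
    have "\<bar>t\<bar> * norm h < d" using that False by (simp add: pos_less_divide_eq)
    then have "\<bar>\<phi> (x + t *\<^sub>R h) - \<phi> x\<bar> \<le> l * (\<bar>t\<bar> * norm h)" using l[of "x + t *\<^sub>R h"] by simp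
    then show ?thesis using that by (simp add: abs_divide pos_divide_le_eq mult_ac)
  qed
  then have "eventually (\<lambda>t. \<bar>(\<phi> (x + t *\<^sub>R h) - \<phi> x) / t\<bar> \<le> l * norm h) (at 0)"
    using d False by (auto simp: eventually_at dist_real_def intro!: exI[of _ "d / norm h"])
  from tendsto_upperbound[OF lim this] show ?thesis by simp
qed

text \<open>Two approximants with errors \<open>e\<close> and \<open>e'\<close> differ near
  \<open>x\<close> by a function with Lipschitz constant \<open>e + e'\<close> at \<open>x\<close>,
  so their derivatives are that close in operator norm. The derivatives form a Cauchy sequence, and
  its limit is the derivative of \<open>w\<close>.\<close>

lemma differentiable_approximation:
  fixes w :: "'a::euclidean_space \<Rightarrow> real"
  assumes "\<And>e. e > 0 \<Longrightarrow> \<exists>g d. g differentiable (at x) \<and> d > 0 \<and>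
    (\<forall>z. norm (z - x) < d \<longrightarrow> \<bar>(w z - w x) - (g z - g x)\<bar> \<le> e * norm (z - x))"
  shows "w differentiable (at x)"
proof -
  have "\<exists>(g::'a \<Rightarrow> real) A d. (g has_derivative blinfun_apply A) (at x) \<and> d > 0 \<and>
    (\<forall>z. norm (z - x) < d \<longrightarrow> \<bar>(w z - w x) - (g z - g x)\<bar> \<le> 1 / real (Suc k) * norm (z - x))" for k
  proof -
    have "1 / real (Suc k) > 0" by simp
    from assms[OF this] obtain g d where g: "g differentiable (at x)" "d > 0"
      "\<And>z. norm (z - x) < d \<Longrightarrow> \<bar>(w z - w x) - (g z - g x)\<bar> \<le> 1 / real (Suc k) * norm (z - x)" by blast
    obtain g' where g': "(g has_derivative g') (at x)" using g(1) by (auto simp: differentiable_def)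
    then have "g' = blinfun_apply (Blinfun g')"
      by (simp add: bounded_linear_Blinfun_apply has_derivative_bounded_linear)
    with g g' show ?thesis by metis
  qed
  then obtain g :: "nat \<Rightarrow> 'a \<Rightarrow> real" and A d where
    g: "\<And>k. (g k has_derivative blinfun_apply (A k)) (at x)" and d: "\<And>k. d k > (0::real)"
    and w: "\<And>k z. norm (z - x) < d k \<Longrightarrow> \<bar>(w z - w x) - (g k z - g k x)\<bar> \<le> 1 / real (Suc k) * norm (z - x)"
    by metis
  have AA: "norm (A j - A k) \<le> 1 / real (Suc j) + 1 / real (Suc k)" for j k
  proof (rule norm_blinfun_bound)
    fix h
    have "\<bar>blinfun_apply (A j) h - blinfun_apply (A k) h\<bar> \<le> (1 / real (Suc j) + 1 / real (Suc k)) * norm h"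
    proof (rule derivative_le_local_lipschitz)
      show "((\<lambda>z. g j z - g k z) has_derivative (\<lambda>h. blinfun_apply (A j) h - blinfun_apply (A k) h)) (at x)"
        by (intro has_derivative_diff g)
      show "min (d j) (d k) > 0" using d by simp
      fix z assume "norm (z - x) < min (d j) (d k)"
      then show "\<bar>g j z - g k z - (g j x - g k x)\<bar> \<le> (1 / real (Suc j) + 1 / real (Suc k)) * norm (z - x)"
        using w[of z j] w[of z k] unfolding distrib_right by linarith
    qed
    then show "norm (blinfun_apply (A j - A k) h) \<le> (1 / real (Suc j) + 1 / real (Suc k)) * norm h"
      by (simp add: blinfun.diff_left)
  qed simp
  have "Cauchy A"
  proof (rule metric_CauchyI)
    fix e :: real assume "e > 0"
    then obtain N where N: "1 / real (Suc N) < e / 2" using nat_approx_posE[of "e / 2"] by auto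
    have "dist (A j) (A k) < e" if "j \<ge> N" "k \<ge> N" for j k
    proof -
      have "1 / real (Suc j) \<le> 1 / real (Suc N)" "1 / real (Suc k) \<le> 1 / real (Suc N)"
        using that by (auto intro!: divide_left_mono)
      then show ?thesis using AA[of j k] N by (simp add: dist_norm)
    qed
    then show "\<exists>N. \<forall>j\<ge>N. \<forall>k\<ge>N. dist (A j) (A k) < e" by blast
  qed
  then obtain B where B: "A \<longlonglongrightarrow> B" using Cauchy_convergent convergent_def by blast
  have AB: "norm (A j - B) \<le> 1 / real (Suc j)" for j
  proof -
    have "(\<lambda>k. norm (A j - A k)) \<longlonglongrightarrow> norm (A j - B)" by (intro tendsto_intros B)
    moreover have "(\<lambda>k. 1 / real (Suc j) + 1 / real (Suc k)) \<longlonglongrightarrow> 1 / real (Suc j) + 0"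
      by (intro tendsto_intros) (use LIMSEQ_inverse_real_of_nat in \<open>simp add: inverse_eq_divide\<close>)
    ultimately have "norm (A j - B) \<le> 1 / real (Suc j) + 0"
      by (rule LIMSEQ_le) (use AA in blast)
    then show ?thesis by simp
  qed
  have "(w has_derivative blinfun_apply B) (at x)"
    unfolding has_derivative_at_alt
  proof (intro conjI allI impI)
    fix e :: real assume "e > 0"
    then obtain k where k: "1 / real (Suc k) < e / 3" using nat_approx_posE[of "e / 3"] by auto
    obtain d' where d': "d' > 0" "\<And>z. norm (z - x) < d' \<Longrightarrow>
        norm (g k z - g k x - blinfun_apply (A k) (z - x)) \<le> e / 3 * norm (z - x)"
      using g[of k, unfolded has_derivative_at_alt] \<open>e > 0\<close> by (metis divide_pos_pos zero_less_numeral)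
    have "norm (w z - w x - blinfun_apply B (z - x)) \<le> e * norm (z - x)" if z: "norm (z - x) < min d' (d k)" for z
    proof -
      have "\<bar>blinfun_apply (A k) (z - x) - blinfun_apply B (z - x)\<bar> \<le> norm (A k - B) * norm (z - x)"
        using norm_blinfun[of "A k - B" "z - x"] by (simp add: blinfun.diff_left)
      also have "\<dots> \<le> e / 3 * norm (z - x)" using AB[of k] k by (intro mult_right_mono) auto
      finally have 1: "\<bar>blinfun_apply (A k) (z - x) - blinfun_apply B (z - x)\<bar> \<le> e / 3 * norm (z - x)" .
      have "1 / real (Suc k) * norm (z - x) \<le> e / 3 * norm (z - x)" using k by (intro mult_right_mono) auto
      then have 2: "\<bar>(w z - w x) - (g k z - g k x)\<bar> \<le> e / 3 * norm (z - x)" using w[of z k] z by linarith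
      have 3: "\<bar>g k z - g k x - blinfun_apply (A k) (z - x)\<bar> \<le> e / 3 * norm (z - x)" using d'(2)[of z] z by simp
      show ?thesis using 1 2 3 unfolding real_norm_def by linarith
    qed
    then show "\<exists>d>0. \<forall>z. norm (z - x) < d \<longrightarrow> norm (w z - w x - blinfun_apply B (z - x)) \<le> e * norm (z - x)"
      using d[of k] d'(1) by (intro exI[of _ "min d' (d k)"]) auto
  qed (rule blinfun.bounded_linear_right)
  then show ?thesis by (auto simp: differentiable_def)
qed

lemma mean_differentiable:
  fixes x :: "'a::euclidean_space"
  assumes g: "continuous_on UNIV g" and t: "t > 0"
  shows "(\<lambda>z. mean g z t) differentiable (at x)"
proof -
  let ?n = "DIM('a)"
  let ?U = "ball x 1"
  obtain a where a: "cball x (t + 1) \<subseteq> cbox (- a) a"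
    using bounded_subset_cbox_symmetric[OF bounded_cball] by blast
  define F where "F z y = g y * (2 * radial 1 z t y / t ^ ?n)" for z y
  define F' where "F' z y = (g y * (2 * ((- 2 / t\<^sup>2) * radial 2 z t y) / t ^ ?n)) *\<^sub>R blinfun_inner_right (z - y)" for z y
  have eq: "mean g z t = integral (cbox (- a) a) (F z)" if "z \<in> ?U" for z
    unfolding mean_def F_def
  proof (rule integral_lborel_eq_integral_cbox)
    show "continuous_on UNIV (\<lambda>y. g y * (2 * radial 1 z t y / t ^ ?n))"
      using t by (intro continuous_intros g continuous_on_radial) auto
    fix y assume "y \<notin> cbox (- a) a"
    then have "y \<notin> cball x (t + 1)" using a by blast
    then have "y \<notin> cball z t" using that dist_triangle[of x y z] by simp
    then show "g y * (2 * radial 1 z t y / t ^ ?n) = 0" using radial_zero[OF t, of y z 1] by simp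
  qed
  \<comment> \<open>The kernel is symmetric in centre and argument, so its derivative in the centre
    is the one already computed in the argument.\<close>
  have swap: "radial i z t y = radial i y t z" for i z y by (simp add: radial_def norm_minus_commute)
  have "((\<lambda>z. integral (cbox (- a) a) (F z)) has_derivative integral (cbox (- a) a) (F' x)) (at x within ?U)"
  proof (rule leibniz_rule)
    fix z y assume "z \<in> ?U"
    have "((\<lambda>z. g y * (2 * radial 1 y t z / t ^ ?n)) has_derivative
        (\<lambda>h. g y * (2 * ((- 2 / t\<^sup>2) * (((z - y) \<bullet> h) * radial (Suc 1) y t z)) / t ^ ?n))) (at z within ?U)"
      using t by (auto intro!: derivative_eq_intros has_derivative_at_withinI[OF radial_has_derivative])
    then show "((\<lambda>z. F z y) has_derivative blinfun_apply (F' z y)) (at z within ?U)"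
      unfolding F_def F'_def swap[of _ _ y]
      by (rule has_derivative_eq_rhs) (auto simp: blinfun.bilinear_simps numeral_2_eq_2 inner_commute)
  next
    fix z assume "z \<in> ?U"
    show "F z integrable_on cbox (- a) a" unfolding F_def using t
      by (intro integrable_continuous continuous_intros continuous_on_radial continuous_on_subset[OF g]) auto
  next
    show "continuous_on (?U \<times> cbox (- a) a) (\<lambda>(z, y). F' z y)"
      unfolding F'_def radial_def case_prod_unfold using t
      by (intro continuous_intros continuous_on_compose2[OF g]
          bounded_linear.continuous_on[OF bounded_linear_blinfun_inner_right]) auto
  qed auto
  then have "((\<lambda>z. integral (cbox (- a) a) (F z)) has_derivative integral (cbox (- a) a) (F' x)) (at x)"
    by (simp add: at_within_open[of x ?U])
  then have "((\<lambda>z. mean g z t) has_derivative integral (cbox (- a) a) (F' x)) (at x)"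
    by (rule has_derivative_transform_within_open[of _ _ _ _ ?U]) (use eq in auto)
  then show ?thesis by (rule has_derivative_differentiable)
qed

section \<open>Regularity across Coulomb singularities\<close>

text \<open>The mean value inequality down to scale 0, where \<open>D\<close> is known only through
  its right-hand limit.\<close>

lemma derivative_limit_bound:
  fixes D :: "real \<Rightarrow> real"
  assumes t: "t > 0" and D: "\<And>s. 0 < s \<Longrightarrow> s \<le> t \<Longrightarrow> (D has_real_derivative D' s) (at s)"
    and b: "\<And>s. 0 < s \<Longrightarrow> s \<le> t \<Longrightarrow> \<bar>D' s\<bar> \<le> A" and lim: "(D \<longlongrightarrow> d) (at_right 0)"
  shows "\<bar>D t - d\<bar> \<le> A * t"
proof -
  have A: "0 \<le> A" using b[of t] t by linarith
  have "((\<lambda>s. \<bar>D t - D s\<bar>) \<longlongrightarrow> \<bar>D t - d\<bar>) (at_right 0)" by (intro tendsto_intros lim)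
  moreover have "\<bar>D t - D s\<bar> \<le> A * t" if "0 < s" "s < t" for s
  proof -
    have "\<bar>D t - D s\<bar> \<le> A * t - A * s"
      by (rule deriv_bound_diff[where D'=D' and G'="\<lambda>_. A"]) (use that D b in \<open>auto intro!: derivative_eq_intros\<close>)
    also have "\<dots> \<le> A * t" using A that by simp
    finally show ?thesis .
  qed
  then have "eventually (\<lambda>s. \<bar>D t - D s\<bar> \<le> A * t) (at_right 0)"
    unfolding eventually_at_right_field using t by blast
  ultimately show ?thesis by (rule tendsto_upperbound) simp
qed

text \<open>Both kernels live in \<open>cball x (2 * t)\<close> and differ by at most a multiple of
  \<open>norm (z - x) / t / t^n\<close>; the volume \<open>(2 t)^n\<close> of that ball cancels
  \<open>t^n\<close> and leaves \<open>2^n\<close>.\<close>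

lemma mean_lipschitz:
  fixes x z :: "'a::euclidean_space"
  assumes g: "continuous_on UNIV g" and t: "t > 0" and B: "\<And>y. y \<in> cball x (2 * t) \<Longrightarrow> \<bar>g y\<bar> \<le> B"
    and xz: "norm (z - x) \<le> t"
  shows "\<bar>mean g z t - mean g x t\<bar> \<le> (4 * bump_bound 2 * 2 ^ DIM('a) * unit_ball_vol DIM('a)) * B * (norm (z - x) / t)"
proof -
  let ?n = "DIM('a)"
  let ?k = "\<lambda>y. 2 * (radial 1 z t y - radial 1 x t y) / t ^ ?n"
  have i: "integrable lborel (\<lambda>y. g y * (2 * radial 1 z t y / t ^ ?n))"
    "integrable lborel (\<lambda>y. g y * (2 * radial 1 x t y / t ^ ?n))"
    using integrable_mean[OF g t] by blast+
  have "mean g z t - mean g x t = (LINT y|lborel. g y * (2 * radial 1 z t y / t ^ ?n) - g y * (2 * radial 1 x t y / t ^ ?n))"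
    unfolding mean_def by (rule Bochner_Integration.integral_diff[OF i, symmetric])
  also have "\<dots> = (LINT y|lborel. g y * ?k y)"
    by (simp add: algebra_simps diff_divide_distrib)
  also have "\<bar>\<dots>\<bar> \<le> (4 * bump_bound 2 * (norm (z - x) / t) / t ^ ?n) * (LINT y:cball x (2 * t)|lborel. B)"
  proof (rule integral_mult_bound)
    show "locally_integrable (\<lambda>y::'a. B)" by (intro locally_integrable_continuous continuous_intros)
    show "\<bar>?k y\<bar> \<le> 4 * bump_bound 2 * (norm (z - x) / t) / t ^ ?n" for y
    proof -
      have "\<bar>radial 1 z t y - radial 1 x t y\<bar> \<le> 2 * bump_bound 2 * norm (z - x) / t"
        using radial_lipschitz[OF t, of 1 z y x] by (simp only: Suc_1)
      then have "2 * \<bar>radial 1 z t y - radial 1 x t y\<bar> / t ^ ?n \<le> 2 * (2 * bump_bound 2 * norm (z - x) / t) / t ^ ?n"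
        using t by (intro divide_right_mono mult_left_mono) auto
      also have "2 * (2 * bump_bound 2 * norm (z - x) / t) / t ^ ?n = 4 * bump_bound 2 * (norm (z - x) / t) / t ^ ?n"
        by simp
      also have "2 * \<bar>radial 1 z t y - radial 1 x t y\<bar> / t ^ ?n = \<bar>?k y\<bar>"
        using t by (simp only: abs_divide abs_mult power_abs abs_numeral abs_of_pos)
      finally show ?thesis .
    qed
    show "?k y = 0" if "y \<notin> cball x (2 * t)" for y
    proof -
      have "y \<notin> cball x t" "y \<notin> cball z t"
        using that t xz dist_triangle[of x y z] by (auto simp: dist_norm norm_minus_commute)
      then show ?thesis by (simp add: radial_zero[OF t] del: mem_cball)
    qed
  qed (rule B)
  also have "\<dots> = (4 * bump_bound 2 * 2 ^ ?n * unit_ball_vol ?n) * B * (norm (z - x) / t)"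
    using t by (simp add: set_lebesgue_integral_def content_cball power_mult_distrib)
  finally show ?thesis .
qed

text \<open>The roles are: \<open>V\<close> is the singular potential, \<open>W\<close> a positive majorant whose averages over balls
  of radius \<open>t\<close> are \<open>O(1/t)\<close>, and \<open>F\<close> a Lipschitz function with \<open>\<Delta> F = V\<close> (the Jastrow exponent).\<close>

locale coulomb_regularity =
  fixes F V W :: "'a::euclidean_space \<Rightarrow> real" and K l :: real
  assumes lap_F: "weak_laplacian F V"
    and V_le: "\<And>y. \<bar>V y\<bar> \<le> W y"
    and W_loc: "locally_integrable W"
    and W_int: "\<And>x t. t > 0 \<Longrightarrow> (LINT y:cball x t|lborel. W y) \<le> K * (t ^ DIM('a) / t)"
    and K_pos: "K > 0"
    and F_lip: "\<And>x y. \<bar>F x - F y\<bar> \<le> l * norm (x - y)"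
    and l_nonneg: "l \<ge> 0"
begin

text \<open>Splits a majorant into its singular part \<open>p * W\<close> and its bounded part
  \<open>q\<close>. The factor \<open>r^n\<close> is set apart because it cancels the normalisation
  \<open>1 / s^n\<close> of the scale derivative.\<close>

lemma kernel_bound:
  assumes r: "r > 0" and p: "p \<ge> 0" and q: "q \<ge> 0"
    and f: "\<And>y. y \<in> cball x r \<Longrightarrow> \<bar>f y\<bar> \<le> p * W y + q"
    and k: "\<And>y. \<bar>k y\<bar> \<le> \<kappa>" "\<And>y. y \<notin> cball x r \<Longrightarrow> k y = 0"
  shows "\<bar>LINT y|lborel. f y * k y\<bar> \<le> \<kappa> * ((p * K / r + q * unit_ball_vol DIM('a)) * r ^ DIM('a))"
proof -
  have \<kappa>: "\<kappa> \<ge> 0" using k(1)[of x] by linarith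
  have lc: "locally_integrable (\<lambda>y::'a. q)" by (intro locally_integrable_continuous continuous_intros)
  have "\<bar>LINT y|lborel. f y * k y\<bar> \<le> \<kappa> * (LINT y:cball x r|lborel. p * W y + q)"
    by (rule integral_mult_bound[OF locally_integrable_add[OF locally_integrable_cmult[OF W_loc] lc]])
      (use f k in auto)
  also have "(LINT y:cball x r|lborel. p * W y + q) = (LINT y:cball x r|lborel. p * W y) + (LINT y:cball x r|lborel. q)"
    using lc locally_integrable_cmult[OF W_loc, of p] by (intro set_integral_add) (auto simp: locally_integrable_def)
  also have "(LINT y:cball x r|lborel. p * W y) = p * (LINT y:cball x r|lborel. W y)" by (rule set_integral_mult_right)
  also have "(LINT y:cball x r|lborel. q) = q * (unit_ball_vol DIM('a) * r ^ DIM('a))"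
    using r by (simp add: set_lebesgue_integral_def content_cball)
  also have "p * (LINT y:cball x r|lborel. W y) + q * (unit_ball_vol DIM('a) * r ^ DIM('a)) \<le> (p * K / r + q * unit_ball_vol DIM('a)) * r ^ DIM('a)"
    using mult_left_mono[OF W_int[OF r, of x] p] by (simp add: algebra_simps)
  finally show ?thesis using \<kappa> by (simp add: mult_left_mono)
qed

text \<open>The weight \<open>s\<close> in the scale derivative cancels the \<open>1 / s\<close> of
  the averaged potential, so that derivative is bounded all the way to scale 0.\<close>

lemma mean_approx:
  assumes \<psi>: "continuous_on UNIV \<psi>" "weak_laplacian \<psi> (\<lambda>x. (V x - E) * \<psi> x)"
    and t: "0 < t" "t \<le> t0" and M: "\<And>y. y \<in> cball x t0 \<Longrightarrow> \<bar>\<psi> y\<bar> \<le> M"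
  shows "\<bar>mean \<psi> x t - mean_mass TYPE('a) * \<psi> x\<bar> \<le> bump_bound 0 * M * (K + \<bar>E\<bar> * unit_ball_vol DIM('a) * t0) * t"
proof (rule derivative_limit_bound[OF t(1)])
  show "(mean \<psi> x \<longlongrightarrow> mean_mass TYPE('a) * \<psi> x) (at_right 0)" by (rule mean_tendsto[OF \<psi>(1)])
  fix s :: real assume s: "0 < s" "s \<le> t"
  show "(mean \<psi> x has_real_derivative s / s ^ DIM('a) * (LINT y|lborel. (V y - E) * \<psi> y * radial 0 x s y)) (at s)"
    by (rule mean_deriv[OF \<psi>(2) s(1)])
  have M0: "M \<ge> 0" using M[of x] t by auto
  have "\<bar>LINT y|lborel. (V y - E) * \<psi> y * radial 0 x s y\<bar> \<le> bump_bound 0 * ((M * K / s + \<bar>E\<bar> * M * unit_ball_vol DIM('a)) * s ^ DIM('a))"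
  proof (rule kernel_bound)
    fix y assume "y \<in> cball x s"
    then have "\<bar>\<psi> y\<bar> \<le> M" using M[of y] s t by simp
    moreover have "\<bar>V y - E\<bar> \<le> W y + \<bar>E\<bar>" using V_le[of y] by linarith
    ultimately have "\<bar>V y - E\<bar> * \<bar>\<psi> y\<bar> \<le> (W y + \<bar>E\<bar>) * M" by (intro mult_mono) auto
    then show "\<bar>(V y - E) * \<psi> y\<bar> \<le> M * W y + \<bar>E\<bar> * M" by (simp only: abs_mult distrib_right mult.commute[of M])
  qed (use s M0 radial_bound radial_zero in auto)
  then have "s / s ^ DIM('a) * \<bar>LINT y|lborel. (V y - E) * \<psi> y * radial 0 x s y\<bar>
      \<le> s / s ^ DIM('a) * (bump_bound 0 * ((M * K / s + \<bar>E\<bar> * M * unit_ball_vol DIM('a)) * s ^ DIM('a)))"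
    using s by (intro mult_left_mono) auto
  also have "\<dots> = bump_bound 0 * M * (K + \<bar>E\<bar> * unit_ball_vol DIM('a) * s)" using s by (simp add: field_simps)
  also have "\<dots> \<le> bump_bound 0 * M * (K + \<bar>E\<bar> * unit_ball_vol DIM('a) * t0)"
    using s t M0 bump_bound_pos[of 0] unit_ball_vol_nonneg[of "DIM('a)"] by (intro mult_left_mono add_left_mono) auto
  finally show "\<bar>s / s ^ DIM('a) * (LINT y|lborel. (V y - E) * \<psi> y * radial 0 x s y)\<bar>
      \<le> bump_bound 0 * M * (K + \<bar>E\<bar> * unit_ball_vol DIM('a) * t0)"
    using s by (simp add: abs_mult abs_divide)
qed

lemma hoelder:
  assumes t0: "t0 > 0"
  obtains H where "H > 0" "\<And>\<psi> x z M. continuous_on UNIV \<psi> \<Longrightarrow> weak_laplacian \<psi> (\<lambda>x. (V x - E) * \<psi> x) \<Longrightarrow>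
    (\<And>y. y \<in> cball x (2 * t0) \<Longrightarrow> \<bar>\<psi> y\<bar> \<le> M) \<Longrightarrow> norm (z - x) \<le> t0 \<Longrightarrow>
    \<bar>\<psi> z - \<psi> x\<bar> \<le> H * M * sqrt (norm (z - x))"
proof -
  let ?m = "mean_mass TYPE('a)"
  have m: "?m > 0" by (rule mean_mass_pos)
  define A where "A = bump_bound 0 * (K + \<bar>E\<bar> * unit_ball_vol DIM('a) * t0)"
  define B where "B = 4 * bump_bound 2 * 2 ^ DIM('a) * unit_ball_vol DIM('a)"
  have A: "A > 0" unfolding A_def using K_pos t0 bump_bound_pos[of 0]
    by (intro mult_pos_pos add_pos_nonneg mult_nonneg_nonneg) auto
  have B: "B > 0" unfolding B_def using bump_bound_pos[of 2] by simp
  define H where "H = (2 * A * sqrt t0 + B / sqrt t0) / ?m"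
  have "\<bar>\<psi> z - \<psi> x\<bar> \<le> H * M * sqrt (norm (z - x))"
    if \<psi>: "continuous_on UNIV \<psi>" "weak_laplacian \<psi> (\<lambda>x. (V x - E) * \<psi> x)"
      and M: "\<And>y. y \<in> cball x (2 * t0) \<Longrightarrow> \<bar>\<psi> y\<bar> \<le> M" and xz: "norm (z - x) \<le> t0" for \<psi> x z M
  proof (cases "z = x")
    case False
    define \<delta> where "\<delta> = norm (z - x)"
    have \<delta>: "0 < \<delta>" "\<delta> \<le> t0" using False xz by (auto simp: \<delta>_def)
    \<comment> \<open>This scale balances the approximation errors, of order \<open>M t\<close>,
      against the change of centre, of order \<open>M \<delta> / t\<close>. The factor
      \<open>sqrt t0\<close> yields \<open>\<delta> \<le> t \<le> t0\<close>, as both estimates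
      demand.\<close>
    define t where "t = sqrt t0 * sqrt \<delta>"
    have t: "0 < t" "t \<le> t0" "\<delta> \<le> t"
    proof -
      show "0 < t" using \<delta> t0 by (simp add: t_def)
      have "sqrt \<delta> \<le> sqrt t0" using \<delta> by simp
      then show "t \<le> t0" "\<delta> \<le> t" using t0 \<delta> mult_left_mono[of "sqrt \<delta>" "sqrt t0" "sqrt t0"]
          mult_right_mono[of "sqrt \<delta>" "sqrt t0" "sqrt \<delta>"] by (auto simp: t_def)
    qed
    have Mx: "\<bar>\<psi> y\<bar> \<le> M" if "y \<in> cball x t0" for y using M[of y] that t0 by simp
    have Mz: "\<bar>\<psi> y\<bar> \<le> M" if "y \<in> cball z t0" for y
      using M[of y] that xz dist_triangle[of x y z] by (auto simp: dist_norm norm_minus_commute)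
    have "\<bar>mean \<psi> x t - ?m * \<psi> x\<bar> \<le> A * M * t"
      using mean_approx[OF \<psi> t(1,2) Mx] by (simp add: A_def mult_ac)
    moreover have "\<bar>mean \<psi> z t - ?m * \<psi> z\<bar> \<le> A * M * t"
      using mean_approx[OF \<psi> t(1,2) Mz] by (simp add: A_def mult_ac)
    moreover have "\<bar>mean \<psi> z t - mean \<psi> x t\<bar> \<le> B * M * (\<delta> / t)"
      unfolding B_def \<delta>_def by (rule mean_lipschitz[OF \<psi>(1) t(1)]) (use M t \<delta> in \<open>auto simp: \<delta>_def\<close>)
    ultimately have "\<bar>?m * \<psi> z - ?m * \<psi> x\<bar> \<le> 2 * (A * M * t) + B * M * (\<delta> / t)" by linarith
    also have "\<delta> / t = sqrt \<delta> / sqrt t0"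
      using \<delta> t0 by (simp add: t_def field_simps flip: power2_eq_square)
    also have "2 * (A * M * t) + B * M * (sqrt \<delta> / sqrt t0) = ?m * (H * M * sqrt \<delta>)"
      using m t0 by (simp add: H_def t_def field_simps)
    finally have "?m * \<bar>\<psi> z - \<psi> x\<bar> \<le> ?m * (H * M * sqrt \<delta>)"
      using m by (simp add: abs_mult flip: right_diff_distrib)
    then show ?thesis using m by (simp add: \<delta>_def)
  qed simp
  moreover have "H > 0" unfolding H_def using A B t0 m by (intro divide_pos_pos add_pos_pos mult_pos_pos) auto
  ultimately show thesis using that by blast
qed

text \<open>Subtracting \<open>\<psi> x * (F - F x)\<close> replaces \<open>V * \<psi>\<close> by \<open>V * (\<psi> - \<psi> x)\<close>, which the Hoelder bound makes
  integrable against the gradient of the fundamental solution with pole at \<open>x\<close>.\<close>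

definition corrected :: "('a \<Rightarrow> real) \<Rightarrow> 'a \<Rightarrow> 'a \<Rightarrow> real" where
  "corrected \<psi> x y = \<psi> y - \<psi> x * (F y - F x)"

lemma continuous_corrected: "continuous_on UNIV \<psi> \<Longrightarrow> continuous_on UNIV (corrected \<psi> x)"
  using lap_F unfolding corrected_def[abs_def] weak_laplacian_def by (auto intro!: continuous_intros)

lemma weak_laplacian_corrected:
  assumes "weak_laplacian \<psi> (\<lambda>x. (V x - E) * \<psi> x)"
  shows "weak_laplacian (corrected \<psi> x) (\<lambda>y. V y * (\<psi> y - \<psi> x) - E * \<psi> y)"
proof -
  have "weak_laplacian (\<lambda>y. \<psi> y + ((- \<psi> x) * F y + \<psi> x * F x)) (\<lambda>y. (V y - E) * \<psi> y + ((- \<psi> x) * V y + 0))"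
    by (intro weak_laplacian_add weak_laplacian_cmult weak_laplacian_const assms lap_F)
  then show ?thesis by (simp add: corrected_def[abs_def] algebra_simps)
qed

text \<open>The scales are split at \<delta> = \<open>norm (z - x)\<close>. Below \<delta> the
  averages at \<open>x\<close> and \<open>z\<close> are estimated separately and the length of the
  scale interval supplies the factor \<delta>. Above \<delta> the Lipschitz dependence of the kernel
  on its centre supplies it, and the remaining \<open>s^(-1/2)\<close> is integrable.\<close>

lemma corrected_approx:
  assumes t0: "t0 > 0"
  obtains C where "C > 0" "\<And>\<psi> x z M T. continuous_on UNIV \<psi> \<Longrightarrow> weak_laplacian \<psi> (\<lambda>x. (V x - E) * \<psi> x) \<Longrightarrow>
    (\<And>y. y \<in> cball x (4 * t0) \<Longrightarrow> \<bar>\<psi> y\<bar> \<le> M) \<Longrightarrow> 0 < T \<Longrightarrow> T \<le> t0 \<Longrightarrow> norm (z - x) \<le> T \<Longrightarrow>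
    \<bar>mean (corrected \<psi> x) z T - mean (corrected \<psi> x) x T - mean_mass TYPE('a) * (corrected \<psi> x z - corrected \<psi> x x)\<bar>
      \<le> C * M * sqrt T * norm (z - x)"
proof -
  let ?m = "mean_mass TYPE('a)" and ?n = "DIM('a)"
  \<comment> \<open>Balls around \<open>z\<close> reach distance \<open>2 * t0\<close> from
    \<open>x\<close>, so the Hoelder bound is needed up to there; its own doubling explains the
    radius \<open>4 * t0\<close> in the hypothesis on \<open>M\<close>.\<close>
  have "2 * t0 > 0" using t0 by simp
  then obtain H where H: "H > 0" and holder: "\<And>\<psi> x z M. continuous_on UNIV \<psi> \<Longrightarrow> weak_laplacian \<psi> (\<lambda>x. (V x - E) * \<psi> x) \<Longrightarrow>
    (\<And>y. y \<in> cball x (2 * (2 * t0)) \<Longrightarrow> \<bar>\<psi> y\<bar> \<le> M) \<Longrightarrow> norm (z - x) \<le> 2 * t0 \<Longrightarrow>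
    \<bar>\<psi> z - \<psi> x\<bar> \<le> H * M * sqrt (norm (z - x))"
    by (rule hoelder[of "2 * t0" E]) blast
  let ?b0 = "bump_bound 0" and ?b1 = "bump_bound 1"
  note b0 = bump_bound_pos[of 0] and b1 = bump_bound_pos[of 1]
  \<comment> \<open>\<open>A1\<close> covers the scales below \<delta>: 2 counts the centres,
    \<open>sqrt 2\<close> comes from the ball of radius \<open>2 * \<delta>\<close>.
    \<open>A2\<close> and \<open>A3\<close> cover the singular and the energy part above \<delta>,
    with \<open>2^n\<close> from the ball of radius \<open>2 * s\<close>.\<close>
  define A1 where "A1 = 2 * ?b0 * (sqrt 2 * H * K + \<bar>E\<bar> * unit_ball_vol DIM('a) * sqrt t0)"
  define A2 where "A2 = 2 * ?b1 * 2 ^ ?n * H * K"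
  define A3 where "A3 = 2 * ?b1 * 2 ^ ?n * \<bar>E\<bar> * unit_ball_vol DIM('a)"
  have ball_vol: "unit_ball_vol DIM('a) > 0" by simp
  have A1: "A1 > 0" unfolding A1_def using b0 H K_pos t0 ball_vol
    by (intro mult_pos_pos add_pos_nonneg mult_nonneg_nonneg) auto
  have A2: "A2 > 0" unfolding A2_def using b1 H K_pos by simp
  have A3: "A3 \<ge> 0" unfolding A3_def using b1 ball_vol by simp
  define C where "C = A1 + 2 * A2 + A3 * sqrt t0"
  have "\<bar>mean (corrected \<psi> x) z T - mean (corrected \<psi> x) x T - ?m * (corrected \<psi> x z - corrected \<psi> x x)\<bar>
      \<le> C * M * sqrt T * norm (z - x)"
    if \<psi>: "continuous_on UNIV \<psi>" "weak_laplacian \<psi> (\<lambda>x. (V x - E) * \<psi> x)"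
      and M: "\<And>y. y \<in> cball x (4 * t0) \<Longrightarrow> \<bar>\<psi> y\<bar> \<le> M" and T: "0 < T" "T \<le> t0" and xz: "norm (z - x) \<le> T"
    for \<psi> x z M T
  proof (cases "z = x")
    case False
    define \<delta> where "\<delta> = norm (z - x)"
    have \<delta>: "0 < \<delta>" "\<delta> \<le> T" using False xz by (auto simp: \<delta>_def)
    have M0: "M \<ge> 0" using M[of x] t0 by auto
    \<comment> \<open>Turns terms linear in \<open>T\<close> into multiples of
      \<open>sqrt T\<close>, the common form of the final bound.\<close>
    have sT: "T \<le> sqrt t0 * sqrt T"
    proof -
      have "sqrt T * sqrt T \<le> sqrt t0 * sqrt T" using T by (intro mult_right_mono) auto
      then show ?thesis using T by simp
    qed
    let ?w = "corrected \<psi> x"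
    let ?f = "\<lambda>y. V y * (\<psi> y - \<psi> x) - E * \<psi> y"
    have wl: "weak_laplacian ?w ?f" by (rule weak_laplacian_corrected[OF \<psi>(2)])
    have wc: "continuous_on UNIV ?w" by (rule continuous_corrected[OF \<psi>(1)])
    have f: "\<bar>?f y\<bar> \<le> (H * M * sqrt r) * W y + \<bar>E\<bar> * M" if y: "y \<in> cball x r" and r: "r \<le> 2 * t0" for y r
    proof -
      have yr: "norm (y - x) \<le> r" using y by (simp add: dist_norm norm_minus_commute)
      have "\<bar>\<psi> y - \<psi> x\<bar> \<le> H * M * sqrt (norm (y - x))"
        by (rule holder[OF \<psi>]) (use M yr r in auto)
      also have "\<dots> \<le> H * M * sqrt r" using yr H M0 by (intro mult_left_mono) auto
      finally have "\<bar>V y\<bar> * \<bar>\<psi> y - \<psi> x\<bar> \<le> W y * (H * M * sqrt r)"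
        using V_le[of y] by (intro mult_mono) auto
      moreover have "\<bar>E\<bar> * \<bar>\<psi> y\<bar> \<le> \<bar>E\<bar> * M" using M[of y] y r t0 by (intro mult_left_mono) auto
      ultimately show ?thesis
        using abs_triangle_ineq4[of "V y * (\<psi> y - \<psi> x)" "E * \<psi> y"] by (simp add: abs_mult mult_ac)
    qed
    define D where "D s = mean ?w z s - mean ?w x s" for s
    define I where "I u s = (LINT y|lborel. ?f y * radial 0 u s y)" for u s
    have D: "(D has_real_derivative s / s ^ ?n * (I z s - I x s)) (at s)" if "s > 0" for s
      unfolding D_def[abs_def] I_def
      using DERIV_diff[OF mean_deriv[OF wl that, of z] mean_deriv[OF wl that, of x]] by (simp add: right_diff_distrib)
    have Dlim: "(D \<longlongrightarrow> ?m * (?w z - ?w x)) (at_right 0)"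
      unfolding D_def[abs_def] right_diff_distrib by (intro tendsto_diff mean_tendsto wc)
    \<comment> \<open>Small scales: for both centres the balls of radius
      \<open>s \<le> \<delta>\<close> stay in \<open>cball x (2 * \<delta>)\<close>, where the
      Hoelder factor is at most of order \<open>sqrt T\<close>.\<close>
    have "\<bar>D \<delta> - ?m * (?w z - ?w x)\<bar> \<le> (A1 * M * sqrt T) * \<delta>"
    proof (rule derivative_limit_bound[OF \<delta>(1) D _ Dlim])
      fix s :: real assume s: "0 < s" "s \<le> \<delta>"
      have I: "\<bar>I u s\<bar> \<le> ?b0 * (((H * M * sqrt (2 * \<delta>)) * K / s + \<bar>E\<bar> * M * unit_ball_vol DIM('a)) * s ^ ?n)" if u: "norm (u - x) \<le> \<delta>" for u
        unfolding I_def
      proof (rule kernel_bound)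
        fix y assume "y \<in> cball u s"
        then have "y \<in> cball x (2 * \<delta>)" using u s dist_triangle[of x y u] by (auto simp: dist_norm norm_minus_commute)
        then show "\<bar>?f y\<bar> \<le> (H * M * sqrt (2 * \<delta>)) * W y + \<bar>E\<bar> * M" using \<delta> T by (intro f) auto
      qed (use s \<delta> H M0 radial_bound radial_zero in auto)
      have "\<bar>I z s - I x s\<bar> \<le> 2 * (?b0 * (((H * M * sqrt (2 * \<delta>)) * K / s + \<bar>E\<bar> * M * unit_ball_vol DIM('a)) * s ^ ?n))"
        using I[of z] I[of x] \<delta> by (simp add: \<delta>_def)
      then have "s / s ^ ?n * \<bar>I z s - I x s\<bar>
          \<le> s / s ^ ?n * (2 * (?b0 * (((H * M * sqrt (2 * \<delta>)) * K / s + \<bar>E\<bar> * M * unit_ball_vol DIM('a)) * s ^ ?n)))"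
        using s by (intro mult_left_mono) auto
      also have "\<dots> = 2 * ?b0 * M * (H * K * sqrt (2 * \<delta>) + \<bar>E\<bar> * unit_ball_vol DIM('a) * s)" using s by (simp add: field_simps)
      also have "\<dots> \<le> 2 * ?b0 * M * (H * K * (sqrt 2 * sqrt T) + \<bar>E\<bar> * unit_ball_vol DIM('a) * (sqrt t0 * sqrt T))"
      proof -
        have "sqrt (2 * \<delta>) \<le> sqrt 2 * sqrt T" using \<delta> by (simp add: real_sqrt_mult)
        moreover have "s \<le> sqrt t0 * sqrt T" using s \<delta> sT by linarith
        ultimately show ?thesis using b0 M0 H K_pos ball_vol by (intro mult_left_mono add_mono) auto
      qed
      also have "\<dots> = A1 * M * sqrt T" by (simp add: A1_def algebra_simps)
      finally show "\<bar>s / s ^ ?n * (I z s - I x s)\<bar> \<le> A1 * M * sqrt T" using s by (simp add: abs_mult abs_divide)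
    qed
    \<comment> \<open>Large scales: the right side is the increment of an explicit primitive of
      \<open>\<delta> * M * (A2 / sqrt s + A3)\<close>, which bounds the scale derivative. Both
      kernels now lie in \<open>cball x (2 * s)\<close> because
      \<open>\<delta> \<le> s\<close>.\<close>
    moreover have "\<bar>D T - D \<delta>\<bar> \<le> \<delta> * M * (2 * A2 * sqrt T + A3 * T) - \<delta> * M * (2 * A2 * sqrt \<delta> + A3 * \<delta>)"
    proof (rule deriv_bound_diff[OF \<delta>(2) D])
      fix s assume s: "\<delta> \<le> s" "s \<le> T"
      then have s0: "s > 0" using \<delta> by linarith
      then show "s > 0" .
      show "((\<lambda>s. \<delta> * M * (2 * A2 * sqrt s + A3 * s)) has_real_derivative \<delta> * M * (A2 / sqrt s + A3)) (at s)"
        using s0 by (auto intro!: derivative_eq_intros simp: field_simps)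
      have int: "integrable lborel (\<lambda>y. ?f y * radial 0 u s y)" for u
        using wl radial_zero[OF s0] by (intro integrable_locally_integrable_mult[where a=u and r=s] continuous_on_radial)
          (auto simp: weak_laplacian_def)
      have "I z s - I x s = (LINT y|lborel. ?f y * (radial 0 z s y - radial 0 x s y))"
        unfolding I_def by (subst Bochner_Integration.integral_diff[symmetric, OF int int]) (simp only: right_diff_distrib)
      also have "\<bar>\<dots>\<bar> \<le> (2 * ?b1 * \<delta> / s) * (((H * M * sqrt (2 * s)) * K / (2 * s) + \<bar>E\<bar> * M * unit_ball_vol DIM('a)) * (2 * s) ^ ?n)"
      proof (rule kernel_bound)
        show "\<bar>?f y\<bar> \<le> (H * M * sqrt (2 * s)) * W y + \<bar>E\<bar> * M" if "y \<in> cball x (2 * s)" for y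
          using that s T by (intro f) auto
        show "\<bar>radial 0 z s y - radial 0 x s y\<bar> \<le> 2 * ?b1 * \<delta> / s" for y
          using radial_lipschitz[OF s0, of 0 z y x] by (simp add: \<delta>_def)
        show "radial 0 z s y - radial 0 x s y = 0" if "y \<notin> cball x (2 * s)" for y
        proof -
          have "y \<notin> cball x s" "y \<notin> cball z s"
            using that s s0 dist_triangle[of x y z] by (auto simp: dist_norm norm_minus_commute \<delta>_def)
          then show ?thesis by (simp add: radial_zero[OF s0] del: mem_cball)
        qed
      qed (use s0 H M0 in auto)
      finally have "s / s ^ ?n * \<bar>I z s - I x s\<bar> \<le> s / s ^ ?n *
          ((2 * ?b1 * \<delta> / s) * (((H * M * sqrt (2 * s)) * K / (2 * s) + \<bar>E\<bar> * M * unit_ball_vol DIM('a)) * (2 * s) ^ ?n))"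
        using s0 by (intro mult_left_mono) auto
      also have "\<dots> = \<delta> * M * (A2 * (sqrt (2 * s) / (2 * s)) + A3)"
        using s0 by (simp add: A2_def A3_def power_mult_distrib algebra_simps)
      also have "\<dots> \<le> \<delta> * M * (A2 / sqrt s + A3)"
      proof -
        have "sqrt (2 * s) / (2 * s) = 1 / sqrt (2 * s)" using s0 by (simp add: real_div_sqrt field_simps)
        also have "\<dots> \<le> 1 / sqrt s" using s0 by (intro divide_left_mono) auto
        finally have "A2 * (sqrt (2 * s) / (2 * s)) \<le> A2 * (1 / sqrt s)" using A2 by (intro mult_left_mono) auto
        then show ?thesis using \<delta> M0 by (intro mult_left_mono) auto
      qed
      finally show "\<bar>s / s ^ ?n * (I z s - I x s)\<bar> \<le> \<delta> * M * (A2 / sqrt s + A3)"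
        using s0 by (simp add: abs_mult abs_divide)
    qed
    moreover have "0 \<le> \<delta> * M * (2 * A2 * sqrt \<delta> + A3 * \<delta>)" using \<delta> M0 A2 A3 by simp
    moreover have "\<delta> * M * (2 * A2 * sqrt T + A3 * T) \<le> \<delta> * M * (2 * A2 * sqrt T + A3 * (sqrt t0 * sqrt T))"
      using sT \<delta> M0 A3 by (intro mult_left_mono add_left_mono) auto
    moreover have "(A1 * M * sqrt T) * \<delta> + \<delta> * M * (2 * A2 * sqrt T + A3 * (sqrt t0 * sqrt T)) = C * M * sqrt T * \<delta>"
      by (simp add: C_def algebra_simps)
    ultimately have "\<bar>D T - ?m * (?w z - ?w x)\<bar> \<le> C * M * sqrt T * \<delta>" by linarith
    then show ?thesis by (simp add: D_def \<delta>_def)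
  qed simp
  moreover have "C > 0" unfolding C_def using A1 A2 A3 t0 by (intro add_pos_nonneg add_pos_pos) auto
  ultimately show thesis using that by blast
qed

lemma local_lipschitz:
  assumes t0: "t0 > 0"
  obtains C where "C > 0" "\<And>\<psi> x z M. continuous_on UNIV \<psi> \<Longrightarrow> weak_laplacian \<psi> (\<lambda>x. (V x - E) * \<psi> x) \<Longrightarrow>
    (\<And>y. y \<in> cball x (4 * t0) \<Longrightarrow> \<bar>\<psi> y\<bar> \<le> M) \<Longrightarrow> norm (z - x) \<le> t0 \<Longrightarrow>
    \<bar>\<psi> z - \<psi> x\<bar> \<le> C * M * norm (z - x)"
proof -
  let ?m = "mean_mass TYPE('a)"
  have m: "?m > 0" by (rule mean_mass_pos)
  obtain C where C: "C > 0" and approx: "\<And>\<psi> x z M T. continuous_on UNIV \<psi> \<Longrightarrow> weak_laplacian \<psi> (\<lambda>x. (V x - E) * \<psi> x) \<Longrightarrow>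
    (\<And>y. y \<in> cball x (4 * t0) \<Longrightarrow> \<bar>\<psi> y\<bar> \<le> M) \<Longrightarrow> 0 < T \<Longrightarrow> T \<le> t0 \<Longrightarrow> norm (z - x) \<le> T \<Longrightarrow>
    \<bar>mean (corrected \<psi> x) z T - mean (corrected \<psi> x) x T - mean_mass TYPE('a) * (corrected \<psi> x z - corrected \<psi> x x)\<bar>
      \<le> C * M * sqrt T * norm (z - x)"
    using corrected_approx[OF t0, of E] by blast
  define B where "B = 4 * bump_bound 2 * 2 ^ DIM('a) * unit_ball_vol DIM('a)"
  have B: "B > 0" unfolding B_def using bump_bound_pos[of 2] by simp
  \<comment> \<open>The quotient by \<open>?m\<close> bounds the increments of the corrected
    function, which is at most \<open>M * (1 + l * (2 * t0))\<close> on the ball of radius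
    \<open>2 * t0\<close>; the final \<open>l\<close> restores the subtracted multiple of
    \<open>F\<close>.\<close>
  define C' where "C' = (C * sqrt t0 + B * (1 + l * (2 * t0)) / t0) / ?m + l"
  have "\<bar>\<psi> z - \<psi> x\<bar> \<le> C' * M * norm (z - x)"
    if \<psi>: "continuous_on UNIV \<psi>" "weak_laplacian \<psi> (\<lambda>x. (V x - E) * \<psi> x)"
      and M: "\<And>y. y \<in> cball x (4 * t0) \<Longrightarrow> \<bar>\<psi> y\<bar> \<le> M" and xz: "norm (z - x) \<le> t0" for \<psi> x z M
  proof -
    let ?w = "corrected \<psi> x"
    have Mx: "\<bar>\<psi> x\<bar> \<le> M" using M[of x] t0 by auto
    have "\<bar>mean ?w z t0 - mean ?w x t0\<bar> \<le> B * (M * (1 + l * (2 * t0))) * (norm (z - x) / t0)"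
      unfolding B_def
    proof (rule mean_lipschitz[OF continuous_corrected[OF \<psi>(1)] t0 _ xz])
      fix y assume y: "y \<in> cball x (2 * t0)"
      have "\<bar>F y - F x\<bar> \<le> l * norm (y - x)" by (rule F_lip)
      also have "\<dots> \<le> l * (2 * t0)" using y l_nonneg by (intro mult_left_mono) (auto simp: dist_norm norm_minus_commute)
      finally have "\<bar>\<psi> x\<bar> * \<bar>F y - F x\<bar> \<le> M * (l * (2 * t0))" using Mx by (intro mult_mono) auto
      moreover have "\<bar>\<psi> y\<bar> \<le> M" using M[of y] y t0 by simp
      ultimately show "\<bar>?w y\<bar> \<le> M * (1 + l * (2 * t0))"
        using abs_triangle_ineq4[of "\<psi> y" "\<psi> x * (F y - F x)"] abs_mult[of "\<psi> x" "F y - F x"]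
        unfolding corrected_def distrib_left by linarith
    qed
    moreover have "\<bar>mean ?w z t0 - mean ?w x t0 - ?m * (?w z - ?w x)\<bar> \<le> C * M * sqrt t0 * norm (z - x)"
      by (rule approx[OF \<psi> M t0 order_refl xz])
    ultimately have "\<bar>?m * (?w z - ?w x)\<bar> \<le> C * M * sqrt t0 * norm (z - x) + B * (M * (1 + l * (2 * t0))) * (norm (z - x) / t0)"
      by linarith
    also have "\<dots> = (C * sqrt t0 + B * (1 + l * (2 * t0)) / t0) * (M * norm (z - x))"
      using t0 by (simp add: field_simps)
    finally have "\<bar>?w z - ?w x\<bar> \<le> (C * sqrt t0 + B * (1 + l * (2 * t0)) / t0) * (M * norm (z - x)) / ?m"
      using m by (subst pos_le_divide_eq) (auto simp: abs_mult mult.commute)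
    moreover have "\<bar>\<psi> x * (F z - F x)\<bar> \<le> M * (l * norm (z - x))"
      unfolding abs_mult using Mx F_lip[of z x] by (intro mult_mono) auto
    moreover have "\<psi> z - \<psi> x = (?w z - ?w x) + \<psi> x * (F z - F x)" by (simp add: corrected_def)
    ultimately have "\<bar>\<psi> z - \<psi> x\<bar> \<le> (C * sqrt t0 + B * (1 + l * (2 * t0)) / t0) * (M * norm (z - x)) / ?m + M * (l * norm (z - x))"
      by linarith
    also have "\<dots> = C' * M * norm (z - x)" by (simp add: C'_def algebra_simps)
    finally show ?thesis .
  qed
  moreover have "C' > 0" unfolding C'_def using C B t0 m l_nonneg
    by (intro add_pos_nonneg divide_pos_pos mult_pos_pos) (auto intro: add_pos_nonneg)
  ultimately show thesis using that by blast
qed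

lemma corrected_differentiable:
  assumes \<psi>: "continuous_on UNIV \<psi>" "weak_laplacian \<psi> (\<lambda>x. (V x - E) * \<psi> x)"
  shows "corrected \<psi> x differentiable (at x)"
proof (rule differentiable_approximation)
  let ?m = "mean_mass TYPE('a)" and ?w = "corrected \<psi> x"
  have m: "?m > 0" by (rule mean_mass_pos)
  obtain C where C: "C > 0" and approx: "\<And>\<psi> x z M T. continuous_on UNIV \<psi> \<Longrightarrow> weak_laplacian \<psi> (\<lambda>x. (V x - E) * \<psi> x) \<Longrightarrow>
    (\<And>y. y \<in> cball x (4 * 1) \<Longrightarrow> \<bar>\<psi> y\<bar> \<le> M) \<Longrightarrow> 0 < T \<Longrightarrow> T \<le> 1 \<Longrightarrow> norm (z - x) \<le> T \<Longrightarrow>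
    \<bar>mean (corrected \<psi> x) z T - mean (corrected \<psi> x) x T - mean_mass TYPE('a) * (corrected \<psi> x z - corrected \<psi> x x)\<bar>
      \<le> C * M * sqrt T * norm (z - x)"
    using corrected_approx[OF zero_less_one, of E] by blast
  have "compact (\<psi> ` cball x (4 * 1))"
    using \<psi>(1) by (intro compact_continuous_image) (auto intro: continuous_on_subset)
  then obtain M where M0: "M > 0" and M: "\<And>y. y \<in> cball x (4 * 1) \<Longrightarrow> \<bar>\<psi> y\<bar> \<le> M"
    using bounded_pos[of "\<psi> ` cball x (4 * 1)"] compact_imp_bounded by (auto simp del: mem_cball)
  fix e :: real assume e: "e > 0"
  \<comment> \<open>The second entry makes the error \<open>C * M * sqrt T\<close> at most
    \<open>e * ?m\<close>, hence at most \<open>e\<close> after division by the mass; the first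
    keeps \<open>T\<close> in the range of \<open>approx\<close>, used with
    \<open>t0 = 1\<close>.\<close>
  define T where "T = min 1 ((e * ?m / (C * M))\<^sup>2)"
  have T: "0 < T" "T \<le> 1" using e m C M0 by (auto simp: T_def)
  have "sqrt T \<le> sqrt ((e * ?m / (C * M))\<^sup>2)" unfolding T_def by (intro real_sqrt_le_mono) simp
  also have "\<dots> = e * ?m / (C * M)" using e m C M0 by simp
  finally have sT: "C * M * sqrt T \<le> e * ?m" using C M0 by (simp add: pos_le_divide_eq mult.commute)
  show "\<exists>g d. g differentiable at x \<and> 0 < d \<and>
      (\<forall>z. norm (z - x) < d \<longrightarrow> \<bar>(?w z - ?w x) - (g z - g x)\<bar> \<le> e * norm (z - x))"
  proof (intro exI[of _ "\<lambda>z. mean ?w z T / ?m"] exI[of _ T] conjI allI impI T(1))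
    show "(\<lambda>z. mean ?w z T / ?m) differentiable at x"
      using m by (intro differentiable_divide mean_differentiable continuous_corrected \<psi>(1) T(1) differentiable_const) auto
    fix z assume z: "norm (z - x) < T"
    have "\<bar>mean ?w z T - mean ?w x T - ?m * (?w z - ?w x)\<bar> \<le> C * M * sqrt T * norm (z - x)"
      by (rule approx[OF \<psi> M T]) (use z in auto)
    also have "\<dots> \<le> (e * ?m) * norm (z - x)" using sT by (intro mult_right_mono) auto
    finally have "\<bar>mean ?w z T - mean ?w x T - ?m * (?w z - ?w x)\<bar> / ?m \<le> e * norm (z - x)"
      using m by (simp add: pos_divide_le_eq mult_ac)
    moreover have "\<bar>mean ?w z T - mean ?w x T - ?m * (?w z - ?w x)\<bar> / ?m
        = \<bar>(?w z - ?w x) - (mean ?w z T / ?m - mean ?w x T / ?m)\<bar>"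
    proof -
      have "(?w z - ?w x) - (mean ?w z T / ?m - mean ?w x T / ?m) = - ((mean ?w z T - mean ?w x T - ?m * (?w z - ?w x)) / ?m)"
        using m by (simp add: field_simps)
      then show ?thesis using m by (simp only: abs_minus_cancel abs_divide abs_of_pos)
    qed
    ultimately show "\<bar>(?w z - ?w x) - (mean ?w z T / ?m - mean ?w x T / ?m)\<bar> \<le> e * norm (z - x)" by simp
  qed
qed

lemma solution_differentiable:
  assumes \<psi>: "continuous_on UNIV \<psi>" "weak_laplacian \<psi> (\<lambda>x. (V x - E) * \<psi> x)"
    and F: "F differentiable (at x)"
  shows "\<psi> differentiable (at x)"
proof -
  have "(\<lambda>y. corrected \<psi> x y + \<psi> x * (F y - F x)) differentiable (at x)"
    by (intro differentiable_add differentiable_mult differentiable_diff differentiable_const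
        corrected_differentiable[OF \<psi>] F)
  then show ?thesis by (simp add: corrected_def)
qed

end

section \<open>The atomic Coulomb potential\<close>

lemma norm_projection_differentiable:
  fixes L :: "'a::real_normed_vector \<Rightarrow> 'b::real_inner"
  assumes L: "bounded_linear L" and x: "L x \<noteq> 0"
  shows "(\<lambda>y. norm (L y)) differentiable (at x)"
proof -
  have "((\<lambda>y. norm (L y)) has_derivative (\<lambda>h. L h \<bullet> sgn (L x))) (at x)"
    by (rule has_derivative_compose[OF bounded_linear_imp_has_derivative[OF L] has_derivative_norm[OF x]])
  then show ?thesis by (rule has_derivative_differentiable)
qed

definition average_decay :: "('a::euclidean_space \<Rightarrow> real) \<Rightarrow> bool" where
  "average_decay W \<longleftrightarrow> locally_integrable W \<and>
    (\<exists>K>0. \<forall>x. \<forall>t>0. (LINT y:cball x t|lborel. W y) \<le> K * (t ^ DIM('a) / t))"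

lemma average_decay_zero: "average_decay (\<lambda>x. 0)"
  unfolding average_decay_def by (auto intro!: locally_integrable_continuous exI[of _ 1] simp: set_lebesgue_integral_def)

lemma average_decay_add_cmult:
  fixes W W' :: "'a::euclidean_space \<Rightarrow> real"
  assumes W: "average_decay W" and W': "average_decay W'" and a: "a \<ge> 0"
  shows "average_decay (\<lambda>x. a * W x + W' x)"
proof -
  obtain K K' where K: "K > 0" "\<And>x t. t > 0 \<Longrightarrow> (LINT y:cball x t|lborel. W y) \<le> K * (t ^ DIM('a) / t)"
    and K': "K' > 0" "\<And>x t. t > 0 \<Longrightarrow> (LINT y:cball x t|lborel. W' y) \<le> K' * (t ^ DIM('a) / t)"
    using W W' unfolding average_decay_def by blast
  have li: "locally_integrable (\<lambda>x. a * W x)" "locally_integrable W'"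
    using W W' by (auto simp: average_decay_def intro: locally_integrable_cmult)
  have "(LINT y:cball x t|lborel. a * W y + W' y) \<le> (a * K + K') * (t ^ DIM('a) / t)" if t: "t > 0" for x t
  proof -
    have "(LINT y:cball x t|lborel. a * W y + W' y) = (LINT y:cball x t|lborel. a * W y) + (LINT y:cball x t|lborel. W' y)"
      using li by (intro set_integral_add) (auto simp: locally_integrable_def)
    also have "(LINT y:cball x t|lborel. a * W y) = a * (LINT y:cball x t|lborel. W y)" by (rule set_integral_mult_right)
    also have "\<dots> + (LINT y:cball x t|lborel. W' y) \<le> a * (K * (t ^ DIM('a) / t)) + K' * (t ^ DIM('a) / t)"
      by (intro add_mono mult_left_mono K(2) K'(2) t a)
    finally show ?thesis by (simp only: distrib_right mult.assoc)
  qed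
  moreover have "a * K + K' > 0" using a K K' by (simp add: add_nonneg_pos)
  ultimately show ?thesis unfolding average_decay_def using locally_integrable_add[OF li] by blast
qed

lemma average_decay_sum:
  assumes "finite I" "\<And>i. i \<in> I \<Longrightarrow> average_decay (W i)" "\<And>i. i \<in> I \<Longrightarrow> a i \<ge> 0"
  shows "average_decay (\<lambda>x. \<Sum>i\<in>I. a i * W i x)"
  using assms by (induction I rule: finite_induct) (auto intro: average_decay_zero average_decay_add_cmult)

text \<open>Everything is linear in the summands except the majorant and the Lipschitz constant,
  which take absolute values of the coefficients.\<close>

lemma coulomb_regularity_sum:
  fixes L :: "'i \<Rightarrow> 'a::euclidean_space \<Rightarrow> real^3" and a c :: "'i \<Rightarrow> real"
  assumes I: "finite I" and P: "\<And>i. i \<in> I \<Longrightarrow> similar_projection (L i) (c i)"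
  obtains W K l where
    "coulomb_regularity (\<lambda>x. \<Sum>i\<in>I. a i * norm (L i x)) (\<lambda>x. \<Sum>i\<in>I. a i * (2 * c i * (1 / norm (L i x)))) W K l"
proof -
  let ?F = "\<lambda>x. \<Sum>i\<in>I. a i * norm (L i x)" and ?V = "\<lambda>x. \<Sum>i\<in>I. a i * (2 * c i * (1 / norm (L i x)))"
  define W where "W x = (\<Sum>i\<in>I. \<bar>a i * (2 * c i)\<bar> * (1 / norm (L i x)))" for x
  have "average_decay W" unfolding W_def[abs_def]
    using coulomb_integral_cball[OF P] by (intro average_decay_sum I) (auto simp: average_decay_def)
  then obtain K where W: "locally_integrable W" and K: "K > 0"
    "\<And>x t. t > 0 \<Longrightarrow> (LINT y:cball x t|lborel. W y) \<le> K * (t ^ DIM('a) / t)"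
    unfolding average_decay_def by blast
  have bl: "bounded_linear (L i)" if "i \<in> I" for i using P[OF that] by (simp add: similar_projection_def)
  have "coulomb_regularity ?F ?V W K (\<Sum>i\<in>I. \<bar>a i\<bar> * onorm (L i))"
  proof
    show "weak_laplacian ?F ?V"
      by (intro weak_laplacian_sum weak_laplacian_cmult weak_laplacian_norm_projection P I)
    show "\<bar>?V y\<bar> \<le> W y" for y unfolding W_def
      by (rule order_trans[OF sum_abs]) (auto simp: abs_mult mult_ac intro!: sum_mono)
    show "\<bar>?F x - ?F y\<bar> \<le> (\<Sum>i\<in>I. \<bar>a i\<bar> * onorm (L i)) * norm (x - y)" for x y
    proof -
      have "\<bar>?F x - ?F y\<bar> = \<bar>\<Sum>i\<in>I. a i * (norm (L i x) - norm (L i y))\<bar>"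
        by (simp add: sum_subtractf right_diff_distrib)
      also have "\<dots> \<le> (\<Sum>i\<in>I. \<bar>a i * (norm (L i x) - norm (L i y))\<bar>)" by (rule sum_abs)
      also have "\<dots> \<le> (\<Sum>i\<in>I. \<bar>a i\<bar> * (onorm (L i) * norm (x - y)))"
        unfolding abs_mult by (intro sum_mono mult_left_mono norm_projection_lipschitz bl) auto
      finally show ?thesis by (simp add: sum_distrib_right mult.assoc)
    qed
    show "0 \<le> (\<Sum>i\<in>I. \<bar>a i\<bar> * onorm (L i))" by (intro sum_nonneg mult_nonneg_nonneg onorm_pos_le bl) auto
  qed (use W K in auto)
  then show thesis by (rule that)
qed

section \<open>Particle positions and differences as projections\<close>

lemma sum_inner_Basis_sq: "(\<Sum>b\<in>Basis. (w \<bullet> b)\<^sup>2) = (norm w)\<^sup>2" for w :: "'a::euclidean_space"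
  unfolding power2_norm_eq_inner by (subst euclidean_inner) (simp add: power2_eq_square)

text \<open>The adjoint of the projection to particle \<open>j\<close> is \<open>axis j\<close>, an
  isometry; Parseval's identity turns its norm into the sum over the basis.\<close>

lemma similar_projection_component: "similar_projection (\<lambda>x::'n::finite config. x $ j) 1"
proof -
  have "(\<Sum>b\<in>Basis. (v \<bullet> b $ j)\<^sup>2) = (norm v)\<^sup>2" for v :: "real^3"
    using sum_inner_Basis_sq[of "axis j v :: 'n config"]
    by (simp add: inner_axis' power2_norm_eq_inner[of "axis j v"] inner_axis_axis power2_norm_eq_inner)
  then show ?thesis by (auto simp: similar_projection_def intro: bounded_linear_vec_nth)
qed

text \<open>The adjoint sends \<open>v\<close> to \<open>axis j v - axis k v\<close>; for distinct
  indices the two terms are orthogonal, which produces the 2.\<close>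

lemma similar_projection_difference:
  assumes "j \<noteq> k" shows "similar_projection (\<lambda>x::'n::finite config. x $ j - x $ k) 2"
proof -
  have "(\<Sum>b\<in>Basis. (v \<bullet> (b $ j - b $ k))\<^sup>2) = 2 * (norm v)\<^sup>2" for v :: "real^3"
  proof -
    have "(\<Sum>b\<in>Basis. (v \<bullet> (b $ j - b $ k))\<^sup>2) = (norm (axis j v - axis k v :: 'n config))\<^sup>2"
      by (subst sum_inner_Basis_sq[symmetric]) (simp add: inner_diff_left inner_diff_right inner_axis')
    also have "\<dots> = 2 * (norm v)\<^sup>2"
      using assms by (simp add: power2_norm_eq_inner inner_diff_left inner_diff_right inner_axis_axis)
    finally show ?thesis .
  qed
  then show ?thesis
    by (auto simp: similar_projection_def intro!: bounded_linear_sub bounded_linear_vec_nth)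
qed

lemma coulomb_potential_regularity:
  obtains F W :: "'n::{finite,linorder} config \<Rightarrow> real" and K l where
    "coulomb_regularity F (coulomb_potential Z) W K l" "AE x in lebesgue. F differentiable (at x)"
proof -
  let ?pairs = "{(j, k). j < k} :: ('n \<times> 'n) set"
  \<comment> \<open>The disjoint sum collects nuclear attraction (left) and electron repulsion
    (right) in one family.\<close>
  define I where "I = (UNIV :: 'n set) <+> ?pairs"
  define L where "L i x = (case i of Inl j \<Rightarrow> x $ j | Inr (j, k) \<Rightarrow> x $ j - x $ k)"
    for i :: "'n + 'n \<times> 'n" and x :: "'n config"
  \<comment> \<open>Chosen so that \<open>a i * 2 * c i\<close> is \<open>- Z\<close> for the
    nucleus (\<open>c i = 1\<close>) and 1 for a pair (\<open>c i = 2\<close>).\<close>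
  define a where "a i = (case i of Inl _ \<Rightarrow> - (Z / 2) | Inr _ \<Rightarrow> 1 / 4)" for i :: "'n + 'n \<times> 'n"
  define c :: "'n + 'n \<times> 'n \<Rightarrow> real" where "c i = (case i of Inl _ \<Rightarrow> 1 | Inr _ \<Rightarrow> 2)" for i
  have I: "finite I" by (simp add: I_def)
  have P: "similar_projection (L i) (c i)" if "i \<in> I" for i
    using that by (auto simp: I_def L_def[abs_def] c_def
        intro!: similar_projection_component similar_projection_difference)
  have V: "(\<lambda>x. \<Sum>i\<in>I. a i * (2 * c i * (1 / norm (L i x)))) = coulomb_potential Z"
  proof
    fix x
    show "(\<Sum>i\<in>I. a i * (2 * c i * (1 / norm (L i x)))) = coulomb_potential Z x"
      unfolding I_def by (subst sum.Plus)
        (auto simp: a_def c_def L_def coulomb_potential_def case_prod_unfold sum_negf intro!: sum.cong)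
  qed
  define F where "F x = (\<Sum>i\<in>I. a i * norm (L i x))" for x
  obtain W K l where reg: "coulomb_regularity F (coulomb_potential Z) W K l"
    using coulomb_regularity_sum[where I=I and L=L and c=c and a=a, OF I P] unfolding V F_def[abs_def] by blast
  have "AE x in lborel. \<forall>i\<in>I. L i x \<noteq> 0"
    using I similar_projection_AE_nonzero[OF P] by (simp add: AE_finite_all)
  then have "AE x in lborel. F differentiable (at x)"
  proof eventually_elim
    case (elim x)
    have "(\<lambda>y. norm (L i y)) differentiable (at x)" if "i \<in> I" for i
      using elim P[OF that] that by (intro norm_projection_differentiable) (auto simp: similar_projection_def)
    then have "(\<lambda>y. \<Sum>i\<in>I. a i * norm (L i y)) differentiable (at x)"
      using I by (intro differentiable_sum differentiable_mult differentiable_const) auto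
    then show ?case by (simp add: F_def[abs_def])
  qed
  then have "AE x in lebesgue. F differentiable (at x)" by (rule AE_completion)
  with reg show thesis by (rule that)
qed

section \<open>The gradient\<close>

text \<open>Uniqueness of the derivative settles the definite description in
  \<open>gradient\<close>; the coordinate formula is there for measurability.\<close>

lemma gradient_works:
  fixes f :: "'a::euclidean_space \<Rightarrow> real"
  assumes "f differentiable (at x)"
  shows "(f has_derivative (\<lambda>h. h \<bullet> gradient f x)) (at x)"
    "gradient f x = (\<Sum>b\<in>Basis. partial_deriv b f x *\<^sub>R b)"
proof -
  let ?D = "\<Sum>b\<in>Basis. partial_deriv b f x *\<^sub>R b"
  have D: "GDERIV f x :> ?D"
    using partial_deriv_works[OF assms] by (simp add: gderiv_def inner_sum_right mult.commute)
  have "D = ?D" if "GDERIV f x :> D" for D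
  proof -
    have "(\<lambda>h. h \<bullet> D) = (\<lambda>h. h \<bullet> ?D)"
      using that D unfolding gderiv_def by (rule has_derivative_unique)
    from fun_cong[OF this] show ?thesis by (subst vector_eq_ldot[symmetric]) blast
  qed
  with D show "gradient f x = ?D" unfolding gradient_def by blast
  with D show "(f has_derivative (\<lambda>h. h \<bullet> gradient f x)) (at x)" by (simp add: gderiv_def)
qed

text \<open>The derivative is evaluated in the direction of the gradient itself. Where the gradient
  is 0 the claim is \<open>0 \<le> l\<close>, which the hypothesis yields at a nearby point.\<close>

lemma gradient_le_local_lipschitz:
  fixes f :: "'a::euclidean_space \<Rightarrow> real"
  assumes "f differentiable (at x)" "d > 0" "\<And>z. norm (z - x) < d \<Longrightarrow> \<bar>f z - f x\<bar> \<le> l * norm (z - x)"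
  shows "norm (gradient f x) \<le> l"
proof -
  let ?D = "gradient f x"
  have "\<bar>?D \<bullet> ?D\<bar> \<le> l * norm ?D"
    by (rule derivative_le_local_lipschitz[OF gradient_works(1)[OF assms(1)] assms(2,3)])
  then have "norm ?D * norm ?D \<le> l * norm ?D" by (simp add: power2_norm_eq_inner[symmetric] power2_eq_square)
  moreover have "0 \<le> l"
  proof -
    obtain b :: 'a where b: "b \<in> Basis" using nonempty_Basis by blast
    have "\<bar>f (x + (d / 2) *\<^sub>R b) - f x\<bar> \<le> l * (d / 2)"
      using assms(3)[of "x + (d / 2) *\<^sub>R b"] assms(2) b by simp
    then have "0 \<le> l * (d / 2)" by linarith
    then show ?thesis using assms(2) by (simp add: zero_le_mult_iff)
  qed
  ultimately show ?thesis by (cases "?D = 0") auto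
qed

text \<open>Sequential limits of difference quotients define a Borel function on the whole space,
  and it equals the gradient wherever \<open>f\<close> is differentiable. The essential supremum
  bound relies on this.\<close>

lemma gradient_measurable:
  fixes f :: "'a::euclidean_space \<Rightarrow> real"
  assumes f: "continuous_on UNIV f" and d: "AE x in lebesgue. f differentiable (at x)"
  shows "gradient f \<in> borel_measurable lebesgue"
proof -
  have [measurable]: "f \<in> borel_measurable borel" using f by (rule borel_measurable_continuous_onI)
  define g where "g x = (\<Sum>b\<in>Basis. lim (\<lambda>k. (f (x + (1 / real (Suc k)) *\<^sub>R b) - f x) * real (Suc k)) *\<^sub>R b)" for x
  have "g \<in> borel_measurable borel" unfolding g_def[abs_def]
    by (intro borel_measurable_sum borel_measurable_scaleR borel_measurable_lim_metric) measurable
  then have "g \<in> borel_measurable lebesgue" by (auto intro: measurable_completion)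
  moreover have "AE x in lebesgue. g x = gradient f x" using d
  proof eventually_elim
    case (elim x)
    show ?case unfolding g_def gradient_works(2)[OF elim]
      by (intro sum.cong refl arg_cong2[where f=scaleR] limI difference_quotient_tendsto elim)
  qed
  ultimately show ?thesis by (rule borel_measurable_AE)
qed

theorem theorem1p2:
  fixes Z E :: real
    and \<psi> :: "'n::{finite,linorder} config \<Rightarrow> real"
  assumes "Z > 0"
    and "continuous_on UNIV \<psi>"
    and "((\<lambda>x. complex_of_real (\<psi> x)), (\<lambda>x. complex_of_real (E * \<psi> x))) \<in> hamiltonian Z"
    and "L2_norm (\<lambda>x. complex_of_real (\<psi> x)) = 1"
  shows "(AE x in lebesgue. \<psi> differentiable (at x)) \<and>
    (\<forall>R>0. \<exists>C::real. \<forall>x.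
       esssup (lebesgue_on (ball x R)) (\<lambda>y. ereal (norm (gradient \<psi> y)))
         \<le> ereal C * (SUP y\<in>ball x (2 * R). ereal \<bar>\<psi> y\<bar>))"
proof -
  obtain F W :: "'n config \<Rightarrow> real" and K l where reg: "coulomb_regularity F (coulomb_potential Z) W K l"
    and F: "AE x in lebesgue. F differentiable (at x)"
    by (rule coulomb_potential_regularity)
  interpret coulomb_regularity F "coulomb_potential Z" W K l by (rule reg)
  have wl: "weak_laplacian \<psi> (\<lambda>x. (coulomb_potential Z x - E) * \<psi> x)"
    using lap_F by (intro hamiltonian_weak_laplacian assms(2,3)) (simp add: weak_laplacian_def)
  have diff: "AE x in lebesgue. \<psi> differentiable (at x)"
    using F by eventually_elim (rule solution_differentiable[OF assms(2) wl])
  have "\<exists>C::real. \<forall>x. esssup (lebesgue_on (ball x R)) (\<lambda>y. ereal (norm (gradient \<psi> y)))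
         \<le> ereal C * (SUP y\<in>ball x (2 * R). ereal \<bar>\<psi> y\<bar>)" if R: "R > 0" for R
  proof -
    \<comment> \<open>For \<open>y\<close> in \<open>ball x R\<close> the Lipschitz bound at
      \<open>y\<close> uses \<psi> on \<open>cball y (4 * (R / 5))\<close>, which fits into
      \<open>ball x (2 * R)\<close> because \<open>R + 4 R / 5 < 2 R\<close>.\<close>
    have R5: "R / 5 > 0" using R by simp
    obtain C where C: "C > 0" and lip: "\<And>(\<psi> :: 'n config \<Rightarrow> real) x z M. continuous_on UNIV \<psi> \<Longrightarrow>
        weak_laplacian \<psi> (\<lambda>x. (coulomb_potential Z x - E) * \<psi> x) \<Longrightarrow>
        (\<And>y. y \<in> cball x (4 * (R / 5)) \<Longrightarrow> \<bar>\<psi> y\<bar> \<le> M) \<Longrightarrow> norm (z - x) \<le> R / 5 \<Longrightarrow>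
        \<bar>\<psi> z - \<psi> x\<bar> \<le> C * M * norm (z - x)"
      using local_lipschitz[OF R5, of E] by blast
    have "esssup (lebesgue_on (ball x R)) (\<lambda>y. ereal (norm (gradient \<psi> y)))
        \<le> ereal C * (SUP y\<in>ball x (2 * R). ereal \<bar>\<psi> y\<bar>)" for x
    \<comment> \<open>If the supremum is infinite, so is the right side, since \<open>C > 0\<close>;
      a zero constant would give 0 in the extended reals.\<close>
    proof (cases "(SUP y\<in>ball x (2 * R). ereal \<bar>\<psi> y\<bar>) = \<infinity>")
      case True
      then show ?thesis using C by simp
    next
      case False
      let ?S = "SUP y\<in>ball x (2 * R). ereal \<bar>\<psi> y\<bar>"
      have up: "ereal \<bar>\<psi> y\<bar> \<le> ?S" if "y \<in> ball x (2 * R)" for y using that by (rule SUP_upper)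
      have "0 \<le> ?S" using up[of x] R by (simp add: order_trans[of 0 "ereal \<bar>\<psi> x\<bar>"])
      then obtain M where M: "?S = ereal M" using False by (cases ?S) auto
      have \<psi>M: "\<bar>\<psi> y\<bar> \<le> M" if "y \<in> ball x (2 * R)" for y using up[OF that] M by simp
      have grad: "norm (gradient \<psi> y) \<le> C * M" if y: "y \<in> ball x R" and d: "\<psi> differentiable (at y)" for y
      proof (rule gradient_le_local_lipschitz[OF d R5])
        fix z assume "norm (z - y) < R / 5"
        moreover have "\<bar>\<psi> u\<bar> \<le> M" if "u \<in> cball y (4 * (R / 5))" for u
          using that y R dist_triangle[of x u y] by (intro \<psi>M) auto
        ultimately show "\<bar>\<psi> z - \<psi> y\<bar> \<le> C * M * norm (z - y)" by (intro lip assms(2) wl) auto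
      qed
      have "esssup (lebesgue_on (ball x R)) (\<lambda>y. ereal (norm (gradient \<psi> y))) \<le> ereal (C * M)"
      proof (rule esssup_I)
        have "gradient \<psi> \<in> borel_measurable (lebesgue_on (ball x R))"
          by (rule measurable_restrict_space1[OF gradient_measurable[OF assms(2) diff]])
        then show "(\<lambda>y. ereal (norm (gradient \<psi> y))) \<in> borel_measurable (lebesgue_on (ball x R))" by measurable
        show "AE y in lebesgue_on (ball x R). ereal (norm (gradient \<psi> y)) \<le> ereal (C * M)"
          using diff by (subst AE_restrict_space_iff) (auto elim!: eventually_mono intro: grad)
      qed
      then show ?thesis using M by simp
    qed
    then show ?thesis by blast
  qed
  with diff show ?thesis by blast
qed

end
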